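(* If an entire algebraic function on $\mathbb C^N$ can be represented as a composition of polynomials and entire algebraic functions of one variable, then its local monodromy group at each point of $\mathbb C^N$ is solvable.
   Context: An entire algebraic function $y$ on $\mathbb C^N$ is the multivalued function defined by an irreducible equation $y^n+f_{n-1}y^{n-1}+\dots+f_0=0$ whose coefficients $f_i$ are polynomials on $\mathbb C^N$; it can be viewed as a continuous multivalued function with finitely many values. Local monodromy group at $p\in\mathbb C^N$: it is the monodromy group of the defining equation in an arbitrarily small neighborhood (ball) $B$ of $p$, i.e. the image of $\pi_1(B\setminus\Sigma,x_0)$, where $\Sigma$ is the zero set of the discriminant of the equation and $x_0\in B\setminus\Sigma$, in the group of permutations of the $n$ analytic germs at $x_0$ satisfying the equation, the homomorphism being given by analytic continuation along loops. Composition of polynomials and entire algebraic functions of one variable: functions obtained, starting from polynomials on $\mathbb C^N$, by finitely many applications of polynomials in several variables to already constructed functions (in particular sums and products) and of compositions $\varphi\circ f$ of an entire algebraic function $\varphi$ of one variable with an already constructed function $f$. Operations on multivalued functions are performed on germs: the result is any multivalued function generated by analytic continuation from the germ obtained by applying the operation to some germs of the given functions at a common point. *)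

theory Defs
  imports
    "HOL-Analysis.Analysis"
    "HOL-Library.Poly_Mapping"
    "HOL-Algebra.Bij"
    "HOL-Algebra.Solvable_Groups"
    "Subresultants.Resultant_Prelim"
begin

section \<open>Polynomials in several variables and monic equations over them\<close>

text \<open>
  A polynomial with variables indexed by \<open>'v\<close> is a finitely supported family of coefficients
  indexed by finitely supported exponents. With this representation
  \<open>'n::finite mvpoly\<close> is the ring \<open>\<complex>[x\<^sub>1, \<dots>, x\<^sub>N]\<close>, where \<open>N = CARD('n)\<close>, and
  \<open>'n mvpoly poly\<close> is \<open>\<complex>[x\<^sub>1, \<dots>, x\<^sub>N][y]\<close>.
\<close>

type_synonym 'v mvpoly = "('v \<Rightarrow>\<^sub>0 nat) \<Rightarrow>\<^sub>0 complex"

definition eval_mvpoly :: "('v \<Rightarrow> complex) \<Rightarrow> 'v mvpoly \<Rightarrow> complex" where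
  "eval_mvpoly x p =
     (\<Sum>m\<in>Poly_Mapping.keys p.
        Poly_Mapping.lookup p m * (\<Prod>i\<in>Poly_Mapping.keys m. x i ^ Poly_Mapping.lookup m i))"

definition vars_mvpoly :: "'v mvpoly \<Rightarrow> 'v set" where
  "vars_mvpoly p = (\<Union>m\<in>Poly_Mapping.keys p. Poly_Mapping.keys m)"

definition poly_fun :: "'n::finite mvpoly \<Rightarrow> complex^'n \<Rightarrow> complex" where
  "poly_fun p x = eval_mvpoly (vec_nth x) p"

definition equation_at :: "'n::finite mvpoly poly \<Rightarrow> complex^'n \<Rightarrow> complex poly" where
  "equation_at P x = map_poly (\<lambda>c. poly_fun c x) P"

text \<open>
  For a monic equation, irreducibility in \<open>\<complex>[x\<^sub>1, \<dots>, x\<^sub>N][y]\<close> and in \<open>\<complex>(x\<^sub>1, \<dots>, x\<^sub>N)[y]\<close> agree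
  by Gauss's lemma, and the degree is positive because \<open>1\<close> is a unit.
\<close>

definition entire_algebraic_equation :: "'n::finite mvpoly poly \<Rightarrow> bool" where
  "entire_algebraic_equation P \<longleftrightarrow> lead_coeff P = 1 \<and> Factorial_Ring.irreducible P"

definition discriminant :: "'a::field poly \<Rightarrow> 'a" where
  "discriminant p =
     (-1) ^ (degree p * (degree p - 1) div 2) * resultant p (pderiv p) / lead_coeff p"

text \<open>
  For monic \<open>P\<close> the degree of \<open>equation_at P x\<close> does not depend on \<open>x\<close>, so its discriminant is
  the value at \<open>x\<close> of the discriminant of \<open>P\<close> with respect to \<open>y\<close>.
\<close>

definition discriminant_locus :: "'n::finite mvpoly poly \<Rightarrow> (complex^'n) set" where
  "discriminant_locus P = {x. discriminant (equation_at P x) = 0}"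


section \<open>Analytic germs and analytic continuation\<close>

definition holomorphic_several_on :: "(complex^'n::finite \<Rightarrow> complex) \<Rightarrow> (complex^'n) set \<Rightarrow> bool" where
  "holomorphic_several_on f U \<longleftrightarrow> open U \<and>
     (\<forall>x\<in>U. \<exists>D. (f has_derivative D) (at x) \<and> (\<forall>c v. D (c *s v) = c * D v))"

text \<open>The germ of \<open>f\<close> at \<open>a\<close>, as the class of all functions that agree with \<open>f\<close> near \<open>a\<close>.\<close>

type_synonym 'n germ = "(complex^'n \<Rightarrow> complex) set"

definition germ_at :: "complex^'n::finite \<Rightarrow> (complex^'n \<Rightarrow> complex) \<Rightarrow> 'n germ" where
  "germ_at a f = {g. \<forall>\<^sub>F x in nhds a. g x = f x}"

text \<open>
  \<open>continues_along \<gamma> g h\<close>: the analytic germ \<open>g\<close> at \<open>\<gamma> 0\<close> admits an analytic continuation along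
  the path \<open>\<gamma>\<close>, which ends with the germ \<open>h\<close> at \<open>\<gamma> 1\<close>.
\<close>

definition continues_along ::
  "(real \<Rightarrow> complex^'n::finite) \<Rightarrow> 'n germ \<Rightarrow> 'n germ \<Rightarrow> bool" where
  "continues_along \<gamma> g h \<longleftrightarrow> path \<gamma> \<and>
     (\<exists>G. G 0 = g \<and> G 1 = h \<and>
       (\<forall>t\<in>{0..1}. \<exists>U f. holomorphic_several_on f U \<and> \<gamma> t \<in> U \<and>
          (\<exists>e>0. \<forall>s\<in>{0..1}. \<bar>s - t\<bar> < e \<longrightarrow> \<gamma> s \<in> U \<and> G s = germ_at (\<gamma> s) f)))"

text \<open>
  A multivalued analytic function is represented by the set of all its analytic germs, each
  paired with its base point.
\<close>

type_synonym 'n multifun = "((complex^'n) \<times> 'n germ) set"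

definition generated_multifun :: "complex^'n::finite \<Rightarrow> 'n germ \<Rightarrow> 'n multifun" where
  "generated_multifun a g =
     {(b, h). \<exists>\<gamma>. pathstart \<gamma> = a \<and> pathfinish \<gamma> = b \<and> continues_along \<gamma> g h}"

definition solution_germs :: "'n::finite mvpoly poly \<Rightarrow> complex^'n \<Rightarrow> 'n germ set" where
  "solution_germs P x =
     {germ_at x f | f. \<exists>U. holomorphic_several_on f U \<and> x \<in> U \<and>
                          (\<forall>z\<in>U. poly (equation_at P z) (f z) = 0)}"

definition algebraic_multifun :: "'n::finite mvpoly poly \<Rightarrow> 'n multifun" where
  "algebraic_multifun P = {(x, g). g \<in> solution_germs P x}"


section \<open>Compositions of polynomials and entire algebraic functions of one variable\<close>

text \<open>
  Functions of one variable live on \<open>complex^1\<close>; \<open>\<chi> _. w\<close> is the point of \<open>complex^1\<close> with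
  coordinate \<open>w\<close>. In rule \<open>polynomial\<close> the germs may be chosen independently of each other, even
  when some of the multivalued functions \<open>F i\<close> coincide.
\<close>

inductive_set compositions :: "('n::finite) multifun set" where
  base: "generated_multifun a (germ_at a (poly_fun p)) \<in> compositions"
| polynomial:
    "\<lbrakk>vars_mvpoly q \<subseteq> {..<k};
      \<And>i::nat. i < k \<Longrightarrow> F i \<in> compositions;
      \<And>i. i < k \<Longrightarrow> (a, germ_at a (f i)) \<in> F i\<rbrakk>
     \<Longrightarrow> generated_multifun a (germ_at a (\<lambda>x. eval_mvpoly (\<lambda>i. f i x) q)) \<in> compositions"
| algebraic:
    "\<lbrakk>entire_algebraic_equation (Q :: 1 mvpoly poly);
      F \<in> compositions;
      (a, germ_at a f) \<in> F;
      ((\<chi> _. f a), germ_at (\<chi> _. f a) \<phi>) \<in> algebraic_multifun Q\<rbrakk>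
     \<Longrightarrow> generated_multifun a (germ_at a (\<lambda>x. \<phi> (\<chi> _. f x))) \<in> compositions"


section \<open>Monodromy\<close>

text \<open>
  The image of the fundamental group of \<open>B - discriminant_locus P\<close> with base point \<open>x\<^sub>0\<close> in the
  group of permutations of the solution germs at \<open>x\<^sub>0\<close>: a permutation belongs to it iff it is
  analytic continuation along some loop.
\<close>

definition monodromy_group ::
  "'n::finite mvpoly poly \<Rightarrow> (complex^'n) set \<Rightarrow> complex^'n \<Rightarrow> ('n germ \<Rightarrow> 'n germ) monoid" where
  "monodromy_group P B x\<^sub>0 = (BijGroup (solution_germs P x\<^sub>0))
     \<lparr>carrier :=
        {\<sigma> \<in> Bij (solution_germs P x\<^sub>0).
           \<exists>\<gamma>. path \<gamma> \<and> path_image \<gamma> \<subseteq> B - discriminant_locus P \<and>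
               pathstart \<gamma> = x\<^sub>0 \<and> pathfinish \<gamma> = x\<^sub>0 \<and>
               (\<forall>g\<in>solution_germs P x\<^sub>0. continues_along \<gamma> g (\<sigma> g))}\<rparr>"

text \<open>
  Solvability of the monodromy group in an arbitrarily small ball around \<open>p\<close>: it is required for
  all sufficiently small radii and every base point.
\<close>

definition solvable_local_monodromy_at :: "'n::finite mvpoly poly \<Rightarrow> complex^'n \<Rightarrow> bool" where
  "solvable_local_monodromy_at P p \<longleftrightarrow>
     (\<forall>\<^sub>F r in at_right 0. \<forall>x\<^sub>0 \<in> ball p r - discriminant_locus P.
        solvable (monodromy_group P (ball p r) x\<^sub>0))"

end

theory Submission
  imports Defs "HOL-Complex_Analysis.Complex_Analysis" "Jordan_Normal_Form.Char_Poly" "Subresultants.Subresultant_Gcd" "HOL-Computational_Algebra.Field_as_Ring"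
begin

text \<open>
  A small disc in \<open>\<complex>\<close> contains at most one branch point of an entire algebraic function \<open>\<phi>\<close> of one
  variable. So the local monodromy of \<open>\<phi>\<close> is cyclic, and commutators of loops act trivially. Let \<open>f\<close>
  be an entire algebraic function on \<open>\<complex>\<^sup>N\<close>. Near a point \<open>p\<close> all values of \<open>f\<close> are close to its finitely
  many values at \<open>p\<close>. If two loops near \<open>p\<close> lead every branch of \<open>f\<close> back to itself, then each branch
  carries both of them to loops in one small disc around a value at \<open>p\<close>, and their commutator leads
  every branch of \<open>\<phi> \<circ> f\<close> back to itself. If all loops in the \<open>d\<close>-th derived group act trivially on
  \<open>f\<close>, then all loops in the next derived group act trivially on \<open>\<phi> \<circ> f\<close>. Polynomials in several
  functions do not increase the depth beyond the maximum. By induction over the construction of a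
  composition, its local monodromy groups have derived series that end in the trivial group.

  To make this precise, germs are replaced by values. Each composition is integral over the
  polynomials on \<open>\<complex>\<^sup>N\<close>: a composition of integral functions generates a finite module, and the
  characteristic polynomial of a multiplication matrix is the equation sought
  (\<open>integral_over_if_stable_span\<close>). Where a monic equation has its maximal number of distinct roots,
  these roots form a covering space (\<open>covering_space_root_cover\<close>), so that continuation along paths is
  the lifting of paths, which is unique and invariant under homotopy. The exceptional sets that
  loops have to avoid are \<open>thin\<close>: a complex line either is contained in them or meets them in
  finitely many points. Balls without thin sets are therefore path connected
  (\<open>path_connected_ball_minus_thin\<close>). The predicate \<open>tame\<close> collects these data together with the
  condition on iterated commutators of loops; it is inherited by polynomials in tame functions
  (\<open>tame_polynomial\<close>) and by entire algebraic functions of a tame function (\<open>tame_composition\<close>). In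
  the latter case constant branches of \<open>f\<close> need care, since their value may be a branch point of
  \<open>\<phi>\<close>, which no change of the loop would avoid.

  The loops that define the monodromy group of \<open>P\<close> avoid its discriminant, but may meet the exceptional
  set of the construction. Analytic continuation along such a loop has the same effect as
  continuation along a loop off that set (\<open>simultaneously_reached_continuation\<close>). This translates the
  statement about loops into one about the derived series of the monodromy group
  (\<open>solvable_monodromy_group\<close>).
\<close>

section \<open>The generic number of roots of a polynomial with a parameter\<close>

lemma card_roots_le_degree:
  fixes p :: "complex poly"
  assumes "p \<noteq> 0"
  shows "finite {y. poly p y = 0}" "card {y. poly p y = 0} \<le> degree p"
  using poly_roots_finite[OF assms] card_poly_roots_bound[OF assms] by auto

text \<open>
  Among the divisors of \<open>R\<close> with the same prime factors as \<open>R\<close>, one of least degree is squarefree: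
  a repeated prime factor could be removed once without losing a prime factor.
\<close>

lemma squarefree_part_exists:
  fixes R :: "complex poly poly"
  assumes "R \<noteq> 0"
  obtains S k where "S dvd R" "R dvd S ^ k" "\<And>q. prime_elem q \<Longrightarrow> degree q > 0 \<Longrightarrow> \<not> q ^ 2 dvd S"
proof -
  define good where "good = (\<lambda>S. S dvd R \<and> (\<exists>k. R dvd S ^ k))"
  have "good R" unfolding good_def by (auto intro: exI[of _ 1])
  then obtain S where S: "good S" and min: "\<And>S'. good S' \<Longrightarrow> degree S \<le> degree S'"
    using exists_least_iff[of "\<lambda>n. \<exists>S. good S \<and> degree S = n"] by (metis not_le_imp_less)
  then obtain k where k: "R dvd S ^ k" and SR: "S dvd R" by (auto simp: good_def)
  have "\<not> q ^ 2 dvd S" if q: "prime_elem q" "degree q > 0" for q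
  proof
    assume "q ^ 2 dvd S"
    then obtain u where u: "S = q ^ 2 * u" by (elim dvdE)
    have "S \<noteq> 0" using SR assms by auto
    then have u0: "u \<noteq> 0" "q \<noteq> 0" using u by auto
    have "S dvd (q * u) ^ 2" unfolding u by (simp add: power_mult_distrib power2_eq_square)
    then have "S ^ k dvd ((q * u) ^ 2) ^ k" by (rule dvd_power_same)
    then have "R dvd (q * u) ^ (2 * k)" using k by (metis dvd_trans power_mult)
    moreover have "q * u dvd R" using SR unfolding u power2_eq_square
      by (metis dvd_mult_right dvd_trans dvd_triv_right mult.assoc)
    ultimately have "good (q * u)" unfolding good_def by blast
    from min[OF this] have "degree S \<le> degree (q * u)" .
    moreover have "degree S = degree q + degree (q * u)"
      unfolding u using u0 by (simp add: degree_mult_eq power2_eq_square)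
    ultimately show False using q by simp
  qed
  with SR k that show ?thesis by blast
qed

text \<open>
  A nonzero resultant excludes common roots of \<open>p\<close> and its derivative, so all roots are simple.
\<close>

lemma resultant_nonzero_card_roots:
  fixes p :: "complex poly"
  assumes "resultant p (pderiv p) \<noteq> 0" "p \<noteq> 0"
  shows "card {y. poly p y = 0} = degree p"
proof -
  have "degree (gcd p (pderiv p)) = 0"
    using assms resultant_0_gcd[of p "pderiv p"] by blast
  then have "is_unit (gcd p (pderiv p))"
    using assms by (simp add: is_unit_iff_degree)
  then have "rsquarefree p"
    unfolding rsquarefree_roots
    by (metis gcd_greatest_iff is_unit_gcd_iff is_unit_pCons_iff one_neq_zero pCons_one poly_eq_0_iff_dvd)
  then have "Polynomial.smult (lead_coeff p) (\<Prod>z|poly p z = 0. [:-z, 1:]) = p"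
    by (rule complex_poly_decompose_rsquarefree)
  then have "degree p = degree (\<Prod>z|poly p z = 0. [:-z, 1:])"
    using assms(2) by (metis degree_smult_eq leading_coeff_0_iff)
  also have "\<dots> = card {z. poly p z = 0}"
    by (subst degree_prod_eq_sum_degree) auto
  finally show ?thesis by simp
qed

abbreviation specialise :: "complex poly poly \<Rightarrow> complex \<Rightarrow> complex poly" where
  "specialise R t \<equiv> map_poly (\<lambda>c. poly c t) R"

lemma comm_ring_hom_poly_at: "comm_ring_hom (\<lambda>c. poly c (t::complex))"
  by unfold_locales auto

text \<open>
  The squarefree part \<open>S\<close> of \<open>R\<close> over \<open>\<complex>[t]\<close> has the same roots as \<open>R\<close> for every value of \<open>t\<close>.
  Its resultant with its derivative is a nonzero polynomial in \<open>t\<close>: a common prime factor would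
  divide \<open>S\<close> twice. Outside the zeros of this polynomial the roots of \<open>S\<close> are simple, hence
  \<open>degree S\<close> in number, and nowhere are there more.
\<close>

lemma generic_number_of_roots:
  fixes R :: "complex poly poly"
  assumes "lead_coeff R = 1"
  shows "\<exists>m E. finite E \<and> (\<forall>t. card {y. poly (specialise R t) y = 0} \<le> m) \<and>
    (\<forall>t. t \<notin> E \<longrightarrow> card {y. poly (specialise R t) y = 0} = m)"
proof -
  have "R \<noteq> 0" using assms by auto
  then obtain S k where SR: "S dvd R" and RS: "R dvd S ^ k"
    and sqf: "\<And>q. prime_elem q \<Longrightarrow> degree q > 0 \<Longrightarrow> \<not> q ^ 2 dvd S"
    using squarefree_part_exists by metis
  have unit_lead: "is_unit (lead_coeff q)" if "q dvd R" for q
    using that assms by (elim dvdE) (metis dvd_triv_left lead_coeff_mult)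
  have S0: "S \<noteq> 0" using SR \<open>R \<noteq> 0\<close> by auto
  define r where "r = resultant S (pderiv S)"
  have r0: "r \<noteq> 0"
  proof
    assume "r = 0"
    then have deg: "degree (gcd S (pderiv S)) \<noteq> 0"
      unfolding r_def by (simp add: resultant_0_gcd)
    then have "gcd S (pderiv S) \<noteq> 0" "\<not> is_unit (gcd S (pderiv S))"
      by (auto simp: S0 elim!: is_unit_polyE)
    then obtain q where q: "prime_elem q" "q dvd gcd S (pderiv S)"
      by (metis prime_divisor_exists prime_def)
    have qS: "q dvd S" "q dvd pderiv S" using q(2) by auto
    then have "is_unit (lead_coeff q)" using unit_lead SR by (meson dvd_trans)
    then have dq: "degree q > 0"
      using prime_elem_not_unit[OF q(1)]
      by (metis degree_eq_zeroE gr0I is_unit_const_poly_iff lead_coeff_pCons(2) pCons_0_0 not_is_unit_0)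
    obtain u where u: "S = q * u" using qS by (elim dvdE)
    have "q dvd pderiv q * u"
      using qS(2) unfolding u pderiv_mult by (metis dvd_add_right_iff dvd_triv_left mult.commute)
    moreover have "\<not> q dvd pderiv q"
    proof
      assume "q dvd pderiv q"
      moreover have "pderiv q \<noteq> 0" using dq by (simp add: pderiv_eq_0_iff)
      ultimately have "degree q \<le> degree (pderiv q)" by (rule dvd_imp_degree_le)
      then show False using dq by (simp add: degree_pderiv)
    qed
    ultimately have "q dvd u" using q(1) by (simp add: prime_elem_dvd_mult_iff)
    then have "q ^ 2 dvd S" unfolding u power2_eq_square by simp
    then show False using sqf[OF q(1) dq] by blast
  qed
  (* Divisors of a monic polynomial have constant leading coefficients, so specialising t
     preserves degrees and commutes with the resultant. *)
  have lead_at: "poly (lead_coeff S) t \<noteq> 0" for t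
    using unit_lead[OF SR] by (metis not_is_unit_0 poly_hom.hom_dvd_1)
  have degS: "degree (specialise S t) = degree S" for t
    by (rule degree_map_poly) (auto simp: lead_at S0)
  have degS': "degree (specialise (pderiv S) t) = degree (pderiv S)" for t
  proof (cases "degree S = 0")
    case True
    then show ?thesis by (metis degree_0 map_poly_0 pderiv_eq_0_iff)
  next
    case False
    then have "coeff (pderiv S) (degree (pderiv S)) = of_nat (degree S) * lead_coeff S"
      by (simp add: degree_pderiv coeff_pderiv)
    then show ?thesis using False by (intro degree_map_poly) (auto simp: lead_at)
  qed
  have roots: "{y. poly (specialise R t) y = 0} = {y. poly (specialise S t) y = 0}" for t
  proof -
    interpret comm_ring_hom "\<lambda>c. poly c t" by (rule comm_ring_hom_poly_at)
    interpret mp: map_poly_comm_ring_hom "\<lambda>c. poly c t" ..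
    have "specialise S t dvd specialise R t" using SR by (rule mp.hom_dvd)
    moreover have "specialise R t dvd specialise S t ^ k" using mp.hom_dvd[OF RS] by (simp add: mp.hom_power)
    ultimately show ?thesis by (auto elim!: dvdE simp: poly_power)
       (metis mult_eq_0_iff poly_mult poly_power power_not_zero)
  qed
  show ?thesis
  proof (intro exI[of _ "{t. poly r t = 0}"] exI[of _ "degree S"] conjI allI impI)
    show "finite {t. poly r t = 0}" using r0 by (rule poly_roots_finite)
    have ne: "specialise S t \<noteq> 0" for t
      using lead_at[of t] by (metis coeff_0 coeff_map_poly poly_0)
    show "card {y. poly (specialise R t) y = 0} \<le> degree S" for t
      using card_roots_le_degree(2)[OF ne] unfolding roots degS .
    show "card {y. poly (specialise R t) y = 0} = degree S" if t: "t \<notin> {t. poly r t = 0}" for t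
    proof -
      have "pderiv (specialise S t) = specialise (pderiv S) t"
        by (intro poly_eqI) (simp add: coeff_pderiv coeff_map_poly)
      then have "resultant (specialise S t) (pderiv (specialise S t)) = poly r t"
        unfolding r_def using comm_ring_hom.resultant_map_poly[OF comm_ring_hom_poly_at degS degS'] by simp
      then show ?thesis unfolding roots
        using resultant_nonzero_card_roots[OF _ ne] t degS by simp
    qed
  qed
qed

section \<open>Roots of monic families as covering spaces\<close>

text \<open>
  The degree is positive so that every fibre contains a root.
\<close>

definition monic_family :: "('a::real_normed_vector \<Rightarrow> complex poly) \<Rightarrow> nat \<Rightarrow> bool" where
  "monic_family R n \<longleftrightarrow> n > 0 \<and> (\<forall>x. degree (R x) = n \<and> lead_coeff (R x) = 1) \<and>
     (\<forall>i. continuous_on UNIV (\<lambda>x. coeff (R x) i))"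

abbreviation roots :: "complex poly \<Rightarrow> complex set" where
  "roots p \<equiv> {y. poly p y = 0}"

text \<open>
  The points at which the number of distinct roots is not maximal. Multiplicities are ignored, so
  the branch locus is a proper subset even if the discriminant vanishes identically.
\<close>

definition branch_locus :: "('a \<Rightarrow> complex poly) \<Rightarrow> 'a set" where
  "branch_locus R = {x. \<exists>x'. card (roots (R x)) < card (roots (R x'))}"

lemma monic_familyD:
  assumes "monic_family R n"
  shows "n > 0" "degree (R x) = n" "lead_coeff (R x) = 1" "continuous_on UNIV (\<lambda>x. coeff (R x) i)"
  using assms unfolding monic_family_def by blast+

lemma monic_family_nonzero: "monic_family R n \<Longrightarrow> R x \<noteq> 0"
  unfolding monic_family_def by (metis leading_coeff_0_iff zero_neq_one)

lemma monic_family_finite_roots: "monic_family R n \<Longrightarrow> finite (roots (R x))"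
  using monic_family_nonzero poly_roots_finite by blast

lemma monic_family_root_exists:
  assumes "monic_family R n" obtains y where "poly (R x) y = 0"
proof -
  have "\<not> constant (poly (R x))"
    using assms by (simp add: monic_family_def constant_degree)
  then show ?thesis using fundamental_theorem_of_algebra that by blast
qed

lemma continuous_on_poly_family:
  assumes "monic_family R n" "continuous_on S f" "continuous_on S g"
  shows "continuous_on S (\<lambda>x. poly (R (f x)) (g x))"
proof -
  have "poly (R x) y = (\<Sum>i\<le>n. coeff (R x) i * y ^ i)" for x y
    using assms(1) unfolding monic_family_def by (metis poly_altdef)
  moreover have "continuous_on S (\<lambda>x. coeff (R (f x)) i)" for i
    using assms continuous_on_compose2[of UNIV "\<lambda>x. coeff (R x) i" S f]
    unfolding monic_family_def by auto
  ultimately show ?thesis using assms(3) by (auto intro!: continuous_intros)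
qed

text \<open>
  The value of a monic polynomial at \<open>y\<close> is the product of the differences of \<open>y\<close> and the roots.
\<close>

lemma monic_poly_far_from_roots:
  fixes p :: "complex poly"
  assumes "lead_coeff p = 1" and far: "\<And>w. poly p w = 0 \<Longrightarrow> e \<le> dist y w" and "0 \<le> e"
  shows "e ^ degree p \<le> norm (poly p y)"
proof -
  obtain as where as: "Polynomial.smult (lead_coeff p) (\<Prod>a\<leftarrow>as. [:- a, 1:]) = p" "length as = degree p"
    using fundamental_theorem_algebra_factorized[of p] by auto
  have p: "p = (\<Prod>a\<leftarrow>as. [:- a, 1:])" using as assms(1) by simp
  have "e ^ length bs \<le> norm (poly (\<Prod>a\<leftarrow>bs. [:- a, 1:]) y)" if "set bs \<subseteq> set as" for bs
    using that
  proof (induction bs)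
    case (Cons b bs)
    have "poly p b = 0" unfolding p using Cons.prems by (auto simp: poly_prod_list prod_list_zero_iff)
    then have "e \<le> norm (y - b)" using far by (simp add: dist_norm)
    moreover have "e ^ length bs \<le> norm (poly (\<Prod>a\<leftarrow>bs. [:- a, 1:]) y)" using Cons by simp
    ultimately have "e * e ^ length bs \<le> norm (y - b) * norm (poly (\<Prod>a\<leftarrow>bs. [:- a, 1:]) y)"
      using assms(3) by (intro mult_mono) auto
    then show ?case by (simp add: norm_mult[symmetric] algebra_simps)
  qed simp
  from this[of as] show ?thesis using as(2) p by simp
qed

text \<open>
  By continuity \<open>R x\<close> is small at a root of \<open>R x0\<close>, and a monic polynomial is small only near its
  roots.
\<close>

lemma nearby_root_exists:
  assumes R: "monic_family R n" and y: "poly (R x0) y = 0" and e: "e > 0"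
  shows "\<forall>\<^sub>F x in nhds x0. \<exists>y'. poly (R x) y' = 0 \<and> dist y' y < e"
proof -
  have "continuous_on UNIV (\<lambda>x. poly (R x) y)"
    by (intro continuous_on_poly_family[OF R] continuous_intros)
  then have "((\<lambda>x. poly (R x) y) \<longlongrightarrow> 0) (nhds x0)"
    using y by (metis UNIV_I continuous_on_eq_continuous_at isCont_def open_UNIV tendsto_at_iff_tendsto_nhds)
  then have "\<forall>\<^sub>F x in nhds x0. dist (poly (R x) y) 0 < e ^ n"
    using e by (intro tendstoD) auto
  then show ?thesis
  proof eventually_elim
    case (elim x)
    show ?case
    proof (rule ccontr)
      assume "\<not> ?thesis"
      then have "e ^ degree (R x) \<le> norm (poly (R x) y)"
        using R e by (intro monic_poly_far_from_roots) (auto simp: monic_family_def dist_commute not_less)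
      then show False using elim R by (simp add: monic_family_def)
    qed
  qed
qed

lemma monic_poly_split:
  fixes p :: "complex poly"
  assumes "degree p = n" "lead_coeff p = 1"
  shows "poly p y = (\<Sum>i<n. coeff p i * y ^ i) + y ^ n"
  using assms unfolding poly_altdef by (auto simp: lessThan_Suc_atMost[symmetric])

text \<open>
  The estimate is uniform in \<open>y\<close>. If \<open>y\<close> is at distance at least \<open>e\<close> from all roots of \<open>R p\<close>, then
  each of these distances is at least \<open>\<kappa> * (1 + norm y)\<close>, so \<open>R p\<close> is at least
  \<open>(\<kappa> * (1 + norm y)) ^ n\<close> at \<open>y\<close>. The difference of the monic polynomials \<open>R p\<close> and \<open>R x\<close> has degree
  less than \<open>n\<close>, and is smaller than this once the coefficients are close enough.
\<close>

lemma all_roots_near: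
  assumes R: "monic_family R n" and e: "e > 0"
  shows "\<forall>\<^sub>F x in nhds p. \<forall>y. poly (R x) y = 0 \<longrightarrow> (\<exists>w. poly (R p) w = 0 \<and> dist y w < e)"
proof -
  define W where "W = roots (R p)"
  have W: "finite W" unfolding W_def by (rule monic_family_finite_roots[OF R])
  define K where "K = (\<Sum>w\<in>W. norm w)"
  have K: "norm w \<le> K" if "w \<in> W" for w unfolding K_def using that W by (simp add: member_le_sum)
  have K0: "K \<ge> 0" unfolding K_def by (simp add: sum_nonneg)
  define \<kappa> where "\<kappa> = 1 / ((1 + K) / e + 1)"
  have \<kappa>: "\<kappa> > 0" unfolding \<kappa>_def using e K0 by (simp add: add_nonneg_pos)
  define \<Delta> where "\<Delta> = (\<lambda>x. \<Sum>i<n. norm (coeff (R p) i - coeff (R x) i))"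
  have "isCont (\<lambda>x. coeff (R x) i) p" for i
    using R by (metis UNIV_I continuous_on_eq_continuous_at monic_family_def open_UNIV)
  then have "isCont \<Delta> p" unfolding \<Delta>_def by (auto intro!: continuous_intros)
  then have "(\<Delta> \<longlongrightarrow> 0) (nhds p)"
    unfolding isCont_def tendsto_at_iff_tendsto_nhds by (simp add: \<Delta>_def)
  then have "\<forall>\<^sub>F x in nhds p. \<bar>\<Delta> x\<bar> < \<kappa> ^ n"
    using \<kappa> tendstoD[of \<Delta> 0 "nhds p" "\<kappa> ^ n"] by simp
  then show ?thesis
  proof eventually_elim
    case (elim x)
    show ?case
    proof (intro allI impI)
      fix y assume y: "poly (R x) y = 0"
      show "\<exists>w. poly (R p) w = 0 \<and> dist y w < e"
      proof (rule ccontr)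
        assume "\<not> ?thesis"
        then have far: "dist y w \<ge> e" if "poly (R p) w = 0" for w
          using that by (auto simp: not_less)
        have "\<kappa> * (1 + norm y) \<le> dist y w" if w: "poly (R p) w = 0" for w
        proof -
          have "norm y \<le> norm w + dist y w" by (metis dist_norm norm_triangle_sub)
          moreover have "norm w \<le> K" using K w by (simp add: W_def)
          moreover have "(1 + K) * e \<le> (1 + K) * dist y w"
            using far[OF w] K0 by (intro mult_left_mono) auto
          then have "1 + K \<le> (1 + K) / e * dist y w" using e by (simp add: field_simps)
          ultimately have "1 + norm y \<le> ((1 + K) / e + 1) * dist y w"
            by (simp add: algebra_simps)
          moreover have "(1 + K) / e + 1 > 0" using e K0 by (simp add: add_nonneg_pos)
          ultimately show ?thesis unfolding \<kappa>_def by (simp add: field_simps)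
        qed
        then have "(\<kappa> * (1 + norm y)) ^ degree (R p) \<le> norm (poly (R p) y)"
          using monic_familyD(3)[OF R] \<kappa> by (intro monic_poly_far_from_roots) auto
        then have low: "\<kappa> ^ n * (1 + norm y) ^ n \<le> norm (poly (R p) y)"
          using R by (simp add: monic_family_def power_mult_distrib)
        note split = monic_poly_split[OF monic_familyD(2,3)[OF R], of _ y]
        have "poly (R p) y = poly (R p) y - poly (R x) y" using y by simp
        also have "\<dots> = (\<Sum>i<n. (coeff (R p) i - coeff (R x) i) * y ^ i)"
          unfolding split by (simp add: sum_subtractf algebra_simps)
        also have "norm \<dots> \<le> (\<Sum>i<n. norm (coeff (R p) i - coeff (R x) i) * (1 + norm y) ^ n)"
        proof (rule sum_norm_le)
          fix i assume "i \<in> {..<n}"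
          then have "norm y ^ i \<le> (1 + norm y) ^ n"
            by (meson lessThan_iff le_add_same_cancel1 le_add_same_cancel2 less_imp_le norm_ge_zero
                order_trans power_increasing power_mono zero_le_one)
          then show "norm ((coeff (R p) i - coeff (R x) i) * y ^ i)
              \<le> norm (coeff (R p) i - coeff (R x) i) * (1 + norm y) ^ n"
            by (simp add: norm_mult norm_power mult_left_mono)
        qed
        also have "\<dots> = \<Delta> x * (1 + norm y) ^ n" unfolding \<Delta>_def by (simp add: sum_distrib_right)
        also have "\<dots> < \<kappa> ^ n * (1 + norm y) ^ n"
          using elim by (intro mult_strict_right_mono) (auto simp: add_pos_nonneg)
        finally show False using low by simp
      qed
    qed
  qed
qed

lemma disjoint_balls_around_points:
  fixes W :: "complex set"
  assumes "finite W"
  shows "\<exists>e>0. \<forall>v\<in>W. \<forall>w\<in>W. \<forall>y. dist y v < e \<longrightarrow> dist y w < e \<longrightarrow> v = w"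
proof -
  define D where "D = insert 1 ((\<lambda>(v, w). dist v w) ` (W \<times> W) - {0})"
  have D: "finite D" "D \<noteq> {}" "\<And>d. d \<in> D \<Longrightarrow> d > 0" unfolding D_def using assms by auto
  show ?thesis
  proof (intro exI[of _ "Min D / 2"] conjI ballI allI impI)
    show "Min D / 2 > 0" using D by simp
    fix v w y assume *: "v \<in> W" "w \<in> W" "dist y v < Min D / 2" "dist y w < Min D / 2"
    then have lt: "dist v w < Min D" by (metis dist_commute dist_triangle_half_r)
    show "v = w"
    proof (rule ccontr)
      assume "v \<noteq> w"
      then have "dist v w \<in> D" using * by (force simp: D_def)
      then show False using D(1) lt by (meson Min_le not_le)
    qed
  qed
qed

text \<open>
  The pigeonhole principle: the disjoint balls around the roots of \<open>R x0\<close> contain a root of \<open>R x\<close>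
  each. If \<open>R x\<close> has no more roots than \<open>R x0\<close>, then these are all its roots.
\<close>

lemma unique_nearby_roots:
  assumes R: "monic_family R n" and e: "e > 0"
    and sep: "\<And>v w y. poly (R x0) v = 0 \<Longrightarrow> poly (R x0) w = 0 \<Longrightarrow> dist y v < e \<Longrightarrow> dist y w < e \<Longrightarrow> v = w"
    and near: "\<And>w. poly (R x0) w = 0 \<Longrightarrow> \<exists>y. poly (R x) y = 0 \<and> dist y w < e"
  shows "card (roots (R x0)) \<le> card (roots (R x))"
    and "\<And>y. card (roots (R x)) \<le> card (roots (R x0)) \<Longrightarrow> poly (R x) y = 0 \<Longrightarrow>
           \<exists>w. poly (R x0) w = 0 \<and> dist y w < e"
    and "\<And>w. card (roots (R x)) \<le> card (roots (R x0)) \<Longrightarrow> poly (R x0) w = 0 \<Longrightarrow>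
           \<exists>!y. poly (R x) y = 0 \<and> dist y w < e"
proof -
  obtain s where s: "poly (R x0) w = 0 \<Longrightarrow> poly (R x) (s w) = 0 \<and> dist (s w) w < e" for w
    using near by metis
  have inj: "inj_on s (roots (R x0))" using s sep by (auto intro!: inj_onI) metis
  have sub: "s ` roots (R x0) \<subseteq> roots (R x)" using s by auto
  show 1: "card (roots (R x0)) \<le> card (roots (R x))"
    using inj sub monic_family_finite_roots[OF R] by (metis card_inj_on_le)
  have img: "\<exists>w. poly (R x0) w = 0 \<and> y = s w"
    if le: "card (roots (R x)) \<le> card (roots (R x0))" and y: "poly (R x) y = 0" for y
  proof -
    have "card (s ` roots (R x0)) = card (roots (R x))"
      using 1 le inj by (simp add: card_image)
    then have "s ` roots (R x0) = roots (R x)"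
      using sub monic_family_finite_roots[OF R] by (intro card_subset_eq) auto
    moreover have "y \<in> roots (R x)" using y by simp
    ultimately have "y \<in> s ` roots (R x0)" by simp
    then show ?thesis by auto
  qed
  show "\<exists>w. poly (R x0) w = 0 \<and> dist y w < e"
    if "card (roots (R x)) \<le> card (roots (R x0))" "poly (R x) y = 0" for y
    using img[OF that] s by blast
  show "\<exists>!y. poly (R x) y = 0 \<and> dist y w < e"
    if le: "card (roots (R x)) \<le> card (roots (R x0))" and w: "poly (R x0) w = 0" for w
  proof (rule ex1I[of _ "s w"])
    show "poly (R x) (s w) = 0 \<and> dist (s w) w < e" using s[OF w] .
    fix y assume y: "poly (R x) y = 0 \<and> dist y w < e"
    then obtain v where v: "poly (R x0) v = 0" "y = s v" using img[OF le] by blast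
    have "dist y v < e" using s[OF v(1)] v(2) by simp
    then have "v = w" using sep[OF v(1) w] y by blast
    then show "y = s w" using v by simp
  qed
qed

lemma eventually_all_roots_persist:
  assumes R: "monic_family R n" and e: "e > 0"
  shows "\<forall>\<^sub>F x in nhds x0. \<forall>w. poly (R x0) w = 0 \<longrightarrow> (\<exists>y. poly (R x) y = 0 \<and> dist y w < e)"
proof -
  have "\<forall>\<^sub>F x in nhds x0. \<forall>w\<in>roots (R x0). \<exists>y. poly (R x) y = 0 \<and> dist y w < e"
  proof (rule eventually_ball_finite)
    show "finite (roots (R x0))" by (rule monic_family_finite_roots[OF R])
    show "\<forall>w\<in>roots (R x0). \<forall>\<^sub>F x in nhds x0. \<exists>y. poly (R x) y = 0 \<and> dist y w < e"
      using nearby_root_exists[OF R _ e] by blast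
  qed
  then show ?thesis by simp
qed

lemma separated_roots:
  assumes "monic_family R n"
  shows "\<exists>e>0. \<forall>v w y. poly (R x0) v = 0 \<longrightarrow> poly (R x0) w = 0 \<longrightarrow> dist y v < e \<longrightarrow> dist y w < e \<longrightarrow> v = w"
  using disjoint_balls_around_points[OF monic_family_finite_roots[OF assms, of x0]] by simp

lemma closed_branch_locus:
  assumes R: "monic_family R n"
  shows "closed (branch_locus R)"
proof -
  have "\<forall>\<^sub>F x in nhds x0. x \<in> - branch_locus R" if x0: "x0 \<in> - branch_locus R" for x0
  proof -
    obtain e where e: "e > 0"
      "\<forall>v w y. poly (R x0) v = 0 \<longrightarrow> poly (R x0) w = 0 \<longrightarrow> dist y v < e \<longrightarrow> dist y w < e \<longrightarrow> v = w"
      using separated_roots[OF R] by blast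
    have "\<forall>\<^sub>F x in nhds x0. \<forall>w. poly (R x0) w = 0 \<longrightarrow> (\<exists>y. poly (R x) y = 0 \<and> dist y w < e)"
      by (rule eventually_all_roots_persist[OF R e(1)])
    then show ?thesis
    proof eventually_elim
      case (elim x)
      have "card (roots (R x0)) \<le> card (roots (R x))"
        using e(2) elim by (intro unique_nearby_roots(1)[OF R e(1)]) blast+
      moreover have "card (roots (R x')) \<le> card (roots (R x0))" for x'
        using x0 unfolding branch_locus_def by (simp add: not_less)
      ultimately show ?case unfolding branch_locus_def
        by (simp add: not_less) (meson order_trans)
    qed
  qed
  then have "\<exists>T. open T \<and> x0 \<in> T \<and> T \<subseteq> - branch_locus R" if "x0 \<in> - branch_locus R" for x0
    using that unfolding eventually_nhds by (metis subsetI)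
  then have "open (- branch_locus R)" by (subst open_subopen) blast
  then show ?thesis by (simp add: closed_def)
qed

definition root_cover :: "('a \<Rightarrow> complex poly) \<Rightarrow> ('a \<times> complex) set" where
  "root_cover R = {(x, y). x \<notin> branch_locus R \<and> poly (R x) y = 0}"

text \<open>
  Near a point where the number of distinct roots is maximal, every root has exactly one
  continuation in a small ball around it. These continuations form the sheets.
\<close>

lemma covering_space_root_cover:
  assumes R: "monic_family R n"
  shows "covering_space (root_cover R) fst (- branch_locus R)"
proof
  show "continuous_on (root_cover R) fst" by (intro continuous_intros)
  show "fst ` root_cover R = - branch_locus R"
  proof -
    have "x \<in> fst ` root_cover R" if "x \<notin> branch_locus R" for x
    proof -
      obtain y where "poly (R x) y = 0" by (rule monic_family_root_exists[OF R])
      then have "(x, y) \<in> root_cover R" using that by (simp add: root_cover_def)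
      then show ?thesis by (rule image_eqI[rotated]) simp
    qed
    then show ?thesis by (auto simp: root_cover_def)
  qed
  fix x0 assume x0: "x0 \<in> - branch_locus R"
  obtain e where e: "e > 0"
    "\<forall>v w y. poly (R x0) v = 0 \<longrightarrow> poly (R x0) w = 0 \<longrightarrow> dist y v < e \<longrightarrow> dist y w < e \<longrightarrow> v = w"
    using separated_roots[OF R] by blast
  have "\<forall>\<^sub>F x in nhds x0. x \<in> - branch_locus R"
    using closed_branch_locus[OF R] x0 by (intro eventually_nhds_in_open) auto
  moreover note eventually_all_roots_persist[OF R e(1), of x0]
  ultimately have "\<forall>\<^sub>F x in nhds x0. x \<in> - branch_locus R \<and> (\<forall>w. poly (R x0) w = 0 \<longrightarrow> (\<exists>y. poly (R x) y = 0 \<and> dist y w < e))"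
    by eventually_elim simp
  then obtain T where T: "open T" "x0 \<in> T"
    and T1: "\<And>x. x \<in> T \<Longrightarrow> x \<in> - branch_locus R"
    and T2: "\<And>x w. x \<in> T \<Longrightarrow> poly (R x0) w = 0 \<Longrightarrow> \<exists>y. poly (R x) y = 0 \<and> dist y w < e"
    unfolding eventually_nhds by blast
  have le: "card (roots (R x)) \<le> card (roots (R x0))" for x
    using x0 unfolding branch_locus_def by (auto simp: not_less)
  have near: "\<exists>w. poly (R x0) w = 0 \<and> dist y w < e" if "x \<in> T" "poly (R x) y = 0" for x y
    using unique_nearby_roots(2)[OF R e(1) _ T2[OF that(1)] le that(2)] e(2) by blast
  have uniq: "\<exists>!y. poly (R x) y = 0 \<and> dist y w < e" if "x \<in> T" "poly (R x0) w = 0" for x w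
    using unique_nearby_roots(3)[OF R e(1) _ T2[OF that(1)] le that(2)] e(2) by blast
  define sheet where "sheet = (\<lambda>w. root_cover R \<inter> (T \<times> ball w e))"
  show "\<exists>T. x0 \<in> T \<and> openin (top_of_set (- branch_locus R)) T \<and>
      (\<exists>v. \<Union>v = root_cover R \<inter> fst -` T \<and> (\<forall>u\<in>v. openin (top_of_set (root_cover R)) u) \<and>
        pairwise disjnt v \<and> (\<forall>u\<in>v. \<exists>q. homeomorphism u T fst q))"
  proof (intro exI[of _ T] conjI exI[of _ "sheet ` roots (R x0)"] ballI)
    show "x0 \<in> T" by fact
    show "openin (top_of_set (- branch_locus R)) T"
      using T T1 closed_branch_locus[OF R] by (simp add: openin_open_eq open_Compl subset_eq)
    show "\<Union> (sheet ` roots (R x0)) = root_cover R \<inter> fst -` T"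
    proof (intro equalityI subsetI)
      fix z assume z: "z \<in> root_cover R \<inter> fst -` T"
      then obtain w where "poly (R x0) w = 0" "dist (snd z) w < e"
        using near[of "fst z" "snd z"] by (auto simp: root_cover_def)
      then have "w \<in> roots (R x0)" "z \<in> sheet w" using z by (auto simp: sheet_def mem_Times_iff dist_commute)
      then show "z \<in> \<Union> (sheet ` roots (R x0))" by blast
    qed (auto simp: sheet_def)
    show "pairwise disjnt (sheet ` roots (R x0))"
    proof (rule pairwise_imageI)
      fix v w assume "v \<in> roots (R x0)" "w \<in> roots (R x0)" "v \<noteq> w"
      then have "\<not> (dist y v < e \<and> dist y w < e)" for y using e(2) by blast
      then show "disjnt (sheet v) (sheet w)"
        by (auto simp: disjnt_def sheet_def dist_commute)
    qed
    fix u assume "u \<in> sheet ` roots (R x0)"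
    then obtain w where u: "u = sheet w" and w: "poly (R x0) w = 0" by auto
    show "openin (top_of_set (root_cover R)) u"
      unfolding u sheet_def using T by (intro openin_open_Int open_Times) auto
    (* The sheet over T is the graph of the function that selects the root in the ball around w. *)
    define s where "s = (\<lambda>x. THE y. poly (R x) y = 0 \<and> dist y w < e)"
    have s: "poly (R x) (s x) = 0" "dist (s x) w < e" if "x \<in> T" for x
      using theI'[OF uniq[OF that w]] unfolding s_def by auto
    have s_eq: "y = s x" if "x \<in> T" "poly (R x) y = 0" "dist y w < e" for x y
      using uniq[OF that(1) w] s[OF that(1)] that by blast
    have "isCont s x1" if x1: "x1 \<in> T" for x1
      unfolding isCont_def tendsto_at_iff_tendsto_nhds
    proof (rule tendstoI)
      fix d :: real assume d: "d > 0"
      define d' where "d' = min d (e - dist (s x1) w)"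
      have d': "d' > 0" using d s[OF x1] by (simp add: d'_def)
      have "\<forall>\<^sub>F x in nhds x1. x \<in> T" using T x1 by (intro eventually_nhds_in_open) auto
      then show "\<forall>\<^sub>F x in nhds x1. dist (s x) (s x1) < d"
        using nearby_root_exists[OF R s(1)[OF x1] d']
      proof eventually_elim
        case (elim x)
        then obtain y where y: "poly (R x) y = 0" "dist y (s x1) < d'" by blast
        have "dist y w < e" using y(2) dist_triangle[of y w "s x1"] by (simp add: d'_def)
        then have "y = s x" using s_eq elim y by blast
        then show ?case using y by (simp add: d'_def)
      qed
    qed
    then have cont: "continuous_on T s" by (simp add: continuous_at_imp_continuous_on)
    show "\<exists>q. homeomorphism u T fst q"
    proof (intro exI[of _ "\<lambda>x. (x, s x)"] homeomorphismI)
      show "continuous_on u fst" by (intro continuous_intros)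
      show "continuous_on T (\<lambda>x. (x, s x))" using cont by (intro continuous_intros)
      show "fst ` u \<subseteq> T" by (auto simp: u sheet_def)
      show "(\<lambda>x. (x, s x)) ` T \<subseteq> u" using s T1 by (auto simp: u sheet_def root_cover_def dist_commute)
      show "(fst z, s (fst z)) = z" if "z \<in> u" for z
        using that s_eq by (auto simp: u sheet_def root_cover_def dist_commute)
    qed auto
  qed
qed

section \<open>Transport of roots along paths\<close>

text \<open>
  The root \<open>y\<close> at the start of \<open>\<gamma>\<close> can be continued along \<open>\<gamma>\<close> to the root \<open>z\<close> at its end. Off the branch
  locus this is the lifting of paths to \<open>root_cover R\<close>; it replaces the analytic continuation of
  germs, which off the branch locus are determined by their values.
\<close>

definition transports :: "('a \<Rightarrow> complex poly) \<Rightarrow> (real \<Rightarrow> 'a) \<Rightarrow> complex \<Rightarrow> complex \<Rightarrow> bool" where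
  "transports R \<gamma> y z \<longleftrightarrow> (\<exists>h. path h \<and> pathstart h = y \<and> pathfinish h = z \<and>
     (\<forall>t\<in>{0..1}. poly (R (\<gamma> t)) (h t) = 0))"

lemma transportsI:
  "path h \<Longrightarrow> (\<And>t. t \<in> {0..1} \<Longrightarrow> poly (R (\<gamma> t)) (h t) = 0) \<Longrightarrow> transports R \<gamma> (pathstart h) (pathfinish h)"
  unfolding transports_def by blast

lemma transports_exists:
  assumes R: "monic_family R n" and \<gamma>: "path \<gamma>" "path_image \<gamma> \<subseteq> - branch_locus R"
    and y: "poly (R (pathstart \<gamma>)) y = 0"
  shows "\<exists>z. transports R \<gamma> y z"
proof -
  have "(pathstart \<gamma>, y) \<in> root_cover R"
    using \<gamma> y by (auto simp: root_cover_def)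
  then obtain h where h: "path h" "path_image h \<subseteq> root_cover R" "pathstart h = (pathstart \<gamma>, y)"
    "\<And>t. t \<in> {0..1} \<Longrightarrow> fst (h t) = \<gamma> t"
    using covering_space_lift_path_strong[OF covering_space_root_cover[OF R] _ \<gamma>, of "(pathstart \<gamma>, y)"]
    by auto
  have "transports R \<gamma> (pathstart (snd \<circ> h)) (pathfinish (snd \<circ> h))"
  proof (rule transportsI)
    show "path (snd \<circ> h)" using h(1) by (auto simp: path_def intro!: continuous_intros continuous_on_compose)
    fix t :: real assume t: "t \<in> {0..1}"
    then have "h t \<in> root_cover R" using h(2) by (auto simp: path_image_def)
    then show "poly (R (\<gamma> t)) ((snd \<circ> h) t) = 0" using h(4)[OF t] by (auto simp: root_cover_def)
  qed
  then show ?thesis using h(3) by (auto simp: pathstart_compose)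
qed

lemma transports_homotopic:
  assumes R: "monic_family R n" and hom: "homotopic_paths (- branch_locus R) \<gamma>1 \<gamma>2"
    and 1: "transports R \<gamma>1 y z1" and 2: "transports R \<gamma>2 y z2"
  shows "z1 = z2"
proof -
  obtain h1 where h1: "path h1" "pathstart h1 = y" "pathfinish h1 = z1" "\<forall>t\<in>{0..1}. poly (R (\<gamma>1 t)) (h1 t) = 0"
    using 1 unfolding transports_def by blast
  obtain h2 where h2: "path h2" "pathstart h2 = y" "pathfinish h2 = z2" "\<forall>t\<in>{0..1}. poly (R (\<gamma>2 t)) (h2 t) = 0"
    using 2 unfolding transports_def by blast
  have p: "path \<gamma>1" "path \<gamma>2" and im: "path_image \<gamma>1 \<subseteq> - branch_locus R" "path_image \<gamma>2 \<subseteq> - branch_locus R"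
    using homotopic_paths_imp_path[OF hom] homotopic_paths_imp_subset[OF hom] by auto
  have "pathfinish (\<lambda>t. (\<gamma>1 t, h1 t)) = pathfinish (\<lambda>t. (\<gamma>2 t, h2 t))"
  proof (rule covering_space_monodromy[OF covering_space_root_cover[OF R] p(1) im(1) p(2) im(2) hom])
    show "path (\<lambda>t. (\<gamma>1 t, h1 t))" "path (\<lambda>t. (\<gamma>2 t, h2 t))"
      using p h1 h2 by (auto simp: path_def intro!: continuous_intros)
    show "path_image (\<lambda>t. (\<gamma>1 t, h1 t)) \<subseteq> root_cover R" "path_image (\<lambda>t. (\<gamma>2 t, h2 t)) \<subseteq> root_cover R"
      using im h1 h2 by (auto simp: path_image_def root_cover_def)
    show "pathstart (\<lambda>t. (\<gamma>1 t, h1 t)) = pathstart (\<lambda>t. (\<gamma>2 t, h2 t))"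
      using homotopic_paths_imp_pathstart[OF hom] h1 h2 by (auto simp: pathstart_def)
  qed auto
  then show ?thesis using h1 h2 by (auto simp: pathfinish_def)
qed

lemma transports_unique:
  assumes "monic_family R n" "path \<gamma>" "path_image \<gamma> \<subseteq> - branch_locus R"
    and "transports R \<gamma> y z1" "transports R \<gamma> y z2"
  shows "z1 = z2"
  using assms by (intro transports_homotopic[of R n \<gamma> \<gamma> y]) (auto simp: homotopic_paths_refl)

lemma lift_join:
  assumes "pathfinish h1 = pathstart h2"
    and "\<And>t. t \<in> {0..1} \<Longrightarrow> poly (R (\<gamma>1 t)) (h1 t) = 0" "\<And>t. t \<in> {0..1} \<Longrightarrow> poly (R (\<gamma>2 t)) (h2 t) = 0"
    and "t \<in> {0..1}"
  shows "poly (R ((\<gamma>1 +++ \<gamma>2) t)) ((h1 +++ h2) t) = 0"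
  using assms by (auto simp: joinpaths_def)

lemma lift_reversepath:
  assumes "\<And>t. t \<in> {0..1} \<Longrightarrow> poly (R (\<gamma> t)) (h t) = 0" and "t \<in> {0..1}"
  shows "poly (R (reversepath \<gamma> t)) (reversepath h t) = 0"
  using assms by (auto simp: reversepath_def)

lemma transports_join:
  assumes "transports R \<gamma>1 x y" "transports R \<gamma>2 y z"
  shows "transports R (\<gamma>1 +++ \<gamma>2) x z"
proof -
  obtain h1 h2 where h: "path h1" "pathstart h1 = x" "pathfinish h1 = y" "\<forall>t\<in>{0..1}. poly (R (\<gamma>1 t)) (h1 t) = 0"
     "path h2" "pathstart h2 = y" "pathfinish h2 = z" "\<forall>t\<in>{0..1}. poly (R (\<gamma>2 t)) (h2 t) = 0"
    using assms unfolding transports_def by metis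
  have "transports R (\<gamma>1 +++ \<gamma>2) (pathstart (h1 +++ h2)) (pathfinish (h1 +++ h2))"
    using h by (intro transportsI lift_join) auto
  then show ?thesis using h by simp
qed

lemma transports_reversepath:
  assumes "transports R \<gamma> x y"
  shows "transports R (reversepath \<gamma>) y x"
proof -
  obtain h where h: "path h" "pathstart h = x" "pathfinish h = y" "\<forall>t\<in>{0..1}. poly (R (\<gamma> t)) (h t) = 0"
    using assms unfolding transports_def by metis
  have "transports R (reversepath \<gamma>) (pathstart (reversepath h)) (pathfinish (reversepath h))"
    using h by (intro transportsI lift_reversepath) auto
  then show ?thesis using h by simp
qed

lemma transports_const:
  "(\<And>t. t \<in> {0..1} \<Longrightarrow> poly (R (\<gamma> t)) c = 0) \<Longrightarrow> transports R \<gamma> c c"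
  using transportsI[of "\<lambda>_. c" R \<gamma>] by (simp add: path_def pathstart_def pathfinish_def)

lemma transports_subpath:
  assumes "path h" "\<And>t. t \<in> {0..1} \<Longrightarrow> poly (R (\<gamma> t)) (h t) = 0" "u \<in> {0..1}" "v \<in> {0..1}"
  shows "transports R (subpath u v \<gamma>) (h u) (h v)"
proof -
  have "transports R (subpath u v \<gamma>) (pathstart (subpath u v h)) (pathfinish (subpath u v h))"
  proof (rule transportsI)
    show "path (subpath u v h)" using assms by (simp add: path_subpath)
    fix t :: real assume t: "t \<in> {0..1}"
    have "(v - u) * t + u = (1 - t) *\<^sub>R u + t *\<^sub>R v" by (simp add: algebra_simps)
    also have "\<dots> \<in> {0..1}" using t assms(3,4) by (intro convexD) auto
    finally show "poly (R (subpath u v \<gamma> t)) (subpath u v h t) = 0"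
      using assms(2) by (simp add: subpath_def)
  qed
  then show ?thesis by simp
qed

section \<open>Polynomials on lines and thin sets\<close>

lemma continuous_on_line:
  fixes u v :: "complex^'n::finite"
  assumes "continuous_on S f"
  shows "continuous_on S (\<lambda>x. u + f x *s v)"
  unfolding vector_scalar_mult_def using assms by (auto intro!: continuous_intros)

text \<open>
  Polynomial on every complex line. Being closed under sums and products, these functions can
  serve as the coefficient ring of all equations below, and restriction to lines reduces statements
  about their zeros to polynomials in one variable.
\<close>

definition linewise_polynomial :: "(complex^'n::finite \<Rightarrow> complex) \<Rightarrow> bool" where
  "linewise_polynomial c \<longleftrightarrow> continuous_on UNIV c \<and> (\<forall>u v. \<exists>p. \<forall>t. c (u + t *s v) = poly p t)"

lemma linewise_polynomial_const [simp]: "linewise_polynomial (\<lambda>_. a)"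
  unfolding linewise_polynomial_def by (auto intro!: exI[of _ "[:a:]"])

lemma linewise_polynomial_coord [simp]: "linewise_polynomial (\<lambda>x::complex^'n::finite. vec_nth x i)"
  unfolding linewise_polynomial_def
proof (intro conjI allI)
  fix u v :: "complex^'n"
  show "\<exists>p. \<forall>t. vec_nth (u + t *s v) i = poly p t"
    by (rule exI[of _ "[:vec_nth u i, vec_nth v i:]"]) simp
qed (intro continuous_intros)

lemma linewise_polynomial_add [intro]:
  assumes "linewise_polynomial c" "linewise_polynomial d"
  shows "linewise_polynomial (\<lambda>x. c x + d x)"
  unfolding linewise_polynomial_def
proof (intro conjI allI)
  fix u v
  obtain p q where "\<forall>t. c (u + t *s v) = poly p t" "\<forall>t. d (u + t *s v) = poly q t"
    using assms unfolding linewise_polynomial_def by blast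
  then show "\<exists>p. \<forall>t. c (u + t *s v) + d (u + t *s v) = poly p t"
    by (auto intro!: exI[of _ "p + q"])
qed (use assms in \<open>auto simp: linewise_polynomial_def intro: continuous_intros\<close>)

lemma linewise_polynomial_mult [intro]:
  assumes "linewise_polynomial c" "linewise_polynomial d"
  shows "linewise_polynomial (\<lambda>x. c x * d x)"
  unfolding linewise_polynomial_def
proof (intro conjI allI)
  fix u v
  obtain p q where "\<forall>t. c (u + t *s v) = poly p t" "\<forall>t. d (u + t *s v) = poly q t"
    using assms unfolding linewise_polynomial_def by blast
  then show "\<exists>p. \<forall>t. c (u + t *s v) * d (u + t *s v) = poly p t"
    by (auto intro!: exI[of _ "p * q"])
qed (use assms in \<open>auto simp: linewise_polynomial_def intro: continuous_intros\<close>)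

lemma linewise_polynomial_minus:
  assumes "linewise_polynomial c" shows "linewise_polynomial (\<lambda>x. - c x)"
  using linewise_polynomial_mult[OF linewise_polynomial_const[of "-1"] assms] by simp

lemma linewise_polynomial_sum [intro]:
  "(\<And>i. i \<in> I \<Longrightarrow> linewise_polynomial (c i)) \<Longrightarrow> linewise_polynomial (\<lambda>x. \<Sum>i\<in>I. c i x)"
  by (induction I rule: infinite_finite_induct) auto

lemma linewise_polynomial_prod [intro]:
  "(\<And>i. i \<in> I \<Longrightarrow> linewise_polynomial (c i)) \<Longrightarrow> linewise_polynomial (\<lambda>x. \<Prod>i\<in>I. c i x)"
  by (induction I rule: infinite_finite_induct) auto

lemma linewise_polynomial_power [intro]:
  "linewise_polynomial c \<Longrightarrow> linewise_polynomial (\<lambda>x. c x ^ k)"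
  by (induction k) auto

lemma linewise_polynomial_poly_fun: "linewise_polynomial (poly_fun p)"
  unfolding poly_fun_def eval_mvpoly_def by (auto intro!: linewise_polynomial_sum linewise_polynomial_mult
      linewise_polynomial_prod linewise_polynomial_power)

text \<open>
  The properties of proper algebraic subsets that the topological arguments rely on.
\<close>

definition thin :: "(complex^'n::finite) set \<Rightarrow> bool" where
  "thin Z \<longleftrightarrow> closed Z \<and> Z \<noteq> UNIV \<and> (\<forall>u v. (\<forall>t. u + t *s v \<in> Z) \<or> finite {t. u + t *s v \<in> Z})"

lemma thin_line_finite:
  assumes "thin Z" "u + t *s v \<notin> Z"
  shows "finite {t. u + t *s v \<in> Z}"
  using assms unfolding thin_def by blast

lemma thin_empty: "thin {}" by (simp add: thin_def)

text \<open>
  On the complex line through \<open>x\<close> and a point outside \<open>Z\<close>, only finitely many points lie in \<open>Z\<close>.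
\<close>

lemma thin_dense:
  fixes Z :: "(complex^'n::finite) set"
  assumes Z: "thin Z" and U: "open U" "x \<in> U"
  obtains b where "b \<in> U" "b \<notin> Z"
proof -
  obtain w where w: "w \<notin> Z" using Z by (auto simp: thin_def)
  define L where "L = (\<lambda>t. x + t *s (w - x))"
  have fin: "finite {t. L t \<in> Z}"
    unfolding L_def using thin_line_finite[OF Z, of x 1 "w - x"] w by simp
  have "continuous_on UNIV L" unfolding L_def by (intro continuous_on_line continuous_intros)
  then have op: "open (L -` U)" using U by (simp add: open_vimage)
  have "0 \<in> L -` U" using U by (simp add: L_def)
  then have "infinite (L -` U)" using op by (metis empty_iff finite_imp_not_open)
  then have "\<not> L -` U \<subseteq> {t. L t \<in> Z}" using fin finite_subset by blast
  then show thesis using that by auto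
qed

lemma thin_Un:
  fixes Z :: "(complex^'n::finite) set"
  assumes "thin Z" "thin Z'" shows "thin (Z \<union> Z')"
  unfolding thin_def
proof (intro conjI allI)
  show "closed (Z \<union> Z')" using assms by (auto simp: thin_def)
  obtain w where w: "w \<notin> Z'" using assms(2) by (auto simp: thin_def)
  obtain b where "b \<in> - Z'" "b \<notin> Z"
    using thin_dense[OF assms(1), of "- Z'" w] assms(2) w by (auto simp: thin_def)
  then show "Z \<union> Z' \<noteq> UNIV" by blast
  fix u v
  show "(\<forall>t. u + t *s v \<in> Z \<union> Z') \<or> finite {t. u + t *s v \<in> Z \<union> Z'}"
    using assms unfolding thin_def by (auto simp: Collect_disj_eq) meson+
qed

lemma thin_UN:
  assumes "finite I" "\<And>i. i \<in> I \<Longrightarrow> thin (Z i)" shows "thin (\<Union>i\<in>I. Z i)"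
  using assms by (induction I) (auto intro: thin_empty thin_Un)

lemma convex_line_vimage_ball:
  fixes u v a :: "complex^'n::finite"
  shows "convex ((\<lambda>t. u + t *s v) -` ball a r)"
proof (rule convexI)
  define L where "L = (\<lambda>t. u + t *s v)"
    fix x y and \<alpha> \<beta> :: real assume "x \<in> (\<lambda>t. u + t *s v) -` ball a r" "y \<in> (\<lambda>t. u + t *s v) -` ball a r"
    and *: "0 \<le> \<alpha>" "0 \<le> \<beta>" "\<alpha> + \<beta> = 1"
    then have xy: "L x \<in> ball a r" "L y \<in> ball a r" by (simp_all add: L_def)
    have "L (\<alpha> *\<^sub>R x + \<beta> *\<^sub>R y) = \<alpha> *\<^sub>R L x + \<beta> *\<^sub>R L y"
    proof (subst Finite_Cartesian_Product.vec_eq_iff, rule allI)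
      fix i
      have \<beta>: "\<beta> = 1 - \<alpha>" using *(3) by simp
      show "vec_nth (L (\<alpha> *\<^sub>R x + \<beta> *\<^sub>R y)) i = vec_nth (\<alpha> *\<^sub>R L x + \<beta> *\<^sub>R L y) i"
        unfolding L_def \<beta> vector_scaleR_component vector_add_component vector_smult_component vector_minus_component
        by (simp add: scaleR_conv_of_real algebra_simps)
    qed
    also have "\<dots> \<in> ball a r" using * xy by (intro convexD[OF convex_ball]) auto
    finally show "\<alpha> *\<^sub>R x + \<beta> *\<^sub>R y \<in> (\<lambda>t. u + t *s v) -` ball a r" by (simp add: L_def)
qed

text \<open>
  Two points outside \<open>Z\<close> lie on a complex line that meets the ball in a convex plane set; removing
  the finitely many points of \<open>Z\<close> on that line leaves it path connected.
\<close>

lemma path_connected_ball_minus_thin: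
  fixes Z :: "(complex^'n::finite) set"
  assumes Z: "thin Z" shows "path_connected (ball a r - Z)"
  unfolding path_connected_def
proof (intro ballI)
  fix u v assume u: "u \<in> ball a r - Z" and v: "v \<in> ball a r - Z"
  define L where "L = (\<lambda>t. u + t *s (v - u))"
  have fin: "finite {t. L t \<in> Z}"
    unfolding L_def using thin_line_finite[OF Z, of u 0 "v - u"] u by simp
  have cont: "continuous_on S L" for S unfolding L_def by (intro continuous_on_line continuous_intros)
  have "convex (L -` ball a r)" unfolding L_def by (rule convex_line_vimage_ball)
  moreover have "open (L -` ball a r)" using cont by (simp add: open_vimage)
  ultimately have "path_connected (L -` ball a r - {t. L t \<in> Z})"
    using fin by (intro path_connected_open_diff_countable) (auto simp: convex_connected countable_finite)
  moreover have "0 \<in> L -` ball a r - {t. L t \<in> Z}" "1 \<in> L -` ball a r - {t. L t \<in> Z}"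
    using u v by (auto simp: L_def)
  ultimately obtain g where g: "path g" "path_image g \<subseteq> L -` ball a r - {t. L t \<in> Z}" "pathstart g = 0" "pathfinish g = 1"
    unfolding path_connected_def by blast
  show "\<exists>g. path g \<and> path_image g \<subseteq> ball a r - Z \<and> pathstart g = u \<and> pathfinish g = v"
  proof (intro exI[of _ "L \<circ> g"] conjI)
    show "path (L \<circ> g)" using g(1) cont by (simp add: path_continuous_image)
    show "path_image (L \<circ> g) \<subseteq> ball a r - Z" using g(2) by (auto simp: path_image_compose)
  qed (use g in \<open>auto simp: pathstart_compose pathfinish_compose L_def\<close>)
qed

lemma thin_zero_set:
  assumes c: "linewise_polynomial c" and "c x \<noteq> 0"
  shows "thin {x. c x = 0}"
  unfolding thin_def
proof (intro conjI allI)
  show "closed {x. c x = 0}"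
    using c unfolding linewise_polynomial_def by (intro closed_Collect_eq) auto
  show "{x. c x = 0} \<noteq> UNIV" using assms(2) by blast
  fix u v
  obtain p where p: "\<forall>t. c (u + t *s v) = poly p t" using c unfolding linewise_polynomial_def by blast
  show "(\<forall>t. u + t *s v \<in> {x. c x = 0}) \<or> finite {t. u + t *s v \<in> {x. c x = 0}}"
    using p by (cases "p = 0") (auto simp: poly_roots_finite)
qed

definition linewise_monic :: "(complex^'n::finite \<Rightarrow> complex poly) \<Rightarrow> nat \<Rightarrow> bool" where
  "linewise_monic R n \<longleftrightarrow> n > 0 \<and> (\<forall>x. degree (R x) = n \<and> lead_coeff (R x) = 1) \<and>
     (\<forall>i. linewise_polynomial (\<lambda>x. coeff (R x) i))"

lemma linewise_monic_imp_monic_family: "linewise_monic R n \<Longrightarrow> monic_family R n"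
  by (auto simp: linewise_monic_def monic_family_def linewise_polynomial_def)

lemma generic_number_of_roots_family:
  fixes R :: "complex \<Rightarrow> complex poly"
  assumes deg: "\<And>t. degree (R t) = n" "\<And>t. lead_coeff (R t) = 1"
    and poly: "\<And>i. \<exists>p. \<forall>t. coeff (R t) i = poly p t"
  shows "\<exists>m E. finite E \<and> (\<forall>t. card (roots (R t)) \<le> m) \<and> (\<forall>t. t \<notin> E \<longrightarrow> card (roots (R t)) = m)"
proof -
  obtain c where c: "\<And>i t. coeff (R t) i = poly (c i) t" using poly by metis
  define C where "C = (\<Sum>i<n. monom (c i) i) + monom 1 n"
  have coeffC: "coeff C i = (if i < n then c i else if i = n then 1 else 0)" for i
    unfolding C_def coeff_add coeff_sum by (auto simp: sum.delta when_def)
  have "degree C = n" by (intro antisym degree_le le_degree) (auto simp: coeffC)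
  then have "lead_coeff C = 1" by (simp add: coeffC)
  moreover have "specialise C t = R t" for t
  proof (rule poly_eqI)
    fix i
    show "coeff (specialise C t) i = coeff (R t) i"
      using deg[of t] c[of t i] by (auto simp: coeff_map_poly coeffC coeff_eq_0)
  qed
  ultimately show ?thesis
    using generic_number_of_roots[of C] by simp
qed

text \<open>
  On a complex line the number of roots is constant up to finitely many exceptions. Either this
  generic number is the maximum over the whole space, or the entire line is in the branch locus.
\<close>

lemma thin_branch_locus:
  fixes R :: "complex^'n::finite \<Rightarrow> complex poly"
  assumes R: "linewise_monic R n"
  shows "thin (branch_locus R)"
  unfolding thin_def
proof (intro conjI allI)
  note R' = linewise_monic_imp_monic_family[OF R]
  show "closed (branch_locus R)" by (rule closed_branch_locus[OF R'])
  have "card (roots (R x)) \<le> n" for x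
    using card_roots_le_degree(2)[OF monic_family_nonzero[OF R']] monic_familyD(2)[OF R'] by metis
  then obtain x where "\<And>x'. card (roots (R x')) \<le> card (roots (R x))"
    using ex_has_greatest_nat[of "\<lambda>_. True" undefined "\<lambda>x. card (roots (R x))" "Suc n"] by (auto simp: less_Suc_eq_le)
  then have "x \<notin> branch_locus R" by (auto simp: branch_locus_def not_less)
  then show "branch_locus R \<noteq> UNIV" by blast
  fix u v
  have "\<exists>p. \<forall>t. coeff (R (u + t *s v)) i = poly p t" for i
    using R by (auto simp: linewise_monic_def linewise_polynomial_def)
  then obtain m E where E: "finite E" and le: "\<And>t. card (roots (R (u + t *s v))) \<le> m"
    and eq: "\<And>t. t \<notin> E \<Longrightarrow> card (roots (R (u + t *s v))) = m"
    using generic_number_of_roots_family[of "\<lambda>t. R (u + t *s v)" n, OF monic_familyD(2)[OF R'] monic_familyD(3)[OF R']]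
    by blast
  show "(\<forall>t. u + t *s v \<in> branch_locus R) \<or> finite {t. u + t *s v \<in> branch_locus R}"
  proof (cases "\<forall>t. u + t *s v \<in> branch_locus R")
    case False
    then obtain t0 where "u + t0 *s v \<notin> branch_locus R" by blast
    then have "card (roots (R x)) \<le> m" for x
      using le[of t0] unfolding branch_locus_def by (auto simp: not_less intro: order_trans)
    then have "u + t *s v \<notin> branch_locus R" if "t \<notin> E" for t
      using eq[OF that] by (auto simp: branch_locus_def not_less)
    then have "{t. u + t *s v \<in> branch_locus R} \<subseteq> E" by blast
    then show ?thesis using E finite_subset by blast
  qed simp
qed

lemma finite_branch_locus:
  fixes R :: "complex \<Rightarrow> complex poly"
  assumes R: "monic_family R n" and poly: "\<And>i. \<exists>p. \<forall>t. coeff (R t) i = poly p t"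
  shows "finite (branch_locus R)"
proof -
  obtain m E where E: "finite E" and le: "\<And>t. card (roots (R t)) \<le> m"
    and eq: "\<And>t. t \<notin> E \<Longrightarrow> card (roots (R t)) = m"
    using generic_number_of_roots_family[of R n, OF monic_familyD(2)[OF R] monic_familyD(3)[OF R] poly] by blast
  have "branch_locus R \<subseteq> E" using le eq by (auto simp: branch_locus_def) (metis leD)
  then show ?thesis using E finite_subset by blast
qed

section \<open>Integral dependence\<close>

lemma linewise_monicD:
  assumes "linewise_monic R n"
  shows "n > 0" "degree (R x) = n" "lead_coeff (R x) = 1" "linewise_polynomial (\<lambda>x. coeff (R x) i)"
  using assms unfolding linewise_monic_def by blast+

text \<open>
  The elements of \<open>T\<close> are points of the base together with values of several branches above them;
  \<open>b\<close> is the projection to the base. In this way multivalued functions become the functions \<open>z\<close> on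
  \<open>T\<close>, and integrality over the functions on the base is a statement about all branches at once.
\<close>

definition integral_over :: "'a set \<Rightarrow> ('a \<Rightarrow> complex^'n::finite) \<Rightarrow> ('a \<Rightarrow> complex) \<Rightarrow> bool" where
  "integral_over T b z \<longleftrightarrow> (\<exists>R n. linewise_monic R n \<and> (\<forall>\<tau>\<in>T. poly (R (b \<tau>)) (z \<tau>) = 0))"

text \<open>
  The submodule generated by \<open>W\<close>, for functions regarded on \<open>T\<close> only.
\<close>

definition coeff_span :: "'a set \<Rightarrow> ('a \<Rightarrow> complex^'n::finite) \<Rightarrow> ('a \<Rightarrow> complex) set \<Rightarrow> ('a \<Rightarrow> complex) set" where
  "coeff_span T b W = {u. \<exists>c. (\<forall>w\<in>W. linewise_polynomial (c w)) \<and> (\<forall>\<tau>\<in>T. u \<tau> = (\<Sum>w\<in>W. c w (b \<tau>) * w \<tau>))}"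

inductive_set gen_ring :: "('a \<Rightarrow> complex^'n::finite) \<Rightarrow> ('a \<Rightarrow> complex) set \<Rightarrow> ('a \<Rightarrow> complex) set"
  for b :: "'a \<Rightarrow> complex^'n::finite" and Y :: "('a \<Rightarrow> complex) set" where
  coef: "linewise_polynomial c \<Longrightarrow> (\<lambda>\<tau>. c (b \<tau>)) \<in> gen_ring b Y"
| gen: "y \<in> Y \<Longrightarrow> y \<in> gen_ring b Y"
| add: "u \<in> gen_ring b Y \<Longrightarrow> v \<in> gen_ring b Y \<Longrightarrow> (\<lambda>\<tau>. u \<tau> + v \<tau>) \<in> gen_ring b Y"
| mult: "u \<in> gen_ring b Y \<Longrightarrow> v \<in> gen_ring b Y \<Longrightarrow> (\<lambda>\<tau>. u \<tau> * v \<tau>) \<in> gen_ring b Y"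

lemma coeff_span_cong:
  "u \<in> coeff_span T b W \<Longrightarrow> (\<And>\<tau>. \<tau> \<in> T \<Longrightarrow> v \<tau> = u \<tau>) \<Longrightarrow> v \<in> coeff_span T b W"
  unfolding coeff_span_def by auto

lemma coeff_spanI:
  assumes "\<And>w. w \<in> W \<Longrightarrow> linewise_polynomial (c w)"
    and "\<And>\<tau>. \<tau> \<in> T \<Longrightarrow> u \<tau> = (\<Sum>w\<in>W. c w (b \<tau>) * w \<tau>)"
  shows "u \<in> coeff_span T b W"
  unfolding coeff_span_def using assms by blast

lemma coeff_spanD:
  assumes "u \<in> coeff_span T b W"
  shows "\<exists>c. (\<forall>w\<in>W. linewise_polynomial (c w)) \<and> (\<forall>\<tau>\<in>T. u \<tau> = (\<Sum>w\<in>W. c w (b \<tau>) * w \<tau>))"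
  using assms unfolding coeff_span_def by blast

lemma coeff_span_zero: "(\<lambda>_. 0) \<in> coeff_span T b W"
  by (rule coeff_spanI[where c = "\<lambda>_ _. 0"]) simp_all

lemma coeff_span_add:
  assumes "u \<in> coeff_span T b W" "v \<in> coeff_span T b W"
  shows "(\<lambda>\<tau>. u \<tau> + v \<tau>) \<in> coeff_span T b W"
proof -
  obtain c where c: "\<And>w. w \<in> W \<Longrightarrow> linewise_polynomial (c w)"
    "\<And>\<tau>. \<tau> \<in> T \<Longrightarrow> u \<tau> = (\<Sum>w\<in>W. c w (b \<tau>) * w \<tau>)"
    using assms(1) by (blast dest: coeff_spanD)
  obtain d where d: "\<And>w. w \<in> W \<Longrightarrow> linewise_polynomial (d w)"
    "\<And>\<tau>. \<tau> \<in> T \<Longrightarrow> v \<tau> = (\<Sum>w\<in>W. d w (b \<tau>) * w \<tau>)"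
    using assms(2) by (blast dest: coeff_spanD)
  show ?thesis
  proof (rule coeff_spanI)
    show "linewise_polynomial (\<lambda>x. c w x + d w x)" if "w \<in> W" for w
      using c(1)[OF that] d(1)[OF that] by (rule linewise_polynomial_add)
    show "u \<tau> + v \<tau> = (\<Sum>w\<in>W. (c w (b \<tau>) + d w (b \<tau>)) * w \<tau>)" if "\<tau> \<in> T" for \<tau>
      using c(2)[OF that] d(2)[OF that] by (simp add: sum.distrib distrib_right)
  qed
qed

lemma coeff_span_scale:
  assumes "linewise_polynomial a" "u \<in> coeff_span T b W"
  shows "(\<lambda>\<tau>. a (b \<tau>) * u \<tau>) \<in> coeff_span T b W"
proof -
  obtain c where c: "\<And>w. w \<in> W \<Longrightarrow> linewise_polynomial (c w)"
    "\<And>\<tau>. \<tau> \<in> T \<Longrightarrow> u \<tau> = (\<Sum>w\<in>W. c w (b \<tau>) * w \<tau>)"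
    using assms(2) by (blast dest: coeff_spanD)
  show ?thesis
  proof (rule coeff_spanI)
    show "linewise_polynomial (\<lambda>x. a x * c w x)" if "w \<in> W" for w
      using assms(1) c(1)[OF that] by (rule linewise_polynomial_mult)
    show "a (b \<tau>) * u \<tau> = (\<Sum>w\<in>W. a (b \<tau>) * c w (b \<tau>) * w \<tau>)" if "\<tau> \<in> T" for \<tau>
      using c(2)[OF that] by (simp add: sum_distrib_left mult.assoc)
  qed
qed

lemma coeff_span_sum:
  assumes "\<And>i. i \<in> I \<Longrightarrow> u i \<in> coeff_span T b W"
  shows "(\<lambda>\<tau>. \<Sum>i\<in>I. u i \<tau>) \<in> coeff_span T b W"
  using assms
proof (induction I rule: infinite_finite_induct)
  case (insert i I)
  then have "(\<lambda>\<tau>. u i \<tau> + (\<Sum>i\<in>I. u i \<tau>)) \<in> coeff_span T b W"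
    by (intro coeff_span_add) simp_all
  with insert.hyps show ?case by simp
qed (simp_all add: coeff_span_zero)

lemma coeff_span_base:
  assumes "finite W" "w \<in> W" shows "w \<in> coeff_span T b W"
proof (rule coeff_spanI[where c = "\<lambda>w' _. if w' = w then 1 else 0"])
  show "w \<tau> = (\<Sum>w'\<in>W. (if w' = w then 1 else 0) * w' \<tau>)" for \<tau>
    using assms by (simp add: if_distrib[of "\<lambda>x. x * _"] cong: if_cong)
qed simp

lemma coeff_span_mult:
  assumes u: "\<And>w. w \<in> W \<Longrightarrow> (\<lambda>\<tau>. u \<tau> * w \<tau>) \<in> coeff_span T b W" and s: "s \<in> coeff_span T b W"
  shows "(\<lambda>\<tau>. u \<tau> * s \<tau>) \<in> coeff_span T b W"
proof -
  obtain c where c: "\<forall>w\<in>W. linewise_polynomial (c w)" "\<forall>\<tau>\<in>T. s \<tau> = (\<Sum>w\<in>W. c w (b \<tau>) * w \<tau>)"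
    using s by (blast dest: coeff_spanD)
  have "(\<lambda>\<tau>. \<Sum>w\<in>W. c w (b \<tau>) * (u \<tau> * w \<tau>)) \<in> coeff_span T b W"
    using c(1) u by (intro coeff_span_sum coeff_span_scale) auto
  then show ?thesis
    by (rule coeff_span_cong) (use c(2) in \<open>auto simp: sum_distrib_left intro!: sum.cong\<close>)
qed

lemma gen_ring_stabilises:
  assumes Y: "\<And>y w. y \<in> Y \<Longrightarrow> w \<in> W \<Longrightarrow> (\<lambda>\<tau>. y \<tau> * w \<tau>) \<in> coeff_span T b W"
    and "u \<in> gen_ring b Y" "s \<in> coeff_span T b W"
  shows "(\<lambda>\<tau>. u \<tau> * s \<tau>) \<in> coeff_span T b W"
  using assms(2,3)
proof (induction arbitrary: s)
  case (coef c)
  then show ?case by (rule coeff_span_scale)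
next
  case (gen y)
  show ?case by (rule coeff_span_mult[OF Y[OF gen.hyps] gen.prems])
next
  case (add u v)
  then show ?case using coeff_span_add[of "\<lambda>\<tau>. u \<tau> * s \<tau>" T b W "\<lambda>\<tau>. v \<tau> * s \<tau>"] by (simp add: distrib_right)
next
  case (mult u v)
  have "(\<lambda>\<tau>. u \<tau> * (v \<tau> * s \<tau>)) \<in> coeff_span T b W" using mult by blast
  then show ?case by (simp add: mult.assoc)
qed

lemma linewise_coeffs_mult:
  assumes "\<And>i. linewise_polynomial (\<lambda>x. coeff (f x) i)" "\<And>i. linewise_polynomial (\<lambda>x. coeff (g x) i)"
  shows "linewise_polynomial (\<lambda>x. coeff (f x * g x) i)"
  unfolding coeff_mult using assms by (auto intro!: linewise_polynomial_sum linewise_polynomial_mult)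

lemma linewise_coeffs_prod:
  assumes "\<And>j i. j \<in> I \<Longrightarrow> linewise_polynomial (\<lambda>x. coeff (f j x) i)"
  shows "linewise_polynomial (\<lambda>x. coeff (\<Prod>j\<in>I. f j x) i)"
  using assms
proof (induction I arbitrary: i rule: infinite_finite_induct)
  case (insert a F)
  then show ?case by (auto intro!: linewise_coeffs_mult)
qed auto

text \<open>
  By the Leibniz formula the coefficients of a characteristic polynomial are sums of products of
  the entries of the matrix.
\<close>

lemma linewise_monic_char_poly:
  fixes M :: "nat \<Rightarrow> nat \<Rightarrow> complex^'n::finite \<Rightarrow> complex"
  assumes "m > 0" and M: "\<And>i j. i < m \<Longrightarrow> j < m \<Longrightarrow> linewise_polynomial (M i j)"
  shows "linewise_monic (\<lambda>x. char_poly (Matrix.mat m m (\<lambda>(i, j). M i j x))) m"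
  unfolding linewise_monic_def
proof (intro conjI allI)
  show "m > 0" by fact
  show "degree (char_poly (Matrix.mat m m (\<lambda>(i, j). M i j x))) = m"
    "lead_coeff (char_poly (Matrix.mat m m (\<lambda>(i, j). M i j x))) = 1" for x
    using degree_monic_char_poly[of "Matrix.mat m m (\<lambda>(i, j). M i j x)" m] by auto
  fix k
  have entry: "linewise_polynomial (\<lambda>x. coeff ((if i = j then [:0, 1:] else 0) + [:- M i j x:]) l)"
    if "i < m" "j < m" for i j l
    using linewise_polynomial_minus[OF M[OF that]]
    by (cases "i = j"; cases l) (auto simp: coeff_pCons split: nat.split)
  have det: "char_poly (Matrix.mat m m (\<lambda>(i, j). M i j x)) =
      (\<Sum>p\<in>{p. p permutes {0..<m}}. signof p * (\<Prod>i = 0..<m. (if i = p i then [:0, 1:] else 0) + [:- M i (p i) x:]))" for x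
    unfolding char_poly_def
    by (subst det_def'[of _ m]) (auto simp: char_poly_matrix_def permutes_def intro!: sum.cong prod.cong)
  show "linewise_polynomial (\<lambda>x. coeff (char_poly (Matrix.mat m m (\<lambda>(i, j). M i j x))) k)"
    unfolding det coeff_sum
  proof (intro linewise_polynomial_sum linewise_coeffs_mult linewise_coeffs_prod)
    show "linewise_polynomial (\<lambda>x. coeff (signof p) i)" for p i by simp
    fix p j i assume "p \<in> {p. p permutes {0..<m}}" "j \<in> {0..<m}"
    then have "j < m" "p j < m" using permutes_in_image[of p "{0..<m}" j] by auto
    then show "linewise_polynomial (\<lambda>x. coeff ((if j = p j then [:0, 1:] else 0) + [:- M j (p j) x:]) i)"
      by (rule entry)
  qed
qed

text \<open>
  At each point of \<open>T\<close> the values of the generators form an eigenvector of the matrix of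
  multiplication by \<open>u\<close>, with the value of \<open>u\<close> as eigenvalue. So \<open>u\<close> is a root of the characteristic
  polynomial of this matrix.
\<close>

lemma integral_over_if_stable_span:
  fixes b :: "'a \<Rightarrow> complex^'n::finite"
  assumes W: "finite W" "\<And>\<tau>. \<tau> \<in> T \<Longrightarrow> \<exists>w\<in>W. w \<tau> \<noteq> 0" "W \<noteq> {}"
    and u: "\<And>w. w \<in> W \<Longrightarrow> (\<lambda>\<tau>. u \<tau> * w \<tau>) \<in> coeff_span T b W"
  shows "integral_over T b u"
proof -
  obtain f where f: "bij_betw f {0..<card W} W" using ex_bij_betw_nat_finite[OF W(1)] by blast
  define m where "m = card W"
  have fW: "f i \<in> W" if "i < m" for i using f that by (auto simp: bij_betw_def m_def)
  have "\<forall>w\<in>W. \<exists>c. (\<forall>w'\<in>W. linewise_polynomial (c w')) \<and> (\<forall>\<tau>\<in>T. u \<tau> * w \<tau> = (\<Sum>w'\<in>W. c w' (b \<tau>) * w' \<tau>))"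
    by (intro ballI coeff_spanD u)
  from bchoice[OF this] obtain c where "\<forall>w\<in>W. (\<forall>w'\<in>W. linewise_polynomial (c w w')) \<and>
      (\<forall>\<tau>\<in>T. u \<tau> * w \<tau> = (\<Sum>w'\<in>W. c w w' (b \<tau>) * w' \<tau>))" ..
  then have c: "\<And>w w'. w \<in> W \<Longrightarrow> w' \<in> W \<Longrightarrow> linewise_polynomial (c w w')"
    "\<And>w \<tau>. w \<in> W \<Longrightarrow> \<tau> \<in> T \<Longrightarrow> u \<tau> * w \<tau> = (\<Sum>w'\<in>W. c w w' (b \<tau>) * w' \<tau>)"
    by simp_all
  define A where "A = (\<lambda>x. Matrix.mat m m (\<lambda>(i, j). c (f i) (f j) x))"
  have "linewise_monic (\<lambda>x. char_poly (A x)) m"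
    unfolding A_def using W fW c(1) by (intro linewise_monic_char_poly) (auto simp: m_def card_gt_0_iff)
  moreover have "poly (char_poly (A (b \<tau>))) (u \<tau>) = 0" if \<tau>: "\<tau> \<in> T" for \<tau>
  proof -
    define v where "v = Matrix.vec m (\<lambda>i. f i \<tau>)"
    have car: "A (b \<tau>) \<in> carrier_mat m m" by (simp add: A_def)
    have "eigenvector (A (b \<tau>)) v (u \<tau>)"
      unfolding eigenvector_def
    proof (intro conjI)
      show "v \<in> carrier_vec (dim_row (A (b \<tau>)))" by (simp add: v_def A_def)
      obtain w where "w \<in> W" "w \<tau> \<noteq> 0" using W(2)[OF \<tau>] by blast
      then have "w \<in> f ` {0..<m}" using f by (simp add: bij_betw_def m_def)
      then obtain i where i: "i < m" "f i \<tau> \<noteq> 0" using \<open>w \<tau> \<noteq> 0\<close> by auto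
      then have "Matrix.vec_index v i \<noteq> Matrix.vec_index (0\<^sub>v (dim_row (A (b \<tau>)))) i"
        by (simp add: v_def A_def)
      then show "v \<noteq> 0\<^sub>v (dim_row (A (b \<tau>)))" by metis
      show "mult_mat_vec (A (b \<tau>)) v = smult_vec (u \<tau>) v"
      proof (rule eq_vecI)
        fix i assume "i < dim_vec (smult_vec (u \<tau>) v)"
        then have i: "i < m" by (simp add: v_def)
        have "u \<tau> * f i \<tau> = (\<Sum>w'\<in>W. c (f i) w' (b \<tau>) * w' \<tau>)" using c(2)[OF fW[OF i] \<tau>] .
        also have "\<dots> = (\<Sum>j = 0..<m. c (f i) (f j) (b \<tau>) * f j \<tau>)"
          unfolding m_def by (rule sum.reindex_bij_betw[OF f, symmetric])
        finally show "Matrix.vec_index (mult_mat_vec (A (b \<tau>)) v) i = Matrix.vec_index (smult_vec (u \<tau>) v) i"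
          using i by (simp add: A_def v_def scalar_prod_def)
      qed (simp add: A_def v_def)
    qed
    then have "eigenvalue (A (b \<tau>)) (u \<tau>)" unfolding eigenvalue_def by blast
    then show ?thesis using eigenvalue_root_char_poly[OF car] by simp
  qed
  ultimately show ?thesis unfolding integral_over_def by blast
qed

text \<open>
  The monomials \<open>y ^ i * z ^ j\<close> with \<open>i < n\<close> and \<open>j < m\<close> span a module that is stable under
  multiplication by \<open>y\<close> and \<open>z\<close>, because \<open>y ^ n\<close> and \<open>z ^ m\<close> can be expressed by smaller powers.
  Coefficients \<open>B j\<close> that involve \<open>y\<close> cover both cases of interest: \<open>z\<close> integral over the base
  functions, and \<open>z\<close> integral over \<open>y\<close>.
\<close>

lemma integral_over_two_generators:
  fixes b :: "'a \<Rightarrow> complex^'n::finite"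
  assumes y: "integral_over T b y" and m: "m > 0"
    and B: "\<And>j. j < m \<Longrightarrow> B j \<in> gen_ring b {y}"
    and z: "\<And>\<tau>. \<tau> \<in> T \<Longrightarrow> (\<Sum>j<m. B j \<tau> * z \<tau> ^ j) + z \<tau> ^ m = 0"
    and u: "u \<in> gen_ring b {y, z}"
  shows "integral_over T b u"
proof -
  obtain R n where R: "linewise_monic R n" and root: "\<And>\<tau>. \<tau> \<in> T \<Longrightarrow> poly (R (b \<tau>)) (y \<tau>) = 0"
    using y unfolding integral_over_def by blast
  have lin: "linewise_polynomial (\<lambda>x. coeff (R x) i)" for i using R by (simp add: linewise_monic_def)
  have n: "n > 0" using R by (simp add: linewise_monic_def)
  have yn: "y \<tau> ^ n = (\<Sum>i<n. - coeff (R (b \<tau>)) i * y \<tau> ^ i)" if "\<tau> \<in> T" for \<tau>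
    using root[OF that] monic_poly_split[OF linewise_monicD(2,3)[OF R], of "b \<tau>" "y \<tau>"]
    by (simp add: sum_negf eq_neg_iff_add_eq_0 add.commute)
  have zm: "z \<tau> ^ m = - (\<Sum>j<m. B j \<tau> * z \<tau> ^ j)" if "\<tau> \<in> T" for \<tau>
    using z[OF that] by (simp add: eq_neg_iff_add_eq_0 add.commute)
  define w where "w = (\<lambda>i j \<tau>. y \<tau> ^ i * z \<tau> ^ j)"
  define W where "W = (\<lambda>(i, j). w i j) ` ({..<n} \<times> {..<m})"
  have finW: "finite W" by (simp add: W_def)
  have base: "w i j \<in> coeff_span T b W" if "i < n" "j < m" for i j
    using that by (intro coeff_span_base finW) (auto simp: W_def)
  have yW: "(\<lambda>\<tau>. y \<tau> * v \<tau>) \<in> coeff_span T b W" if "v \<in> W" for v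
  proof -
    obtain i j where v: "v = w i j" and ij: "i < n" "j < m" using \<open>v \<in> W\<close> by (auto simp: W_def)
    show ?thesis
    proof (cases "Suc i < n")
      case True
      from base[OF this ij(2)] show ?thesis by (simp add: v w_def mult.assoc)
    next
      case False
      then have n_eq: "n = Suc i" using ij by simp
      have "(\<lambda>\<tau>. \<Sum>k<n. (\<lambda>x. - coeff (R x) k) (b \<tau>) * w k j \<tau>) \<in> coeff_span T b W"
        using ij base by (intro coeff_span_sum coeff_span_scale linewise_polynomial_minus lin) auto
      then show ?thesis
      proof (rule coeff_span_cong)
        fix \<tau> assume "\<tau> \<in> T"
        have "y \<tau> * v \<tau> = y \<tau> ^ n * z \<tau> ^ j" by (simp add: v w_def n_eq)
        then show "y \<tau> * v \<tau> = (\<Sum>k<n. (\<lambda>x. - coeff (R x) k) (b \<tau>) * w k j \<tau>)"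
          unfolding yn[OF \<open>\<tau> \<in> T\<close>] by (simp add: sum_distrib_right w_def mult.assoc)
      qed
    qed
  qed
  have zW: "(\<lambda>\<tau>. z \<tau> * v \<tau>) \<in> coeff_span T b W" if "v \<in> W" for v
  proof -
    obtain i j where v: "v = w i j" and ij: "i < n" "j < m" using \<open>v \<in> W\<close> by (auto simp: W_def)
    show ?thesis
    proof (cases "Suc j < m")
      case True
      from base[OF ij(1) this] show ?thesis by (simp add: v w_def mult.left_commute)
    next
      case False
      then have m_eq: "m = Suc j" using ij by simp
      have "(\<lambda>\<tau>. B k \<tau> * w i k \<tau>) \<in> coeff_span T b W" if "k < m" for k
        by (rule gen_ring_stabilises[OF _ B[OF that] base[OF ij(1) that]]) (use yW in auto)
      then have "(\<lambda>\<tau>. (\<lambda>_. -1) (b \<tau>) * (\<Sum>k<m. B k \<tau> * w i k \<tau>)) \<in> coeff_span T b W"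
        by (intro coeff_span_sum coeff_span_scale) auto
      then show ?thesis
      proof (rule coeff_span_cong)
        fix \<tau> assume "\<tau> \<in> T"
        have "z \<tau> * v \<tau> = y \<tau> ^ i * z \<tau> ^ m" by (simp add: v w_def m_eq)
        then show "z \<tau> * v \<tau> = (\<lambda>_. -1) (b \<tau>) * (\<Sum>k<m. B k \<tau> * w i k \<tau>)"
          unfolding zm[OF \<open>\<tau> \<in> T\<close>] by (simp add: sum_distrib_left w_def mult_ac sum_negf)
      qed
    qed
  qed
  show ?thesis
  proof (rule integral_over_if_stable_span[OF finW])
    have one: "w 0 0 \<in> W" using n m by (auto simp: W_def)
    then show "W \<noteq> {}" by blast
    show "\<exists>w\<in>W. w \<tau> \<noteq> 0" for \<tau> by (rule bexI[OF _ one]) (simp add: w_def)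
    show "(\<lambda>\<tau>. u \<tau> * v \<tau>) \<in> coeff_span T b W" if "v \<in> W" for v
      by (rule gen_ring_stabilises[OF _ u coeff_span_base[OF finW that]]) (use yW zW in blast)
  qed
qed

lemma integral_over_gen_ring:
  assumes y: "integral_over T b y" and z: "integral_over T b z" and u: "u \<in> gen_ring b {y, z}"
  shows "integral_over T b u"
proof -
  obtain R n where R: "linewise_monic R n" and root: "\<And>\<tau>. \<tau> \<in> T \<Longrightarrow> poly (R (b \<tau>)) (z \<tau>) = 0"
    using z unfolding integral_over_def by blast
  show ?thesis
  proof (rule integral_over_two_generators[OF y _ _ _ u])
    show "n > 0" using R by (simp add: linewise_monic_def)
    show "(\<lambda>\<tau>. coeff (R (b \<tau>)) j) \<in> gen_ring b {y}" for j
      using R gen_ring.coef[of "\<lambda>x. coeff (R x) j" b] by (simp add: linewise_monic_def)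
    show "(\<Sum>j<n. coeff (R (b \<tau>)) j * z \<tau> ^ j) + z \<tau> ^ n = 0" if "\<tau> \<in> T" for \<tau>
      using root[OF that] monic_poly_split[OF linewise_monicD(2,3)[OF R], of "b \<tau>" "z \<tau>"] by simp
  qed
qed

lemma linewise_monic_linear:
  assumes "linewise_polynomial c" shows "linewise_monic (\<lambda>x. [:- c x, 1:]) 1"
  unfolding linewise_monic_def
proof (intro conjI allI)
  fix i
  show "linewise_polynomial (\<lambda>x. coeff [:- c x, 1:] i)"
    using linewise_polynomial_minus[OF assms] by (cases i) (auto simp: coeff_pCons split: nat.split)
qed auto

lemma integral_over_coef:
  assumes "linewise_polynomial c" shows "integral_over T b (\<lambda>\<tau>. c (b \<tau>))"
  using linewise_monic_linear[OF assms] unfolding integral_over_def by (intro exI[of _ "\<lambda>x. [:- c x, 1:]"]) auto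

lemma integral_over_add:
  assumes "integral_over T b y" "integral_over T b z"
  shows "integral_over T b (\<lambda>\<tau>. y \<tau> + z \<tau>)"
proof (rule integral_over_gen_ring[OF assms])
  have "y \<in> gen_ring b {y, z}" "z \<in> gen_ring b {y, z}" by (simp_all add: gen_ring.gen)
  then show "(\<lambda>\<tau>. y \<tau> + z \<tau>) \<in> gen_ring b {y, z}" by (rule gen_ring.add)
qed

lemma integral_over_mult:
  assumes "integral_over T b y" "integral_over T b z"
  shows "integral_over T b (\<lambda>\<tau>. y \<tau> * z \<tau>)"
proof (rule integral_over_gen_ring[OF assms])
  have "y \<in> gen_ring b {y, z}" "z \<in> gen_ring b {y, z}" by (simp_all add: gen_ring.gen)
  then show "(\<lambda>\<tau>. y \<tau> * z \<tau>) \<in> gen_ring b {y, z}" by (rule gen_ring.mult)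
qed

lemma integral_over_const: "integral_over T b (\<lambda>\<tau>. a)"
  by (rule integral_over_coef[OF linewise_polynomial_const])

lemma integral_over_sum:
  assumes "\<And>i. i \<in> I \<Longrightarrow> integral_over T b (u i)"
  shows "integral_over T b (\<lambda>\<tau>. \<Sum>i\<in>I. u i \<tau>)"
  using assms
proof (induction I rule: infinite_finite_induct)
  case (insert i I)
  then have "integral_over T b (\<lambda>\<tau>. u i \<tau> + (\<Sum>i\<in>I. u i \<tau>))"
    by (intro integral_over_add) simp_all
  with insert.hyps show ?case by simp
qed (simp_all add: integral_over_const)

lemma integral_over_prod:
  assumes "\<And>i. i \<in> I \<Longrightarrow> integral_over T b (u i)"
  shows "integral_over T b (\<lambda>\<tau>. \<Prod>i\<in>I. u i \<tau>)"
  using assms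
proof (induction I rule: infinite_finite_induct)
  case (insert i I)
  then have "integral_over T b (\<lambda>\<tau>. u i \<tau> * (\<Prod>i\<in>I. u i \<tau>))"
    by (intro integral_over_mult) simp_all
  with insert.hyps show ?case by simp
qed (simp_all add: integral_over_const)

lemma integral_over_power:
  assumes "integral_over T b u"
  shows "integral_over T b (\<lambda>\<tau>. u \<tau> ^ k)"
proof (induction k)
  case (Suc k)
  from integral_over_mult[OF assms Suc] show ?case by simp
qed (simp add: integral_over_const)

lemma integral_over_eval_mvpoly:
  assumes "\<And>i. i \<in> vars_mvpoly q \<Longrightarrow> integral_over T b (u i)"
  shows "integral_over T b (\<lambda>\<tau>. eval_mvpoly (\<lambda>i. u i \<tau>) q)"
  unfolding eval_mvpoly_def
proof (rule integral_over_sum)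
  fix m assume m: "m \<in> Poly_Mapping.keys q"
  have "integral_over T b (\<lambda>\<tau>. \<Prod>i\<in>Poly_Mapping.keys m. u i \<tau> ^ Poly_Mapping.lookup m i)"
  proof (rule integral_over_prod)
    fix i assume "i \<in> Poly_Mapping.keys m"
    then have "i \<in> vars_mvpoly q" using m by (auto simp: vars_mvpoly_def)
    then show "integral_over T b (\<lambda>\<tau>. u i \<tau> ^ Poly_Mapping.lookup m i)"
      by (rule integral_over_power[OF assms])
  qed
  then show "integral_over T b (\<lambda>\<tau>. Poly_Mapping.lookup q m * (\<Prod>i\<in>Poly_Mapping.keys m. u i \<tau> ^ Poly_Mapping.lookup m i))"
    by (rule integral_over_mult[OF integral_over_const])
qed

lemma gen_ring_poly:
  assumes y: "y \<in> gen_ring b Y"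
  shows "(\<lambda>\<tau>. poly p (y \<tau>)) \<in> gen_ring b Y"
proof (induction p)
  case 0
  have "(\<lambda>\<tau>. 0) \<in> gen_ring b Y"
    using linewise_polynomial_const by (rule gen_ring.coef)
  then show ?case by simp
next
  case (pCons a p)
  have "(\<lambda>\<tau>. a) \<in> gen_ring b Y"
    using linewise_polynomial_const by (rule gen_ring.coef)
  from gen_ring.add[OF this gen_ring.mult[OF y pCons.IH]] show ?case by simp
qed

text \<open>
  Transitivity of integrality: an entire algebraic function of an integral function is integral.
\<close>

lemma integral_over_root:
  fixes Q :: "complex \<Rightarrow> complex poly"
  assumes y: "integral_over T b y" and m: "m > 0" and Q: "\<And>w. degree (Q w) = m" "\<And>w. lead_coeff (Q w) = 1"
    and poly: "\<And>i. \<exists>p. \<forall>w. coeff (Q w) i = poly p w"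
    and z: "\<And>\<tau>. \<tau> \<in> T \<Longrightarrow> poly (Q (y \<tau>)) (z \<tau>) = 0"
  shows "integral_over T b z"
proof (rule integral_over_two_generators[OF y m, where B = "\<lambda>j \<tau>. coeff (Q (y \<tau>)) j" and z = z])
  show "(\<lambda>\<tau>. coeff (Q (y \<tau>)) j) \<in> gen_ring b {y}" for j
  proof -
    obtain p where p: "\<forall>w. coeff (Q w) j = poly p w" using poly[of j] ..
    have "(\<lambda>\<tau>. poly p (y \<tau>)) \<in> gen_ring b {y}"
      by (rule gen_ring_poly) (rule gen_ring.gen, simp)
    then show ?thesis by (simp add: p)
  qed
  show "(\<Sum>j<m. coeff (Q (y \<tau>)) j * z \<tau> ^ j) + z \<tau> ^ m = 0" if "\<tau> \<in> T" for \<tau>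
    using z[OF that] Q monic_poly_split[of "Q (y \<tau>)" m "z \<tau>"] by simp
  show "z \<in> gen_ring b {y, z}" by (intro gen_ring.gen) simp
qed

section \<open>Germs and branches of monic families\<close>

lemma transports_section:
  assumes "path \<gamma>" "continuous_on (path_image \<gamma>) f" "\<And>x. x \<in> path_image \<gamma> \<Longrightarrow> poly (R x) (f x) = 0"
  shows "transports R \<gamma> (f (pathstart \<gamma>)) (f (pathfinish \<gamma>))"
proof -
  have "transports R \<gamma> (pathstart (f \<circ> \<gamma>)) (pathfinish (f \<circ> \<gamma>))"
  proof (rule transportsI)
    show "path (f \<circ> \<gamma>)" using assms by (intro path_continuous_image)
    show "poly (R (\<gamma> t)) ((f \<circ> \<gamma>) t) = 0" if "t \<in> {0..1}" for t
      using assms(3) that by (simp add: path_image_def)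
  qed
  then show ?thesis by (simp add: pathstart_compose pathfinish_compose)
qed

lemma germ_at_eq_iff: "germ_at a f = germ_at a g \<longleftrightarrow> (\<forall>\<^sub>F x in nhds a. f x = g x)"
proof
  assume "germ_at a f = germ_at a g"
  moreover have "f \<in> germ_at a f" by (simp add: germ_at_def)
  ultimately show "\<forall>\<^sub>F x in nhds a. f x = g x" by (simp add: germ_at_def)
next
  assume eq: "\<forall>\<^sub>F x in nhds a. f x = g x"
  show "germ_at a f = germ_at a g"
    unfolding germ_at_def
  proof (intro equalityI subsetI CollectI)
    fix h assume "h \<in> {g. \<forall>\<^sub>F x in nhds a. g x = f x}"
    then show "\<forall>\<^sub>F x in nhds a. h x = g x" using eq by (auto elim: eventually_elim2)
  next
    fix h assume "h \<in> {h. \<forall>\<^sub>F x in nhds a. h x = g x}"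
    then show "\<forall>\<^sub>F x in nhds a. h x = f x" using eq by (auto elim: eventually_elim2)
  qed
qed

lemma holomorphic_several_on_imp_continuous_on:
  "holomorphic_several_on f U \<Longrightarrow> continuous_on U f"
  unfolding holomorphic_several_on_def
  by (meson continuous_at_imp_continuous_on has_derivative_continuous)

lemma holomorphic_several_on_line:
  fixes f :: "complex^'n::finite \<Rightarrow> complex"
  assumes f: "holomorphic_several_on f U"
  shows "(\<lambda>t. f (u + t *s v)) holomorphic_on ((\<lambda>t. u + t *s v) -` U)"
proof (rule holomorphic_onI)
  fix t assume t: "t \<in> (\<lambda>t. u + t *s v) -` U"
  then obtain D where D: "(f has_derivative D) (at (u + t *s v))" "\<And>c v. D (c *s v) = c * D v"
    using f unfolding holomorphic_several_on_def by auto
  have bl: "bounded_linear (\<lambda>t. t *s v)"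
  proof (rule linear_conv_bounded_linear[THEN iffD1], rule linearI)
    fix x y show "(x + y) *s v = x *s v + y *s v" by (rule vector_sadd_rdistrib)
  next
    fix r :: real and x show "(r *\<^sub>R x) *s v = r *\<^sub>R (x *s v)"
      by (simp add: Finite_Cartesian_Product.vec_eq_iff)
  qed
  have "((\<lambda>t. u + t *s v) has_derivative (\<lambda>s. s *s v)) (at t)"
    using bounded_linear_imp_has_derivative[OF bl, of "at t"]
    by (auto intro!: derivative_eq_intros)
  from diff_chain_at[OF this D(1)]
  have "((\<lambda>t. f (u + t *s v)) has_derivative (\<lambda>s. s * D v)) (at t)"
    by (simp add: o_def D(2))
  then have "((\<lambda>t. f (u + t *s v)) has_field_derivative D v) (at t)"
    unfolding has_field_derivative_def by (simp add: mult.commute[of _ "D v"])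
  then show "(\<lambda>t. f (u + t *s v)) field_differentiable at t within (\<lambda>t. u + t *s v) -` U"
    using field_differentiable_at_within field_differentiable_def by blast
qed

text \<open>
  On the complex line through \<open>c\<close> and \<open>b\<close> this is the identity theorem in one variable.
\<close>

lemma root_identity_on_ball:
  fixes f :: "complex^'n::finite \<Rightarrow> complex"
  assumes R: "linewise_monic R n" and f: "holomorphic_several_on f (ball a r)"
    and N: "open N" "c \<in> N" "N \<subseteq> ball a r" and root: "\<And>x. x \<in> N \<Longrightarrow> poly (R x) (f x) = 0"
    and b: "b \<in> ball a r"
  shows "poly (R b) (f b) = 0"
proof -
  define L where "L = (\<lambda>t. c + t *s (b - c))"
  have cont: "continuous_on UNIV L" unfolding L_def by (intro continuous_on_line continuous_intros)
  define S where "S = L -` ball a r"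
  have S: "open S" using cont unfolding S_def by (simp add: open_vimage)
  have "convex S" unfolding S_def L_def by (rule convex_line_vimage_ball)
  have "poly (R x) y = (\<Sum>i\<le>n. coeff (R x) i * y ^ i)" for x y
    using linewise_monicD(2)[OF R, of x] by (simp add: poly_altdef)
  moreover have "(\<lambda>t. coeff (R (L t)) i) holomorphic_on S" for i
  proof -
    obtain p where "\<forall>t. coeff (R (c + t *s (b - c))) i = poly p t"
      using linewise_monicD(4)[OF R, of i] unfolding linewise_polynomial_def by blast
    then have "(\<lambda>t. coeff (R (L t)) i) = poly p" by (auto simp: L_def)
    then show ?thesis by (simp add: poly_holomorphic_on)
  qed
  moreover have "(\<lambda>t. f (L t)) holomorphic_on S"
    unfolding L_def S_def by (rule holomorphic_several_on_line[OF f])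
  ultimately have hol: "(\<lambda>t. poly (R (L t)) (f (L t))) holomorphic_on S"
    by (simp add: holomorphic_intros)
  have "(\<lambda>t. poly (R (L t)) (f (L t))) 1 = (\<lambda>_. 0) 1"
  proof (rule analytic_continuation_open[where s = "L -` N" and s' = S and g = "\<lambda>_. 0"
        and f = "\<lambda>t. poly (R (L t)) (f (L t))"])
    show "open (L -` N)" using cont N(1) by (simp add: open_vimage)
    have "0 \<in> L -` N" using N(2) by (simp add: L_def)
    then show "L -` N \<noteq> {}" by blast
    show "connected S" using \<open>convex S\<close> by (simp add: convex_connected)
    show "L -` N \<subseteq> S" using N(3) by (auto simp: S_def)
    show "1 \<in> S" using b by (simp add: S_def L_def)
    show "poly (R (L t)) (f (L t)) = 0" if "t \<in> L -` N" for t using that root by simp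
  qed (use S hol in auto)
  then show ?thesis by (simp add: L_def)
qed

text \<open>
  The relation \<open>A\<close> consists of pairs of a point off \<open>Z\<close> and the value of a branch at it.
\<close>

definition transport_closed :: "('a::topological_space \<Rightarrow> complex poly) \<Rightarrow> 'a set \<Rightarrow> ('a \<times> complex) set \<Rightarrow> bool" where
  "transport_closed R Z A \<longleftrightarrow> (\<forall>\<gamma> y z. path \<gamma> \<longrightarrow> path_image \<gamma> \<subseteq> - Z \<longrightarrow> (pathstart \<gamma>, y) \<in> A \<longrightarrow>
     transports R \<gamma> y z \<longrightarrow> (pathfinish \<gamma>, z) \<in> A)"

text \<open>
  At points of \<open>Z\<close> different branches may have the same value, so there only the equation is
  required.
\<close>

definition local_branch ::
  "(complex^'n::finite \<Rightarrow> complex poly) \<Rightarrow> (complex^'n) set \<Rightarrow> ((complex^'n) \<times> complex) set \<Rightarrow> complex^'n \<Rightarrow> 'n germ \<Rightarrow> bool" where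
  "local_branch R Z A x h \<longleftrightarrow> (\<exists>f U. open U \<and> x \<in> U \<and> continuous_on U f \<and> h = germ_at x f \<and>
     (\<forall>b\<in>U. poly (R b) (f b) = 0) \<and> (\<forall>b\<in>U - Z. (b, f b) \<in> A))"

text \<open>
  The equation spreads over the ball by the identity theorem. Two points of the ball off \<open>Z\<close> are
  joined by a path off \<open>Z\<close>, along which \<open>f\<close> itself is the transport, so membership in \<open>A\<close> spreads too.
\<close>

lemma local_branch_spreads:
  fixes f :: "complex^'n::finite \<Rightarrow> complex"
  assumes R: "linewise_monic R n" and Z: "thin Z" and A: "transport_closed R Z A"
    and f: "holomorphic_several_on f (ball a r)" and x: "x \<in> ball a r"
    and br: "local_branch R Z A x (germ_at x f)" and b: "b \<in> ball a r"
  shows "poly (R b) (f b) = 0" and "b \<notin> Z \<Longrightarrow> (b, f b) \<in> A"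
proof -
  obtain g U where U: "open U" "x \<in> U" and g: "germ_at x f = germ_at x g"
    "\<And>b. b \<in> U \<Longrightarrow> poly (R b) (g b) = 0" "\<And>b. b \<in> U \<Longrightarrow> b \<notin> Z \<Longrightarrow> (b, g b) \<in> A"
    using br unfolding local_branch_def by auto
  obtain T where T: "open T" "x \<in> T" "\<And>y. y \<in> T \<Longrightarrow> f y = g y"
    using g(1) unfolding germ_at_eq_iff eventually_nhds by blast
  define N where "N = T \<inter> U \<inter> ball a r"
  have N: "open N" "x \<in> N" "N \<subseteq> ball a r" using T U x by (auto simp: N_def)
  have root: "poly (R y) (f y) = 0" if "y \<in> ball a r" for y
    by (rule root_identity_on_ball[OF R f N _ that]) (use T g in \<open>auto simp: N_def\<close>)
  show "poly (R b) (f b) = 0" by (rule root[OF b])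
  assume bZ: "b \<notin> Z"
  obtain c where c: "c \<in> N" "c \<notin> Z" using thin_dense[OF Z N(1,2)] by blast
  have "c \<in> ball a r - Z" "b \<in> ball a r - Z" using c N b bZ by auto
  then obtain \<gamma> where \<gamma>: "path \<gamma>" "path_image \<gamma> \<subseteq> ball a r - Z" "pathstart \<gamma> = c" "pathfinish \<gamma> = b"
    using path_connected_ball_minus_thin[OF Z, of a r] unfolding path_connected_def by blast
  have "path_image \<gamma> \<subseteq> ball a r" using \<gamma>(2) by blast
  then have "transports R \<gamma> (f (pathstart \<gamma>)) (f (pathfinish \<gamma>))"
    using \<gamma>(1) root continuous_on_subset[OF holomorphic_several_on_imp_continuous_on[OF f]]
    by (intro transports_section) auto
  then have "transports R \<gamma> (f c) (f b)" using \<gamma> by simp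
  moreover have "(c, f c) \<in> A" using c T g(3) by (auto simp: N_def)
  ultimately show "(b, f b) \<in> A"
    using A \<gamma> unfolding transport_closed_def by blast
qed

lemma holomorphic_several_on_subset:
  "holomorphic_several_on f U \<Longrightarrow> open V \<Longrightarrow> V \<subseteq> U \<Longrightarrow> holomorphic_several_on f V"
  unfolding holomorphic_several_on_def by blast

lemma locally_constant_on_unit_interval:
  fixes P :: "real \<Rightarrow> bool"
  assumes loc: "\<And>t. t \<in> {0..1} \<Longrightarrow> \<exists>e>0. \<forall>s\<in>{0..1}. \<bar>s - t\<bar> < e \<longrightarrow> P s = P t"
    and "s \<in> {0..1}" "t \<in> {0..1}" "P s"
  shows "P t"
proof -
  have "P s = P t"
  proof (rule connected_local_const[of "{0..1}"])
    show "\<forall>t\<in>{0..1}. \<forall>\<^sub>F s in at t within {0..1}. P t = P s"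
    proof
      fix t :: real assume t: "t \<in> {0..1}"
      then obtain e where e: "e > 0" "\<forall>s\<in>{0..1}. \<bar>s - t\<bar> < e \<longrightarrow> P s = P t" using loc by blast
      then show "\<forall>\<^sub>F s in at t within {0..1}. P t = P s"
        unfolding eventually_at dist_real_def by blast
    qed
  qed (use assms in auto)
  then show ?thesis using assms by simp
qed

text \<open>
  The germs along the path in the definition of \<open>continues_along\<close>.
\<close>

definition continuation_family :: "(real \<Rightarrow> complex^'n::finite) \<Rightarrow> (real \<Rightarrow> 'n germ) \<Rightarrow> bool" where
  "continuation_family \<gamma> G \<longleftrightarrow> path \<gamma> \<and> (\<forall>t\<in>{0..1}. \<exists>U f. holomorphic_several_on f U \<and> \<gamma> t \<in> U \<and>
     (\<exists>e>0. \<forall>s\<in>{0..1}. \<bar>s - t\<bar> < e \<longrightarrow> \<gamma> s \<in> U \<and> G s = germ_at (\<gamma> s) f))"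

lemma continues_along_iff:
  "continues_along \<gamma> g h \<longleftrightarrow> (\<exists>G. continuation_family \<gamma> G \<and> G 0 = g \<and> G 1 = h)"
  unfolding continues_along_def continuation_family_def by blast

lemma continuation_family_local:
  assumes "continuation_family \<gamma> G" "t \<in> {0..1}"
  shows "\<exists>f r e. r > 0 \<and> e > 0 \<and> holomorphic_several_on f (ball (\<gamma> t) r) \<and>
    (\<forall>s\<in>{0..1}. \<bar>s - t\<bar> < e \<longrightarrow> \<gamma> s \<in> ball (\<gamma> t) r \<and> G s = germ_at (\<gamma> s) f)"
proof -
  obtain U f e where U: "holomorphic_several_on f U" "\<gamma> t \<in> U" and e: "e > 0"
    "\<forall>s\<in>{0..1}. \<bar>s - t\<bar> < e \<longrightarrow> \<gamma> s \<in> U \<and> G s = germ_at (\<gamma> s) f"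
    using assms unfolding continuation_family_def by blast
  have "open U" using U by (simp add: holomorphic_several_on_def)
  then obtain r where r: "r > 0" "ball (\<gamma> t) r \<subseteq> U" using U(2) open_contains_ball by blast
  have "continuous_on {0..1} \<gamma>" using assms(1) by (simp add: continuation_family_def path_def)
  then obtain d where d: "d > 0" "\<forall>s\<in>{0..1}. dist s t < d \<longrightarrow> dist (\<gamma> s) (\<gamma> t) < r"
    using assms(2) r(1) unfolding continuous_on_iff by blast
  show ?thesis
  proof (rule exI[of _ f], rule exI[of _ r], rule exI[of _ "min d e"], intro conjI ballI impI)
    show "holomorphic_several_on f (ball (\<gamma> t) r)"
      using U(1) r(2) by (intro holomorphic_several_on_subset[OF U(1)]) auto
    show "\<gamma> s \<in> ball (\<gamma> t) r" "G s = germ_at (\<gamma> s) f" if "s \<in> {0..1}" "\<bar>s - t\<bar> < min d e" for s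
      using d e that by (simp_all add: dist_commute dist_real_def)
  qed (use r d e in auto)
qed

text \<open>
  Near each parameter the germs are represented by one function on a ball, so the property is
  locally constant along the path. The path may meet \<open>Z\<close>.
\<close>

lemma local_branch_continuation:
  assumes R: "linewise_monic R n" and Z: "thin Z" and A: "transport_closed R Z A"
    and G: "continuation_family \<gamma> G" and 0: "local_branch R Z A (\<gamma> 0) (G 0)" and t: "t \<in> {0..1}"
  shows "local_branch R Z A (\<gamma> t) (G t)"
proof (rule locally_constant_on_unit_interval[of "\<lambda>t. local_branch R Z A (\<gamma> t) (G t)" 0])
  fix t :: real assume t: "t \<in> {0..1}"
  obtain f r e where r: "r > 0" and e: "e > 0" and f: "holomorphic_several_on f (ball (\<gamma> t) r)"
    and "\<forall>s\<in>{0..1}. \<bar>s - t\<bar> < e \<longrightarrow> \<gamma> s \<in> ball (\<gamma> t) r \<and> G s = germ_at (\<gamma> s) f"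
    using continuation_family_local[OF G t] by blast
  then have near: "\<gamma> s \<in> ball (\<gamma> t) r \<and> G s = germ_at (\<gamma> s) f" if "s \<in> {0..1}" "\<bar>s - t\<bar> < e" for s
    using that by blast
  have move: "local_branch R Z A (\<gamma> s') (G s')"
    if s: "s \<in> {0..1}" "\<bar>s - t\<bar> < e" "local_branch R Z A (\<gamma> s) (G s)"
      and s': "s' \<in> {0..1}" "\<bar>s' - t\<bar> < e" for s s'
  proof -
    have "local_branch R Z A (\<gamma> s) (germ_at (\<gamma> s) f)" "\<gamma> s \<in> ball (\<gamma> t) r"
      using s near[OF s(1,2)] by auto
    note spread = local_branch_spreads[OF R Z A f this(2,1)]
    show ?thesis unfolding local_branch_def
    proof (intro exI[of _ f] exI[of _ "ball (\<gamma> t) r"] conjI ballI)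
      show "\<gamma> s' \<in> ball (\<gamma> t) r" "G s' = germ_at (\<gamma> s') f" using near[OF s'] by auto
      show "continuous_on (ball (\<gamma> t) r) f" by (rule holomorphic_several_on_imp_continuous_on[OF f])
      show "poly (R b) (f b) = 0" if "b \<in> ball (\<gamma> t) r" for b using spread(1)[OF that] .
      show "(b, f b) \<in> A" if "b \<in> ball (\<gamma> t) r - Z" for b using spread(2) that by auto
    qed simp
  qed
  have "local_branch R Z A (\<gamma> s) (G s) = local_branch R Z A (\<gamma> t) (G t)"
    if "s \<in> {0..1}" "\<bar>s - t\<bar> < e" for s
    using move[of s t] move[of t s] t that e by auto
  then show "\<exists>e>0. \<forall>s\<in>{0..1}. \<bar>s - t\<bar> < e \<longrightarrow> local_branch R Z A (\<gamma> s) (G s) = local_branch R Z A (\<gamma> t) (G t)"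
    using e by blast
qed (use 0 t in auto)

section \<open>Iterated commutators of loops\<close>

text \<open>
  Permutations are composed from right to left and paths from left to right. So if \<open>\<alpha>\<close> and \<open>\<beta>\<close>
  induce the permutations \<open>h2\<close> and \<open>h1\<close>, this loop induces the commutator of \<open>h1\<close> and \<open>h2\<close>.
\<close>

abbreviation loop_commutator :: "(real \<Rightarrow> 'a::topological_space) \<Rightarrow> (real \<Rightarrow> 'a) \<Rightarrow> real \<Rightarrow> 'a" where
  "loop_commutator \<alpha> \<beta> \<equiv> reversepath \<alpha> +++ (reversepath \<beta> +++ (\<alpha> +++ \<beta>))"

text \<open>
  Loops representing the elements of the \<open>n\<close>-th derived subgroup of the fundamental group of \<open>S\<close>.
  Inverses of commutators are commutators, so no rule for inverses occurs.
\<close>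

inductive derived_loop :: "'a::topological_space set \<Rightarrow> 'a \<Rightarrow> nat \<Rightarrow> (real \<Rightarrow> 'a) \<Rightarrow> bool" for S x where
  loop: "path \<gamma> \<Longrightarrow> path_image \<gamma> \<subseteq> S \<Longrightarrow> pathstart \<gamma> = x \<Longrightarrow> pathfinish \<gamma> = x \<Longrightarrow> derived_loop S x 0 \<gamma>"
| const: "x \<in> S \<Longrightarrow> derived_loop S x (Suc n) (\<lambda>_. x)"
| commutator: "derived_loop S x n \<alpha> \<Longrightarrow> derived_loop S x n \<beta> \<Longrightarrow>
    derived_loop S x (Suc n) (loop_commutator \<alpha> \<beta>)"
| join: "derived_loop S x (Suc n) \<alpha> \<Longrightarrow> derived_loop S x (Suc n) \<beta> \<Longrightarrow> derived_loop S x (Suc n) (\<alpha> +++ \<beta>)"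

lemma derived_loop_imp_loop:
  assumes "derived_loop S x n \<gamma>"
  shows "path \<gamma> \<and> path_image \<gamma> \<subseteq> S \<and> pathstart \<gamma> = x \<and> pathfinish \<gamma> = x"
  using assms
proof induction
  case (const n)
  then show ?case by (auto simp: path_def pathstart_def pathfinish_def path_image_def)
qed (auto simp: path_image_join)

lemma derived_loop_mono:
  assumes "derived_loop S x n \<gamma>" "S \<subseteq> S'"
  shows "derived_loop S' x n \<gamma>"
  using assms(1)
proof induction
  case (loop \<gamma>)
  then show ?case using assms(2) by (intro derived_loop.loop) auto
next
  case (const n)
  then show ?case using assms(2) by (intro derived_loop.const) auto
next
  case (commutator n \<alpha> \<beta>)
  show ?case by (rule derived_loop.commutator[OF commutator.IH])
next
  case (join n \<alpha> \<beta>)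
  show ?case by (rule derived_loop.join[OF join.IH])
qed

text \<open>
  The derived series is decreasing.
\<close>

lemma derived_loop_Suc:
  assumes "derived_loop S x (Suc m) \<gamma>" shows "derived_loop S x m \<gamma>"
proof (cases m)
  case 0
  then show ?thesis using derived_loop_imp_loop[OF assms] by (auto intro: derived_loop.loop)
next
  case (Suc k)
  have "\<forall>k. n = Suc (Suc k) \<longrightarrow> derived_loop S x (Suc k) \<gamma>" if "derived_loop S x n \<gamma>" for n
    using that
  proof induction
    case (commutator n \<alpha> \<beta>)
    have "derived_loop S x (Suc k) (loop_commutator \<alpha> \<beta>)" if "n = Suc k" for k
    proof (rule derived_loop.commutator)
      show "derived_loop S x k \<alpha>" "derived_loop S x k \<beta>"
        using commutator that derived_loop_imp_loop[of S x n]
        by (cases k; auto intro: derived_loop.loop)+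
    qed
    then show ?case by simp
  next
    case (join n \<alpha> \<beta>)
    have "derived_loop S x (Suc k) (\<alpha> +++ \<beta>)" if "n = Suc k" for k
      using join.IH that by (intro derived_loop.join) simp_all
    then show ?case by simp
  qed (simp_all add: derived_loop.const)
  then show ?thesis using assms Suc by simp
qed

lemma derived_loop_antimono:
  assumes "derived_loop S x n \<gamma>" "m \<le> n" shows "derived_loop S x m \<gamma>"
  using assms(2,1) by (induction rule: inc_induct) (auto dest: derived_loop_Suc)

section \<open>Tame multivalued functions\<close>

definition loops_trivial_near ::
  "('a::metric_space \<Rightarrow> complex poly) \<Rightarrow> 'a set \<Rightarrow> ('a \<times> complex) set \<Rightarrow> 'a \<Rightarrow> bool" where
  "loops_trivial_near R Z A p \<longleftrightarrow> (\<exists>e>0. \<exists>d. \<forall>x y \<gamma>. (x, y) \<in> A \<longrightarrow>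
     derived_loop (ball p e - Z) x d \<gamma> \<longrightarrow> transports R \<gamma> y y)"

lemma loops_trivial_nearI:
  assumes "e > 0" "\<And>x y \<gamma>. (x, y) \<in> A \<Longrightarrow> derived_loop (ball p e - Z) x d \<gamma> \<Longrightarrow> transports R \<gamma> y y"
  shows "loops_trivial_near R Z A p"
  unfolding loops_trivial_near_def using assms by (intro exI[of _ e] exI[of _ d]) blast

text \<open>
  The invariant of compositions. The values of the branches satisfy the monic equation \<open>R\<close> and, off
  the exceptional set \<open>Z\<close>, form the relation \<open>A\<close>, which may omit some of the roots of \<open>R\<close>. The
  last condition is solvability of the local monodromy, expressed by loops: near every point, all
  loops of some depth in the derived series act trivially.
\<close>

definition tame_branches ::
  "(complex^'n::finite \<Rightarrow> complex poly) \<Rightarrow> (complex^'n) set \<Rightarrow> ((complex^'n) \<times> complex) set \<Rightarrow> bool" where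
  "tame_branches R Z A \<longleftrightarrow> (\<exists>n. linewise_monic R n) \<and> thin Z \<and> branch_locus R \<subseteq> Z \<and>
     (\<forall>x y. (x, y) \<in> A \<longrightarrow> x \<notin> Z \<and> poly (R x) y = 0) \<and> transport_closed R Z A \<and>
     (\<forall>p. loops_trivial_near R Z A p)"

definition tame :: "('n::finite) multifun \<Rightarrow> bool" where
  "tame F \<longleftrightarrow> (\<exists>R Z A. tame_branches R Z A \<and> (\<forall>x h. (x, h) \<in> F \<longrightarrow> local_branch R Z A x h))"

lemma tame_generated_multifun:
  assumes "tame_branches R Z A" "local_branch R Z A a g"
  shows "tame (generated_multifun a g)"
  unfolding tame_def
proof (intro exI conjI allI impI)
  show T: "tame_branches R Z A" by fact
  obtain n where n: "linewise_monic R n" using T by (auto simp: tame_branches_def)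
  fix x h assume "(x, h) \<in> generated_multifun a g"
  then obtain \<gamma> G where "pathstart \<gamma> = a" "pathfinish \<gamma> = x" "continuation_family \<gamma> G" "G 0 = g" "G 1 = h"
    unfolding generated_multifun_def continues_along_iff by blast
  then show "local_branch R Z A x h"
    using local_branch_continuation[OF n, of Z A \<gamma> G 1] assms T
    by (auto simp: tame_branches_def pathstart_def pathfinish_def)
qed

lemma local_branch_germ_eq:
  assumes "local_branch R Z A x (germ_at x f)"
  obtains U where "open U" "x \<in> U" "continuous_on U f"
    "\<And>b. b \<in> U \<Longrightarrow> poly (R b) (f b) = 0" "\<And>b. b \<in> U \<Longrightarrow> b \<notin> Z \<Longrightarrow> (b, f b) \<in> A"
proof -
  obtain g U where U: "open U" "x \<in> U" "continuous_on U g" and g: "germ_at x f = germ_at x g"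
    "\<And>b. b \<in> U \<Longrightarrow> poly (R b) (g b) = 0" "\<And>b. b \<in> U \<Longrightarrow> b \<notin> Z \<Longrightarrow> (b, g b) \<in> A"
    using assms unfolding local_branch_def by auto
  obtain T where T: "open T" "x \<in> T" "\<And>y. y \<in> T \<Longrightarrow> f y = g y"
    using g(1) unfolding germ_at_eq_iff eventually_nhds by blast
  show thesis
  proof (rule that[of "T \<inter> U"])
    have "continuous_on (T \<inter> U) g" using U(3) continuous_on_subset by blast
    then show "continuous_on (T \<inter> U) f" by (rule continuous_on_eq) (use T in auto)
  qed (use T U g in auto)
qed

text \<open>
  A single-valued function is the only root of a monic equation of degree one.
\<close>

lemma tame_coefficient:
  fixes c :: "complex^'n::finite \<Rightarrow> complex"
  assumes c: "linewise_polynomial c"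
  shows "tame (generated_multifun a (germ_at a c))"
proof (rule tame_generated_multifun)
  define R where "R = (\<lambda>x. [:- c x, 1:])"
  have root: "poly (R x) y = 0 \<longleftrightarrow> y = c x" for x y by (simp add: R_def add_eq_0_iff2)
  have R: "linewise_monic R 1" unfolding R_def by (rule linewise_monic_linear[OF c])
  have "roots (R x) = {c x}" for x by (simp add: root)
  then have "branch_locus R = {}" by (simp add: branch_locus_def)
  have cont: "continuous_on UNIV c" using c by (simp add: linewise_polynomial_def)
  have loops: "transports R \<gamma> (c x) (c x)" if "derived_loop S x d \<gamma>" for S x d \<gamma>
  proof -
    have \<gamma>: "path \<gamma>" "pathstart \<gamma> = x" "pathfinish \<gamma> = x" using derived_loop_imp_loop[OF that] by auto
    then have "transports R \<gamma> (c (pathstart \<gamma>)) (c (pathfinish \<gamma>))"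
      using continuous_on_subset[OF cont] root by (intro transports_section) auto
    then show ?thesis using \<gamma> by simp
  qed
  have closed: "transport_closed R {} {(x, c x) | x. True}"
    unfolding transport_closed_def
  proof (intro allI impI)
    fix \<gamma> y z assume "transports R \<gamma> y z"
    then obtain h where "pathfinish h = z" "\<forall>t\<in>{0..1}. poly (R (\<gamma> t)) (h t) = 0"
      unfolding transports_def by blast
    then have "z = c (pathfinish \<gamma>)" by (auto simp: root pathfinish_def)
    then show "(pathfinish \<gamma>, z) \<in> {(x, c x) | x. True}" by simp
  qed
  show "tame_branches R {} {(x, c x) | x. True}"
    unfolding tame_branches_def
  proof (intro conjI allI impI)
    show "\<exists>n. linewise_monic R n" using R by blast
    fix p :: "complex^'n"
    show "loops_trivial_near R {} {(x, c x) | x. True} p"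
      by (rule loops_trivial_nearI[of 1 _ _ _ 0]) (use loops in auto)
  qed (use closed \<open>branch_locus R = {}\<close> in \<open>auto simp: thin_empty root\<close>)
  show "local_branch R {} {(x, c x) | x. True} a (germ_at a c)"
    unfolding local_branch_def
    by (rule exI[of _ c], rule exI[of _ UNIV]) (use cont root in auto)
qed

section \<open>Polynomials in tame functions\<close>

lemma eval_mvpoly_cong:
  assumes "\<And>i. i \<in> vars_mvpoly q \<Longrightarrow> x i = y i"
  shows "eval_mvpoly x q = eval_mvpoly y q"
  unfolding eval_mvpoly_def
proof (intro sum.cong refl arg_cong2[where f = "(*)"] prod.cong)
  fix m i assume "m \<in> Poly_Mapping.keys q" "i \<in> Poly_Mapping.keys m"
  then have "x i = y i" using assms by (auto simp: vars_mvpoly_def)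
  then show "x i ^ Poly_Mapping.lookup m i = y i ^ Poly_Mapping.lookup m i" by simp
qed

lemma continuous_on_eval_mvpoly:
  assumes "\<And>i. i \<in> vars_mvpoly q \<Longrightarrow> continuous_on S (f i)"
  shows "continuous_on S (\<lambda>x. eval_mvpoly (\<lambda>i. f i x) q)"
  unfolding eval_mvpoly_def
proof (intro continuous_on_sum continuous_on_mult continuous_on_const continuous_on_prod continuous_on_power)
  fix m i assume "m \<in> Poly_Mapping.keys q" "i \<in> Poly_Mapping.keys m"
  then show "continuous_on S (f i)" using assms by (auto simp: vars_mvpoly_def)
qed

lemma transports_eval_mvpoly:
  assumes vars: "vars_mvpoly q \<subseteq> {..<k}"
    and tr: "\<And>i. i < k \<Longrightarrow> transports (R i) \<gamma> (y i) (y' i)"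
    and root: "\<And>x v. (\<And>i. i < k \<Longrightarrow> poly (R i x) (v i) = 0) \<Longrightarrow> poly (S x) (eval_mvpoly v q) = 0"
  shows "transports S \<gamma> (eval_mvpoly y q) (eval_mvpoly y' q)"
proof -
  have "\<forall>i. \<exists>h. i < k \<longrightarrow> path h \<and> pathstart h = y i \<and> pathfinish h = y' i \<and> (\<forall>t\<in>{0..1}. poly (R i (\<gamma> t)) (h t) = 0)"
    using tr unfolding transports_def by blast
  from choice[OF this] obtain h where h: "\<forall>i. i < k \<longrightarrow> path (h i) \<and> pathstart (h i) = y i \<and>
      pathfinish (h i) = y' i \<and> (\<forall>t\<in>{0..1}. poly (R i (\<gamma> t)) (h i t) = 0)" ..
  define H where "H = (\<lambda>t. eval_mvpoly (\<lambda>i. h i t) q)"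
  have "transports S \<gamma> (pathstart H) (pathfinish H)"
  proof (rule transportsI)
    show "path H" unfolding H_def path_def
      by (rule continuous_on_eval_mvpoly) (use h vars in \<open>auto simp: path_def\<close>)
    show "poly (S (\<gamma> t)) (H t) = 0" if "t \<in> {0..1}" for t
      unfolding H_def by (rule root) (use h that in blast)
  qed
  moreover have "pathstart H = eval_mvpoly y q" "pathfinish H = eval_mvpoly y' q"
    unfolding H_def pathstart_def pathfinish_def
    by (rule eval_mvpoly_cong; use h vars in \<open>auto simp: pathstart_def pathfinish_def\<close>)+
  ultimately show ?thesis by simp
qed

lemma tame_branchesD:
  assumes "tame_branches R Z A"
  shows "\<exists>n. linewise_monic R n" "thin Z" "branch_locus R \<subseteq> Z"
    "\<And>x y. (x, y) \<in> A \<Longrightarrow> x \<notin> Z" "\<And>x y. (x, y) \<in> A \<Longrightarrow> poly (R x) y = 0" "transport_closed R Z A"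
    "loops_trivial_near R Z A p"
  using assms unfolding tame_branches_def by blast+

text \<open>
  The values at a point are obtained by independent choices of branches of the \<open>F i\<close>; a loop that
  acts trivially on all of these branches acts trivially on the result.
\<close>

lemma tame_polynomial:
  fixes F :: "nat \<Rightarrow> ('n::finite) multifun"
  assumes vars: "vars_mvpoly q \<subseteq> {..<k}" and F: "\<And>i. i < k \<Longrightarrow> tame (F i)"
    and germ: "\<And>i. i < k \<Longrightarrow> (a, germ_at a (f i)) \<in> F i"
  shows "tame (generated_multifun a (germ_at a (\<lambda>x. eval_mvpoly (\<lambda>i. f i x) q)))"
proof -
  have "\<forall>i. \<exists>R Z A. i < k \<longrightarrow> tame_branches R Z A \<and> local_branch R Z A a (germ_at a (f i))"
    using F germ unfolding tame_def by blast
  from choice[OF this] obtain R where "\<forall>i. \<exists>Z A. i < k \<longrightarrow> tame_branches (R i) Z A \<and> local_branch (R i) Z A a (germ_at a (f i))" ..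
  from choice[OF this] obtain Z where "\<forall>i. \<exists>A. i < k \<longrightarrow> tame_branches (R i) (Z i) A \<and> local_branch (R i) (Z i) A a (germ_at a (f i))" ..
  from choice[OF this] obtain A where RZA: "\<forall>i. i < k \<longrightarrow> tame_branches (R i) (Z i) (A i) \<and> local_branch (R i) (Z i) (A i) a (germ_at a (f i))" ..
  have T: "tame_branches (R i) (Z i) (A i)" and br: "local_branch (R i) (Z i) (A i) a (germ_at a (f i))" if "i < k" for i
    using RZA that by auto
  define P where "P = {(x :: complex^'n, v :: nat \<Rightarrow> complex). \<forall>i<k. poly (R i x) (v i) = 0}"
  have "integral_over P fst (\<lambda>\<tau>. snd \<tau> i)" if "i < k" for i
    using tame_branchesD(1)[OF T[OF that]] that unfolding integral_over_def by (auto simp: P_def)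
  then have "integral_over P fst (\<lambda>\<tau>. eval_mvpoly (\<lambda>i. snd \<tau> i) q)"
    using vars by (intro integral_over_eval_mvpoly) auto
  then obtain S n where S: "linewise_monic S n" and "\<forall>\<tau>\<in>P. poly (S (fst \<tau>)) (eval_mvpoly (\<lambda>i. snd \<tau> i) q) = 0"
    unfolding integral_over_def by blast
  then have root: "poly (S x) (eval_mvpoly v q) = 0" if "\<And>i. i < k \<Longrightarrow> poly (R i x) (v i) = 0" for x v
    using that by (auto simp: P_def)
  note S' = linewise_monic_imp_monic_family[OF S]
  define Y where "Y = branch_locus S \<union> (\<Union>i\<in>{..<k}. Z i)"
  define B where "B = {(x, eval_mvpoly y q) | x y. x \<notin> Y \<and> (\<forall>i<k. (x, y i) \<in> A i)}"
  have B_I: "(x, eval_mvpoly y q) \<in> B" if "x \<notin> Y" "\<forall>i<k. (x, y i) \<in> A i" for x y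
    unfolding B_def using that by blast
  have ZY: "Z i \<subseteq> Y" if "i < k" for i using that by (auto simp: Y_def)
  show ?thesis
  proof (rule tame_generated_multifun)
    show "tame_branches S Y B"
      unfolding tame_branches_def
    proof (intro conjI allI impI)
      show "\<exists>n. linewise_monic S n" using S by blast
      show "thin Y" unfolding Y_def
        using thin_branch_locus[OF S] tame_branchesD(2)[OF T] by (intro thin_Un thin_UN) auto
      show "branch_locus S \<subseteq> Y" by (auto simp: Y_def)
      fix x z assume "(x, z) \<in> B"
      then obtain y where y: "z = eval_mvpoly y q" "x \<notin> Y" "\<forall>i<k. (x, y i) \<in> A i" by (auto simp: B_def)
      show "x \<notin> Y" by fact
      show "poly (S x) z = 0" unfolding y(1) using y(3) tame_branchesD(5)[OF T] by (intro root) blast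
    next
      show "transport_closed S Y B"
        unfolding transport_closed_def
      proof (intro allI impI)
        fix \<gamma> z z' assume \<gamma>: "path \<gamma>" "path_image \<gamma> \<subseteq> - Y" and z: "(pathstart \<gamma>, z) \<in> B" and tr: "transports S \<gamma> z z'"
        obtain y where y: "z = eval_mvpoly y q" "\<forall>i<k. (pathstart \<gamma>, y i) \<in> A i" using z by (auto simp: B_def)
        have "\<exists>w. transports (R i) \<gamma> (y i) w" if i: "i < k" for i
        proof -
          obtain m where "linewise_monic (R i) m" using tame_branchesD(1)[OF T[OF i]] by blast
          moreover have "path_image \<gamma> \<subseteq> - branch_locus (R i)"
            using \<gamma>(2) tame_branchesD(3)[OF T[OF i]] ZY[OF i] by blast
          moreover have "poly (R i (pathstart \<gamma>)) (y i) = 0"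
            using tame_branchesD(5)[OF T[OF i]] y(2) i by blast
          ultimately show ?thesis
            using transports_exists[OF linewise_monic_imp_monic_family _ _ ] \<gamma>(1) by blast
        qed
        then have "\<forall>i. \<exists>w. i < k \<longrightarrow> transports (R i) \<gamma> (y i) w" by blast
        from choice[OF this] obtain y' where "\<forall>i. i < k \<longrightarrow> transports (R i) \<gamma> (y i) (y' i)" ..
        then have y': "transports (R i) \<gamma> (y i) (y' i)" if "i < k" for i using that by blast
        have "transports S \<gamma> z (eval_mvpoly y' q)"
          unfolding y(1) by (rule transports_eval_mvpoly[OF vars y' root])
        then have "z' = eval_mvpoly y' q"
          using transports_unique[OF S' \<gamma>(1) _ tr] \<gamma>(2) by (auto simp: Y_def)
        moreover have "(pathfinish \<gamma>, y' i) \<in> A i" if i: "i < k" for i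
          using tame_branchesD(6)[OF T[OF i]] \<gamma> y(2) y'[OF i] i ZY[OF i] unfolding transport_closed_def by blast
        moreover have "pathfinish \<gamma> \<notin> Y" using \<gamma>(2) pathfinish_in_path_image by blast
        ultimately show "(pathfinish \<gamma>, z') \<in> B" by (auto simp: B_def)
      qed
    next
      fix p
      have "\<forall>i. \<exists>e d. i < k \<longrightarrow> e > 0 \<and> (\<forall>x y \<gamma>. (x, y) \<in> A i \<longrightarrow> derived_loop (ball p e - Z i) x d \<gamma> \<longrightarrow> transports (R i) \<gamma> y y)"
        using tame_branchesD(7)[OF T, of _ p] unfolding loops_trivial_near_def by blast
      from choice[OF this] obtain e where "\<forall>i. \<exists>d. i < k \<longrightarrow> e i > 0 \<and>
          (\<forall>x y \<gamma>. (x, y) \<in> A i \<longrightarrow> derived_loop (ball p (e i) - Z i) x d \<gamma> \<longrightarrow> transports (R i) \<gamma> y y)" ..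
      from choice[OF this] obtain d where ed: "\<forall>i. i < k \<longrightarrow> e i > 0 \<and>
          (\<forall>x y \<gamma>. (x, y) \<in> A i \<longrightarrow> derived_loop (ball p (e i) - Z i) x (d i) \<gamma> \<longrightarrow> transports (R i) \<gamma> y y)" ..
      (* The additional elements 1 and 0 make Min and Max meaningful for k = 0. *)
      define e0 where "e0 = Min (insert 1 (e ` {..<k}))"
      define d0 where "d0 = Max (insert 0 (d ` {..<k}))"
      have e0: "e0 > 0" using ed by (auto simp: e0_def)
      have le: "e0 \<le> e i" "d i \<le> d0" if "i < k" for i
        using that by (auto simp: e0_def d0_def intro!: Min_le Max_ge)
      have "transports S \<gamma> z z" if z: "(x, z) \<in> B" and \<gamma>: "derived_loop (ball p e0 - Y) x d0 \<gamma>" for x z \<gamma>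
      proof -
        obtain y where y: "z = eval_mvpoly y q" "\<forall>i<k. (x, y i) \<in> A i" using z by (auto simp: B_def)
        have "transports (R i) \<gamma> (y i) (y i)" if i: "i < k" for i
        proof -
          have "ball p e0 - Y \<subseteq> ball p (e i) - Z i" using le(1)[OF i] ZY[OF i] by auto
          then have "derived_loop (ball p (e i) - Z i) x (d i) \<gamma>"
            using derived_loop_mono derived_loop_antimono[OF _ le(2)[OF i]] \<gamma> by blast
          then show ?thesis using ed i y(2) by blast
        qed
        then show ?thesis unfolding y(1) by (rule transports_eval_mvpoly[OF vars _ root])
      qed
      then show "loops_trivial_near S Y B p" by (intro loops_trivial_nearI[OF e0])
    qed
    have "\<forall>i. \<exists>U. i < k \<longrightarrow> open U \<and> a \<in> U \<and> continuous_on U (f i) \<and> (\<forall>b\<in>U. poly (R i b) (f i b) = 0) \<and>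
        (\<forall>b\<in>U. b \<notin> Z i \<longrightarrow> (b, f i b) \<in> A i)"
    proof
      fix i
      show "\<exists>U. i < k \<longrightarrow> open U \<and> a \<in> U \<and> continuous_on U (f i) \<and> (\<forall>b\<in>U. poly (R i b) (f i b) = 0) \<and>
        (\<forall>b\<in>U. b \<notin> Z i \<longrightarrow> (b, f i b) \<in> A i)"
      proof (cases "i < k")
        case True
        show ?thesis by (rule local_branch_germ_eq[OF br[OF True]]) blast
      qed blast
    qed
    from choice[OF this] obtain U where U: "\<forall>i. i < k \<longrightarrow> open (U i) \<and> a \<in> U i \<and> continuous_on (U i) (f i) \<and>
        (\<forall>b\<in>U i. poly (R i b) (f i b) = 0) \<and> (\<forall>b\<in>U i. b \<notin> Z i \<longrightarrow> (b, f i b) \<in> A i)" ..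
    define V where "V = (\<Inter>i\<in>{..<k}. U i)"
    have VU: "V \<subseteq> U i" if "i < k" for i using that by (auto simp: V_def)
    show "local_branch S Y B a (germ_at a (\<lambda>x. eval_mvpoly (\<lambda>i. f i x) q))"
      unfolding local_branch_def
    proof (rule exI[of _ "\<lambda>x. eval_mvpoly (\<lambda>i. f i x) q"], rule exI[of _ V], intro conjI ballI)
      show "open V" unfolding V_def using U by (intro open_INT) auto
      show "a \<in> V" using U by (auto simp: V_def)
      show "continuous_on V (\<lambda>x. eval_mvpoly (\<lambda>i. f i x) q)"
      proof (rule continuous_on_eval_mvpoly)
        fix i assume "i \<in> vars_mvpoly q"
        then have "i < k" using vars by auto
        then have "continuous_on (U i) (f i)" "V \<subseteq> U i" using U VU by simp_all
        then show "continuous_on V (f i)" by (rule continuous_on_subset)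
      qed
      show "poly (S b) (eval_mvpoly (\<lambda>i. f i b) q) = 0" if "b \<in> V" for b
      proof (rule root)
        fix i assume "i < k"
        then show "poly (R i b) (f i b) = 0" using U VU[of i] that by auto
      qed
      show "(b, eval_mvpoly (\<lambda>i. f i b) q) \<in> B" if b: "b \<in> V - Y" for b
      proof -
        have bA: "\<forall>i<k. (b, f i b) \<in> A i"
        proof (intro allI impI)
          fix i assume i: "i < k"
          have "b \<in> U i" "b \<notin> Z i" using VU[OF i] ZY[OF i] b by auto
          then show "(b, f i b) \<in> A i" using U i by auto
        qed
        have "b \<notin> Y" using b by simp
        then show ?thesis using bA by (rule B_I)
      qed
    qed simp
  qed
qed

section \<open>Entire algebraic functions of tame functions\<close>

text \<open>
  For \<open>F = {}\<close> this is the contractibility of the disc. Otherwise the commutator has winding number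
  \<open>0\<close> about \<open>w\<close>, hence is null-homotopic in the plane without \<open>w\<close>.
\<close>

lemma commutator_null_homotopic:
  fixes a b :: "real \<Rightarrow> complex"
  assumes F: "F \<subseteq> {w}"
    and a: "path a" "path_image a \<subseteq> ball w e - F" "pathstart a = y" "pathfinish a = y"
    and b: "path b" "path_image b \<subseteq> ball w e - F" "pathstart b = y" "pathfinish b = y"
  shows "homotopic_paths (ball w e - F) (loop_commutator a b) (\<lambda>_. y)"
proof -
  define c where "c = loop_commutator a b"
  have c: "path c" "path_image c \<subseteq> ball w e - F" "pathstart c = y" "pathfinish c = y"
    unfolding c_def using a b by (auto simp: path_image_join)
  have const: "linepath y y = (\<lambda>_. y)" by (auto simp: linepath_def fun_eq_iff algebra_simps)
  show ?thesis
  proof (cases "F = {}")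
    case True
    have "simply_connected (ball w e)" by (intro convex_imp_simply_connected convex_ball)
    then have nh: "\<forall>p. path p \<and> path_image p \<subseteq> ball w e \<and> pathfinish p = pathstart p \<longrightarrow>
        homotopic_paths (ball w e) p (linepath (pathstart p) (pathstart p))"
      unfolding simply_connected_eq_contractible_path by (rule conjunct2)
    have "homotopic_paths (ball w e) c (linepath (pathstart c) (pathstart c))"
      using c True by (intro nh[THEN spec[of _ c], THEN mp]) simp
    then show ?thesis using True c(3) const by (simp add: c_def)
  next
    case False
    then have F: "F = {w}" using F by blast
    have nin: "w \<notin> path_image a" "w \<notin> path_image b" using a b F by auto
    have "winding_number c w = - winding_number a w + (- winding_number b w + (winding_number a w + winding_number b w))"
      unfolding c_def using a b nin
      by (simp add: winding_number_join winding_number_reversepath path_image_join)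
    then have "winding_number c w = 0" by simp
    then have hom: "homotopic_paths (- {w}) c (\<lambda>_. y)"
      using winding_number_homotopic_paths_null_explicit_eq[of c w] c F const by auto
    have "compact (path_image c)" using c(1) by (rule compact_path_image)
    then obtain z where z: "z \<in> path_image c" "\<And>x. x \<in> path_image c \<Longrightarrow> dist w x \<le> dist w z"
      using distance_attains_sup[of "path_image c" w] path_image_nonempty[of c] by blast
    define \<rho> where "\<rho> = dist w z"
    have \<rho>: "0 < \<rho>" "\<rho> < e" using z(1) c(2) F by (auto simp: \<rho>_def)
    (* The radial retraction onto the disc of radius rho, which contains the commutator, moves
       the null-homotopy into the given disc and keeps it away from w. *)
    define r where "r = (\<lambda>x. w + (x - w) * of_real (min 1 (\<rho> / norm (x - w))))"
    have r_id: "r x = x" if "x \<in> path_image c" for x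
    proof -
      have "norm (x - w) \<le> \<rho>" "x \<noteq> w"
        using z(2)[OF that] that c(2) F by (auto simp: \<rho>_def dist_norm norm_minus_commute)
      then have "min 1 (\<rho> / norm (x - w)) = 1" by (simp add: min_def)
      then show ?thesis by (simp add: r_def)
    qed
    have r_in: "r x \<in> ball w e - F" if "x \<in> - {w}" for x
    proof -
      have x: "norm (x - w) > 0" using that by simp
      have "dist w (r x) = norm (x - w) * min 1 (\<rho> / norm (x - w))"
        using x \<rho> by (simp add: r_def dist_norm norm_mult min_def)
      also have "\<dots> \<le> \<rho>" using x \<rho> by (simp add: min_def field_simps)
      finally have "dist w (r x) < e" using \<rho> by simp
      moreover have "r x \<noteq> w" using x \<rho> by (simp add: r_def min_def)
      ultimately show ?thesis by (simp add: F)
    qed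
    have "continuous_on (- {w}) r" unfolding r_def by (intro continuous_intros) auto
    then have hom': "homotopic_paths (ball w e - F) (r \<circ> c) (r \<circ> (\<lambda>_. y))"
      using homotopic_paths_continuous_image[OF hom, of r "ball w e - F"] r_in by auto
    have "y \<in> path_image c" using c(3) by (metis pathstart_in_path_image)
    then have ry: "r \<circ> (\<lambda>_. y) = (\<lambda>_. y)" using r_id by auto
    have "homotopic_paths (ball w e - F) c (r \<circ> c)"
      by (rule homotopic_paths_eq[OF c(1,2)]) (use r_id in \<open>auto simp: path_image_def\<close>)
    from homotopic_paths_trans[OF this hom'] show ?thesis unfolding ry c_def .
  qed
qed

lemma poly_fun_0 [simp]: "poly_fun 0 x = 0"
  by (simp add: poly_fun_def eval_mvpoly_def)

lemma poly_fun_1 [simp]: "poly_fun 1 x = 1"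
  by (simp add: poly_fun_def eval_mvpoly_def)

lemma coeff_equation_at: "coeff (equation_at P x) i = poly_fun (coeff P i) x"
  by (simp add: equation_at_def coeff_map_poly)

lemma linewise_monic_equation_at:
  fixes P :: "'n::finite mvpoly poly"
  assumes "entire_algebraic_equation P"
  shows "linewise_monic (equation_at P) (degree P)"
proof -
  have lead: "lead_coeff P = 1" and irr: "Factorial_Ring.irreducible P"
    using assms by (auto simp: entire_algebraic_equation_def)
  have "degree P > 0"
  proof (rule ccontr)
    assume "\<not> degree P > 0"
    then have "degree P = 0" by simp
    then obtain c where c: "P = [:c:]" by (rule degree_eq_zeroE)
    have "c = 1" using lead unfolding c by simp
    then have "P = 1" unfolding c by (simp only: one_pCons)
    then show False using irr by simp
  qed
  moreover have deg: "degree (equation_at P x) = degree P" for x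
  proof (rule antisym)
    show "degree (equation_at P x) \<le> degree P"
      by (rule degree_le) (simp add: coeff_equation_at coeff_eq_0)
    show "degree P \<le> degree (equation_at P x)"
      by (rule le_degree) (simp add: coeff_equation_at lead)
  qed
  moreover have "lead_coeff (equation_at P x) = 1" for x
    by (simp add: deg coeff_equation_at lead)
  moreover have "linewise_polynomial (\<lambda>x. coeff (equation_at P x) i)" for i
    unfolding coeff_equation_at by (rule linewise_polynomial_poly_fun)
  ultimately show ?thesis unfolding linewise_monic_def by blast
qed

lemma derived_loop_Suc_induct:
  assumes "derived_loop S x (Suc n) \<gamma>"
    and const: "x \<in> S \<Longrightarrow> P (\<lambda>_. x)"
    and comm: "\<And>\<alpha> \<beta>. derived_loop S x n \<alpha> \<Longrightarrow> derived_loop S x n \<beta> \<Longrightarrow> P (loop_commutator \<alpha> \<beta>)"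
    and join: "\<And>\<alpha> \<beta>. P \<alpha> \<Longrightarrow> P \<beta> \<Longrightarrow> P (\<alpha> +++ \<beta>)"
  shows "P \<gamma>"
proof -
  have "m = Suc n \<longrightarrow> P \<gamma>" if "derived_loop S x m \<gamma>" for m
    using that
  proof induction
    case (const k)
    show ?case by (intro impI assms(2) const.hyps)
  next
    case (commutator k \<alpha> \<beta>)
    have "P (loop_commutator \<alpha> \<beta>)" if "k = n"
      using commutator.hyps unfolding that by (rule comm)
    then show ?case by simp
  next
    case (join k \<alpha> \<beta>)
    have "P (\<alpha> +++ \<beta>)" if "k = n"
      by (rule assms(4)) (use join.IH that in simp_all)
    then show ?case by simp
  qed simp
  then show ?thesis using assms(1) by blast
qed

lemma thin_root_locus:
  fixes R :: "complex^'n::finite \<Rightarrow> complex poly"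
  assumes R: "linewise_monic R n" and c: "\<not> (\<forall>x. poly (R x) c = 0)"
  shows "thin {x. poly (R x) c = 0}"
proof -
  obtain x where "poly (R x) c \<noteq> 0" using c by blast
  moreover have "linewise_polynomial (\<lambda>x. poly (R x) c)"
  proof -
    have "poly (R x) c = (\<Sum>i\<le>n. coeff (R x) i * c ^ i)" for x
      using linewise_monicD(2)[OF R, of x] by (simp add: poly_altdef)
    then show ?thesis
      using linewise_polynomial_sum[OF linewise_polynomial_mult[OF linewise_monicD(4)[OF R] linewise_polynomial_const]]
      by simp
  qed
  ultimately show ?thesis by (intro thin_zero_set)
qed

text \<open>
  A connected set in a union of disjoint balls is contained in one of them.
\<close>

lemma path_stays_in_ball:
  fixes h :: "real \<Rightarrow> complex"
  assumes W: "finite W" and sep: "\<And>v w y. v \<in> W \<Longrightarrow> w \<in> W \<Longrightarrow> dist y v < e \<Longrightarrow> dist y w < e \<Longrightarrow> v = w"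
    and h: "path h" and near: "\<And>y. y \<in> path_image h \<Longrightarrow> \<exists>w\<in>W. dist y w < e"
    and w: "w \<in> W" "dist (pathstart h) w < e"
  shows "path_image h \<subseteq> ball w e"
proof -
  have "connected (path_image h)" using h by (rule connected_path_image)
  moreover have "ball w e \<inter> (\<Union>v\<in>W - {w}. ball v e) \<inter> path_image h = {}"
  proof (rule equals0I)
    fix y assume "y \<in> ball w e \<inter> (\<Union>v\<in>W - {w}. ball v e) \<inter> path_image h"
    then obtain v where "v \<in> W - {w}" "dist y v < e" "dist y w < e" by (auto simp: dist_commute)
    then show False using sep[of v w y] w(1) by auto
  qed
  moreover have "path_image h \<subseteq> ball w e \<union> (\<Union>v\<in>W - {w}. ball v e)"
    using near by (fastforce simp: dist_commute)
  ultimately have "ball w e \<inter> path_image h = {} \<or> (\<Union>v\<in>W - {w}. ball v e) \<inter> path_image h = {}"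
    by (intro connectedD) auto
  moreover have "pathstart h \<in> ball w e \<inter> path_image h"
    using w(2) pathstart_in_path_image[of h] by (simp add: dist_commute)
  ultimately show ?thesis using \<open>path_image h \<subseteq> ball w e \<union> (\<Union>v\<in>W - {w}. ball v e)\<close> by blast
qed

text \<open>
  A disc with at most one branch point has abelian fundamental group, so the monodromy of \<open>q\<close> in it
  is trivial on commutators.
\<close>

lemma transports_commutator_in_disc:
  fixes q :: "complex \<Rightarrow> complex poly"
  assumes q: "monic_family q m" and disc: "ball w e \<inter> branch_locus q \<subseteq> {w}"
    and a: "path a" "path_image a \<subseteq> ball w e - branch_locus q" "pathstart a = y" "pathfinish a = y"
    and b: "path b" "path_image b \<subseteq> ball w e - branch_locus q" "pathstart b = y" "pathfinish b = y"
    and z: "poly (q y) z = 0"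
  shows "transports q (loop_commutator a b) z z"
proof -
  define F where "F = branch_locus q \<inter> {w}"
  have sub: "ball w e - F \<subseteq> - branch_locus q" using disc by (auto simp: F_def)
  have "homotopic_paths (ball w e - F) (loop_commutator a b) (\<lambda>_. y)"
    using a b by (intro commutator_null_homotopic) (auto simp: F_def)
  then have hom: "homotopic_paths (- branch_locus q) (loop_commutator a b) (\<lambda>_. y)"
    using sub by (rule homotopic_paths_subset)
  have "\<exists>z'. transports q (loop_commutator a b) z z'"
    using homotopic_paths_imp_path[OF hom] homotopic_paths_imp_subset[OF hom] a z
    by (intro transports_exists[OF q]) auto
  then obtain z' where z': "transports q (loop_commutator a b) z z'" by blast
  have "transports q (\<lambda>_. y) z z" by (intro transports_const z)
  then have "z' = z" by (rule transports_homotopic[OF q hom z'])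
  then show ?thesis using z' by simp
qed

text \<open>
  The heart of the induction. Near \<open>p\<close> the values of all branches are close to the finitely many
  roots of \<open>R p\<close>, and discs around these roots can be chosen to contain no branch points of \<open>q\<close>,
  except possibly their centres. Loops that act trivially on the branches in \<open>A\<close> are carried by each
  branch to loops in one of these discs. The commutators of these are null-homotopic away from the
  branch points of \<open>q\<close>, so the commutators of the original loops act trivially on the branches of
  \<open>\<psi> \<circ> f\<close>: the depth increases by one.
  
  For this the loops have to avoid the points at which a branch takes a value in the branch locus of
  \<open>q\<close>. These points form a thin set unless the branch is constant. If \<open>f\<close> is constant, so is
  \<open>\<psi> \<circ> f\<close>; otherwise the constant branches can be removed from \<open>A\<close>.
\<close>

lemma tame_composition:
  fixes q :: "complex \<Rightarrow> complex poly" and f :: "complex^'n::finite \<Rightarrow> complex"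
  assumes q: "monic_family q m" and q_poly: "\<And>i. \<exists>p. \<forall>w. coeff (q w) i = poly p w"
    and T: "tame_branches R Z A" and br: "local_branch R Z A a (germ_at a f)"
    and \<psi>: "open N" "f a \<in> N" "continuous_on N \<psi>" "\<And>w. w \<in> N \<Longrightarrow> poly (q w) (\<psi> w) = 0"
  shows "tame (generated_multifun a (germ_at a (\<lambda>x. \<psi> (f x))))"
proof -
  obtain U where U: "open U" "a \<in> U" "continuous_on U f"
    "\<forall>b\<in>U. poly (R b) (f b) = 0" "\<forall>b\<in>U. b \<notin> Z \<longrightarrow> (b, f b) \<in> A"
    by (rule local_branch_germ_eq[OF br]) blast
  have "open (U \<inter> f -` N)" using U \<psi>(1) by (intro continuous_open_preimage) auto
  then obtain r where r: "r > 0" "ball a r \<subseteq> U \<inter> f -` N"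
    using U(2) \<psi>(2) open_contains_ball[of "U \<inter> f -` N"] by blast
  have B: "b \<in> U" "f b \<in> N" if "b \<in> ball a r" for b using r(2) that by auto
  have contf: "continuous_on (ball a r) f" using U(3) by (rule continuous_on_subset) (use r in auto)
  show ?thesis
  proof (cases "\<forall>x\<in>ball a r. f x = f a")
    case True
    have "\<forall>\<^sub>F x in nhds a. x \<in> ball a r" using r(1) by (intro eventually_nhds_in_open) auto
    then have "\<forall>\<^sub>F x in nhds a. \<psi> (f x) = \<psi> (f a)"
      by (rule eventually_mono) (use True in simp)
    then have "germ_at a (\<lambda>x. \<psi> (f x)) = germ_at a (\<lambda>_. \<psi> (f a))" by (simp add: germ_at_eq_iff)
    then show ?thesis using tame_coefficient[OF linewise_polynomial_const[of "\<psi> (f a)"], of a] by simp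
  next
    case False
    obtain n where R: "linewise_monic R n" using tame_branchesD(1)[OF T] by blast
    note R' = linewise_monic_imp_monic_family[OF R]
    note ZT = tame_branchesD(2)[OF T] and LZ = tame_branchesD(3)[OF T]
    note AZ = tame_branchesD(4)[OF T] and Aroot = tame_branchesD(5)[OF T] and Acl = tame_branchesD(6)[OF T]
    (* The possible values of constant branches. *)
    define C where "C = {c. \<forall>x. poly (R x) c = 0}"
    define \<Lambda> where "\<Lambda> = branch_locus q"
    have fin: "finite \<Lambda>" unfolding \<Lambda>_def by (rule finite_branch_locus[OF q q_poly])
    define D where "D = {(x :: complex^'n, y, z). poly (R x) y = 0 \<and> poly (q y) z = 0}"
    have "integral_over D fst (\<lambda>\<tau>. fst (snd \<tau>))"
      unfolding integral_over_def using R by (auto simp: D_def)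
    then have "integral_over D fst (\<lambda>\<tau>. snd (snd \<tau>))"
      by (rule integral_over_root[OF _ monic_familyD(1,2,3)[OF q] q_poly]) (auto simp: D_def)
    then obtain S k where S: "linewise_monic S k" and "\<forall>\<tau>\<in>D. poly (S (fst \<tau>)) (snd (snd \<tau>)) = 0"
      unfolding integral_over_def by blast
    then have root: "poly (S x) z = 0" if "poly (R x) y = 0" "poly (q y) z = 0" for x y z
      using that by (auto simp: D_def)
    note S' = linewise_monic_imp_monic_family[OF S]
    (* Off Y, no branch that is not constant takes a value in the branch locus of q. *)
    define Y where "Y = Z \<union> branch_locus S \<union> (\<Union>c\<in>\<Lambda> - C. {x. poly (R x) c = 0})"
    define A' where "A' = {(x, z). x \<notin> Y \<and> (\<exists>y. (x, y) \<in> A \<and> y \<notin> C \<and> poly (q y) z = 0)}"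
    have A'I: "(x, z) \<in> A'" if "x \<notin> Y" "(x, y) \<in> A" "y \<notin> C" "poly (q y) z = 0" for x y z
      using that by (auto simp: A'_def)
    have ZY: "Z \<subseteq> Y" and SY: "branch_locus S \<subseteq> Y" by (auto simp: Y_def)
    have avoid: "y \<notin> \<Lambda>" if "x \<notin> Y" "poly (R x) y = 0" "y \<notin> C" for x y
      using that by (auto simp: Y_def)
    (* By uniqueness of transport a branch that takes a value in C off Y is constant. *)
    have nonconst: "h t \<notin> C"
      if h: "path h" "\<And>t. t \<in> {0..1} \<Longrightarrow> poly (R (\<gamma> t)) (h t) = 0"
        and \<gamma>: "path \<gamma>" "path_image \<gamma> \<subseteq> - Y" and start: "pathstart h \<notin> C" and t: "t \<in> {0..1}" for h \<gamma> t
    proof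
      assume "h t \<in> C"
      then have "transports R (subpath t 0 \<gamma>) (h t) (h t)"
        by (intro transports_const) (auto simp: C_def)
      moreover have "transports R (subpath t 0 \<gamma>) (h t) (h 0)"
        using h t by (intro transports_subpath) auto
      moreover have "path (subpath t 0 \<gamma>)" using \<gamma>(1) t by (intro path_subpath) auto
      moreover have "path_image (subpath t 0 \<gamma>) \<subseteq> - branch_locus R"
        using path_image_subpath_subset[of t 0 \<gamma>] t \<gamma>(2) LZ ZY by auto
      ultimately have "h t = h 0" using transports_unique[OF R'] by blast
      then show False using start \<open>h t \<in> C\<close> by (simp add: pathstart_def)
    qed
    have lift: "path h \<longrightarrow> path_image h \<subseteq> - \<Lambda> \<and> (pathfinish \<gamma>, pathfinish h) \<in> A \<and> pathfinish h \<notin> C"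
      if h: "\<And>t. t \<in> {0..1} \<Longrightarrow> poly (R (\<gamma> t)) (h t) = 0"
        and \<gamma>: "path \<gamma>" "path_image \<gamma> \<subseteq> - Y" and start: "pathstart h \<notin> C" "(pathstart \<gamma>, pathstart h) \<in> A" for h \<gamma>
    proof (intro impI conjI)
      assume "path h"
      have nc: "h t \<notin> C" if "t \<in> {0..1}" for t
        by (rule nonconst[OF \<open>path h\<close> _ \<gamma> start(1) that]) (rule h)
      show "path_image h \<subseteq> - \<Lambda>"
      proof
        fix y assume "y \<in> path_image h"
        then obtain t where t: "t \<in> {0..1}" "y = h t" by (auto simp: path_image_def)
        have "\<gamma> t \<notin> Y" using t(1) \<gamma>(2) unfolding path_image_def by blast
        then show "y \<in> - \<Lambda>" using avoid h[OF t(1)] nc[OF t(1)] t(2) by blast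
      qed
      have "transports R \<gamma> (pathstart h) (pathfinish h)" using \<open>path h\<close> h by (rule transportsI)
      then show "(pathfinish \<gamma>, pathfinish h) \<in> A"
        using Acl \<gamma> start(2) ZY unfolding transport_closed_def by blast
      show "pathfinish h \<notin> C" using nc[of 1] by (simp add: pathfinish_def)
    qed
    show ?thesis
    proof (rule tame_generated_multifun)
      show "tame_branches S Y A'"
        unfolding tame_branches_def
      proof (intro conjI allI impI)
        show "\<exists>k. linewise_monic S k" using S by blast
        have "thin {x. poly (R x) c = 0}" if "c \<in> \<Lambda> - C" for c
          using that by (intro thin_root_locus[OF R]) (auto simp: C_def)
        then show "thin Y" unfolding Y_def
          using ZT thin_branch_locus[OF S] fin by (intro thin_Un thin_UN) auto
        show "branch_locus S \<subseteq> Y" by (rule SY)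
        fix x z assume "(x, z) \<in> A'"
        then obtain y where y: "x \<notin> Y" "(x, y) \<in> A" "poly (q y) z = 0" by (auto simp: A'_def)
        show "x \<notin> Y" by fact
        show "poly (S x) z = 0" by (rule root[OF Aroot[OF y(2)] y(3)])
      next
        show "transport_closed S Y A'"
          unfolding transport_closed_def
        proof (intro allI impI)
          fix \<gamma> z z' assume \<gamma>: "path \<gamma>" "path_image \<gamma> \<subseteq> - Y" and z: "(pathstart \<gamma>, z) \<in> A'" and tr: "transports S \<gamma> z z'"
          obtain y where y: "(pathstart \<gamma>, y) \<in> A" "y \<notin> C" "poly (q y) z = 0" using z by (auto simp: A'_def)
          have "\<exists>y'. transports R \<gamma> y y'"
            using \<gamma> LZ ZY Aroot[OF y(1)] by (intro transports_exists[OF R']) auto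
          then obtain h where h: "path h" "pathstart h = y" "\<And>t. t \<in> {0..1} \<Longrightarrow> poly (R (\<gamma> t)) (h t) = 0"
            unfolding transports_def by blast
          have hl: "path_image h \<subseteq> - \<Lambda>" "(pathfinish \<gamma>, pathfinish h) \<in> A" "pathfinish h \<notin> C"
            using lift[OF h(3) \<gamma>] h y by auto
          have "\<exists>z'. transports q h z z'"
            using h hl(1) y(3) by (intro transports_exists[OF q]) (auto simp: \<Lambda>_def)
          then obtain k where k: "path k" "pathstart k = z" "\<And>t. t \<in> {0..1} \<Longrightarrow> poly (q (h t)) (k t) = 0"
            unfolding transports_def by blast
          have "transports S \<gamma> (pathstart k) (pathfinish k)"
            using k(1) root[OF h(3) k(3)] by (rule transportsI)
          then have "z' = pathfinish k"
            using transports_unique[OF S' \<gamma>(1) _ tr] \<gamma>(2) SY k(2) by auto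
          moreover have "poly (q (pathfinish h)) (pathfinish k) = 0" using k(3)[of 1] by (simp add: pathfinish_def)
          moreover have "pathfinish \<gamma> \<notin> Y" using \<gamma>(2) pathfinish_in_path_image by blast
          ultimately show "(pathfinish \<gamma>, z') \<in> A'" using hl by (intro A'I) auto
        qed
      next
        fix p
        obtain e0 d where e0: "e0 > 0" and fixA: "\<forall>x y \<gamma>. (x, y) \<in> A \<longrightarrow> derived_loop (ball p e0 - Z) x d \<gamma> \<longrightarrow> transports R \<gamma> y y"
          using tame_branchesD(7)[OF T, of p] unfolding loops_trivial_near_def by blast
        define W where "W = roots (R p)"
        have W: "finite W" unfolding W_def by (rule monic_family_finite_roots[OF R'])
        (* Separating the roots of R p from the branch points of q as well leaves at most the centre
           of each disc as a branch point. *)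
        obtain e where e: "e > 0"
          and sep: "\<forall>v\<in>W \<union> \<Lambda>. \<forall>w\<in>W \<union> \<Lambda>. \<forall>y. dist y v < e \<longrightarrow> dist y w < e \<longrightarrow> v = w"
          using disjoint_balls_around_points[of "W \<union> \<Lambda>"] W fin by blast
        have "\<forall>\<^sub>F x in nhds p. \<forall>y. poly (R x) y = 0 \<longrightarrow> (\<exists>w. poly (R p) w = 0 \<and> dist y w < e)"
          by (rule all_roots_near[OF R' e])
        then obtain \<delta> where \<delta>: "\<delta> > 0" "\<forall>x. dist x p < \<delta> \<longrightarrow> (\<forall>y. poly (R x) y = 0 \<longrightarrow> (\<exists>w. poly (R p) w = 0 \<and> dist y w < e))"
          unfolding eventually_nhds_metric by blast
        define \<epsilon> where "\<epsilon> = min e0 \<delta>"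
        define X where "X = ball p \<epsilon> - Y"
        have X0: "X \<subseteq> ball p e0 - Z" using ZY by (auto simp: X_def \<epsilon>_def)
        have near: "\<exists>w\<in>W. dist y w < e" if "x \<in> X" "poly (R x) y = 0" for x y
        proof -
          have "dist x p < \<delta>" using that(1) by (simp add: X_def \<epsilon>_def dist_commute)
          then show ?thesis using \<delta>(2) that(2) unfolding W_def by blast
        qed
        have closed_lift: "\<exists>h. path h \<and> pathstart h = y \<and> pathfinish h = y \<and>
            (\<forall>t\<in>{0..1}. poly (R (\<gamma> t)) (h t) = 0) \<and> path_image h \<subseteq> ball w e - \<Lambda>"
          if \<gamma>: "derived_loop X x d \<gamma>" and y: "(x, y) \<in> A" "y \<notin> C" and w: "w \<in> W" "dist y w < e" for \<gamma> x y w
        proof -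
          have "derived_loop (ball p e0 - Z) x d \<gamma>" using \<gamma> X0 by (rule derived_loop_mono)
          then have "transports R \<gamma> y y" using fixA y(1) by blast
          then obtain h where h: "path h" "pathstart h = y" "pathfinish h = y" "\<And>t. t \<in> {0..1} \<Longrightarrow> poly (R (\<gamma> t)) (h t) = 0"
            unfolding transports_def by blast
          have loop: "path \<gamma>" "path_image \<gamma> \<subseteq> X" "pathstart \<gamma> = x" "pathfinish \<gamma> = x"
            using derived_loop_imp_loop[OF \<gamma>] by auto
          have "path_image \<gamma> \<subseteq> - Y" using loop(2) by (auto simp: X_def)
          then have "path_image h \<subseteq> - \<Lambda>" using lift[OF h(4) loop(1)] h(1,2) loop(3) y by auto
          moreover have "path_image h \<subseteq> ball w e"
          proof (rule path_stays_in_ball[OF W _ h(1) _ w(1)])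
            show "v = u" if "v \<in> W" "u \<in> W" "dist y v < e" "dist y u < e" for v u y
              using sep that by blast
            show "\<exists>w\<in>W. dist u w < e" if u: "u \<in> path_image h" for u
            proof -
              obtain t where t: "t \<in> {0..1}" "u = h t" using u unfolding path_image_def by blast
              have "\<gamma> t \<in> X" using loop(2) t(1) unfolding path_image_def by blast
              then show ?thesis using near h(4)[OF t(1)] t(2) by blast
            qed
            show "dist (pathstart h) w < e" using h(2) w(2) by simp
          qed
          ultimately show ?thesis using h by (intro exI[of _ h]) auto
        qed
        have "transports S \<gamma> z z" if \<gamma>: "derived_loop X x (Suc d) \<gamma>" and z: "(x, z) \<in> A'" for \<gamma> x z
          using \<gamma>
        proof (rule derived_loop_Suc_induct)
          obtain y where y: "x \<notin> Y" "(x, y) \<in> A" "y \<notin> C" "poly (q y) z = 0" using z by (auto simp: A'_def)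
          have Sz: "poly (S x) z = 0" by (rule root[OF Aroot[OF y(2)] y(4)])
          show "transports S (\<lambda>_. x) z z" by (intro transports_const Sz)
          show "transports S (\<alpha> +++ \<beta>) z z" if "transports S \<alpha> z z" "transports S \<beta> z z" for \<alpha> \<beta>
            using that by (rule transports_join)
          fix \<alpha> \<beta> assume \<alpha>: "derived_loop X x d \<alpha>" and \<beta>: "derived_loop X x d \<beta>"
          have "x \<in> X" using derived_loop_imp_loop[OF \<alpha>] pathstart_in_path_image[of \<alpha>] by auto
          then obtain w where w: "w \<in> W" "dist y w < e" using near Aroot[OF y(2)] by blast
          obtain a where a: "path a" "pathstart a = y" "pathfinish a = y"
            "\<And>t. t \<in> {0..1} \<Longrightarrow> poly (R (\<alpha> t)) (a t) = 0" "path_image a \<subseteq> ball w e - \<Lambda>"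
            using closed_lift[OF \<alpha> y(2,3) w] by blast
          obtain b where b: "path b" "pathstart b = y" "pathfinish b = y"
            "\<And>t. t \<in> {0..1} \<Longrightarrow> poly (R (\<beta> t)) (b t) = 0" "path_image b \<subseteq> ball w e - \<Lambda>"
            using closed_lift[OF \<beta> y(2,3) w] by blast
          have "ball w e \<inter> branch_locus q \<subseteq> {w}"
          proof
            fix u assume u: "u \<in> ball w e \<inter> branch_locus q"
            then have "dist u w < e" "u \<in> \<Lambda>" by (simp_all add: \<Lambda>_def dist_commute)
            then have "u = w" using sep w(1) e by (metis UnI1 UnI2 dist_self)
            then show "u \<in> {w}" by simp
          qed
          then have "transports q (loop_commutator a b) z z"
            using a b y(4) by (intro transports_commutator_in_disc[OF q]) (auto simp: \<Lambda>_def)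
          then obtain k where k: "path k" "pathstart k = z" "pathfinish k = z"
            "\<And>t. t \<in> {0..1} \<Longrightarrow> poly (q (loop_commutator a b t)) (k t) = 0"
            unfolding transports_def by blast
          have cl: "poly (R ((loop_commutator \<alpha> \<beta>) t)) (loop_commutator a b t) = 0" if "t \<in> {0..1}" for t
            using a b that by (intro lift_join lift_reversepath) auto
          have "transports S (loop_commutator \<alpha> \<beta>) (pathstart k) (pathfinish k)"
            using k(1) root[OF cl k(4)] by (rule transportsI)
          then show "transports S (loop_commutator \<alpha> \<beta>) z z" using k by simp
        qed
        moreover have "\<epsilon> > 0" using e0 \<delta>(1) by (simp add: \<epsilon>_def)
        ultimately show "loops_trivial_near S Y A' p"
          unfolding X_def by (intro loops_trivial_nearI[of \<epsilon> _ _ _ "Suc d"])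
      qed
      (* If f took a value in C at a point off Y, then f would be constant on the ball. *)
      have fC: "f b \<notin> C" if b: "b \<in> ball a r" "b \<notin> Y" for b
      proof
        assume fbC: "f b \<in> C"
        have on_Z: "f x = f b" if x: "x \<in> ball a r" "x \<notin> Z" for x
        proof -
          have "b \<in> ball a r - Z" "x \<in> ball a r - Z" using b x ZY by auto
          then obtain \<gamma> where \<gamma>: "path \<gamma>" "path_image \<gamma> \<subseteq> ball a r - Z" "pathstart \<gamma> = b" "pathfinish \<gamma> = x"
            using path_connected_ball_minus_thin[OF ZT, of a r] unfolding path_connected_def by blast
          have "path_image \<gamma> \<subseteq> ball a r" using \<gamma>(2) by blast
          then have "transports R \<gamma> (f (pathstart \<gamma>)) (f (pathfinish \<gamma>))"
            using \<gamma>(1) U(4) B(1) continuous_on_subset[OF contf] by (intro transports_section) auto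
          moreover have "transports R \<gamma> (f b) (f b)" by (rule transports_const) (use fbC in \<open>simp add: C_def\<close>)
          moreover have "path_image \<gamma> \<subseteq> - branch_locus R" using \<gamma>(2) LZ by blast
          ultimately show ?thesis using transports_unique[OF R' \<gamma>(1)] \<gamma>(3,4) by metis
        qed
        have "f x = f b" if x: "x \<in> ball a r" for x
        proof (rule ccontr)
          assume ne: "f x \<noteq> f b"
          have "open (ball a r \<inter> f -` (- {f b}))" by (rule continuous_open_preimage[OF contf]) auto
          moreover have "x \<in> ball a r \<inter> f -` (- {f b})" using x ne by simp
          ultimately obtain u where "u \<in> ball a r \<inter> f -` (- {f b})" "u \<notin> Z" by (rule thin_dense[OF ZT])
          then show False using on_Z by auto
        qed
        moreover have "a \<in> ball a r" using r(1) by simp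
        ultimately show False using False by metis
      qed
      show "local_branch S Y A' a (germ_at a (\<lambda>x. \<psi> (f x)))"
        unfolding local_branch_def
      proof (rule exI[of _ "\<lambda>x. \<psi> (f x)"], rule exI[of _ "ball a r"], intro conjI ballI)
        show "open (ball a r)" "a \<in> ball a r" using r(1) by auto
        show "continuous_on (ball a r) (\<lambda>x. \<psi> (f x))"
          by (rule continuous_on_compose2[OF \<psi>(3) contf]) (use B in auto)
        show "poly (S b) (\<psi> (f b)) = 0" if "b \<in> ball a r" for b
          using root[of b "f b"] U(4) B[OF that] \<psi>(4) by blast
        show "(b, \<psi> (f b)) \<in> A'" if b: "b \<in> ball a r - Y" for b
        proof (rule A'I)
          show "b \<notin> Y" using b by simp
          show "(b, f b) \<in> A" using U(5) B(1) b ZY by auto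
          show "f b \<notin> C" using fC b by simp
          show "poly (q (f b)) (\<psi> (f b)) = 0" using \<psi>(4) B(2) b by simp
        qed
      qed simp
    qed
  qed
qed

text \<open>
  Functions of one variable live on \<open>complex^1\<close>; the equation is pulled back to \<open>\<complex>\<close>.
\<close>

lemma tame_algebraic:
  fixes F :: "('n::finite) multifun"
  assumes Q: "entire_algebraic_equation (Q :: 1 mvpoly poly)" and F: "tame F"
    and f: "(a, germ_at a f) \<in> F" and \<phi>: "((\<chi> _. f a), germ_at (\<chi> _. f a) \<phi>) \<in> algebraic_multifun Q"
  shows "tame (generated_multifun a (germ_at a (\<lambda>x. \<phi> (\<chi> _. f x))))"
proof -
  obtain R Z A where T: "tame_branches R Z A" and br: "local_branch R Z A a (germ_at a f)"
    using F f unfolding tame_def by blast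
  define pt :: "complex \<Rightarrow> complex^1" where "pt = (\<lambda>w. \<chi> _. w)"
  have pt_line: "pt w = 0 + w *s pt 1" for w
    by (simp add: pt_def Finite_Cartesian_Product.vec_eq_iff)
  have pt_cont: "continuous_on X pt" for X unfolding pt_def by (intro continuous_intros)
  note lm = linewise_monic_equation_at[OF Q]
  define q where "q = (\<lambda>w. equation_at Q (pt w))"
  have q_poly: "\<exists>p. \<forall>w. coeff (q w) i = poly p w" for i
    using linewise_monicD(4)[OF lm, of i] unfolding linewise_polynomial_def q_def by (subst pt_line) blast
  have q: "monic_family q (degree Q)"
    unfolding monic_family_def
  proof (intro conjI allI)
    show "degree Q > 0" "degree (q w) = degree Q" "lead_coeff (q w) = 1" for w
      using linewise_monicD(1,2,3)[OF lm] by (auto simp: q_def)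
    show "continuous_on UNIV (\<lambda>w. coeff (q w) i)" for i
    proof -
      obtain p where "\<forall>w. coeff (q w) i = poly p w" using q_poly by blast
      moreover have "continuous_on UNIV (\<lambda>w. poly p w)" by (intro continuous_intros)
      ultimately show ?thesis by simp
    qed
  qed
  obtain g V where V: "holomorphic_several_on g V" "pt (f a) \<in> V" "germ_at (pt (f a)) \<phi> = germ_at (pt (f a)) g"
    "\<forall>z\<in>V. poly (equation_at Q z) (g z) = 0"
    using \<phi> unfolding algebraic_multifun_def solution_germs_def pt_def by blast
  obtain X where X: "open X" "pt (f a) \<in> X" "\<And>y. y \<in> X \<Longrightarrow> \<phi> y = g y"
    using V(3) unfolding germ_at_eq_iff eventually_nhds by blast
  define M where "M = X \<inter> V"
  have "open M" using X(1) V(1) by (auto simp: M_def holomorphic_several_on_def)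
  have "continuous_on M g" using holomorphic_several_on_imp_continuous_on[OF V(1)]
    by (rule continuous_on_subset) (auto simp: M_def)
  then have cont: "continuous_on M \<phi>" by (rule continuous_on_eq) (auto simp: M_def X)
  define N where "N = pt -` M"
  have "tame (generated_multifun a (germ_at a (\<lambda>x. (\<lambda>w. \<phi> (pt w)) (f x))))"
  proof (rule tame_composition[OF q q_poly T br, of N "\<lambda>w. \<phi> (pt w)"])
    show "open N" unfolding N_def using \<open>open M\<close> pt_cont by (intro open_vimage) auto
    show "f a \<in> N" using X V by (simp add: N_def M_def)
    show "continuous_on N (\<lambda>w. \<phi> (pt w))"
      by (rule continuous_on_compose2[OF cont pt_cont]) (auto simp: N_def)
    show "poly (q w) (\<phi> (pt w)) = 0" if "w \<in> N" for w
      using that V(4) X(3) by (auto simp: N_def M_def q_def)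
  qed
  then show ?thesis by (simp add: pt_def)
qed

theorem compositions_tame:
  assumes "F \<in> compositions" shows "tame F"
  using assms
proof induction
  case (base a p)
  show ?case by (rule tame_coefficient[OF linewise_polynomial_poly_fun])
next
  case (polynomial q k F a f)
  show ?case by (rule tame_polynomial[OF polynomial.hyps(1)]) (use polynomial in blast)+
next
  case (algebraic Q F a f \<phi>)
  show ?case by (rule tame_algebraic[OF algebraic.hyps(1) algebraic.IH algebraic.hyps(3,4)])
qed

section \<open>Continuation along joined and reversed paths\<close>

lemma continuation_familyI:
  assumes "path \<gamma>"
    and "\<And>t. t \<in> {0..1} \<Longrightarrow> \<exists>U f e. holomorphic_several_on f U \<and> \<gamma> t \<in> U \<and> e > 0 \<and>
      (\<forall>s\<in>{0..1}. \<bar>s - t\<bar> < e \<longrightarrow> \<gamma> s \<in> U \<and> G s = germ_at (\<gamma> s) f)"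
  shows "continuation_family \<gamma> G"
  unfolding continuation_family_def
proof (intro conjI ballI)
  fix t :: real assume "t \<in> {0..1}"
  from assms(2)[OF this] obtain U f e where "holomorphic_several_on f U \<and> \<gamma> t \<in> U \<and> e > 0 \<and>
      (\<forall>s\<in>{0..1}. \<bar>s - t\<bar> < e \<longrightarrow> \<gamma> s \<in> U \<and> G s = germ_at (\<gamma> s) f)"
    by (elim exE)
  then show "\<exists>U f. holomorphic_several_on f U \<and> \<gamma> t \<in> U \<and>
      (\<exists>e>0. \<forall>s\<in>{0..1}. \<bar>s - t\<bar> < e \<longrightarrow> \<gamma> s \<in> U \<and> G s = germ_at (\<gamma> s) f)"
    by (intro exI[of _ U] exI[of _ f] exI[of _ e] conjI) simp_all
qed (rule assms(1))

lemma continuation_family_const: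
  assumes "holomorphic_several_on f U" "x \<in> U"
  shows "continuation_family (\<lambda>_. x) (\<lambda>_. germ_at x f)"
proof (rule continuation_familyI)
  show "path (\<lambda>_::real. x)" by (simp add: path_def)
  fix t :: real
  show "\<exists>U f' e. holomorphic_several_on f' U \<and> x \<in> U \<and> e > 0 \<and>
      (\<forall>s\<in>{0..1}. \<bar>s - t\<bar> < e \<longrightarrow> x \<in> U \<and> germ_at x f = germ_at x f')"
    by (rule exI[of _ U], rule exI[of _ f], rule exI[of _ 1]) (use assms in simp)
qed

lemma continuation_family_reversepath:
  assumes G: "continuation_family \<gamma> G"
  shows "continuation_family (reversepath \<gamma>) (\<lambda>t. G (1 - t))"
proof (rule continuation_familyI)
  show "path (reversepath \<gamma>)" using G by (simp add: continuation_family_def)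
  fix t :: real assume "t \<in> {0..1}"
  then have "1 - t \<in> {0..1}" by simp
  then obtain f r e where f: "r > 0" "e > 0" "holomorphic_several_on f (ball (\<gamma> (1 - t)) r)"
    and near: "\<forall>s\<in>{0..1}. \<bar>s - (1 - t)\<bar> < e \<longrightarrow> \<gamma> s \<in> ball (\<gamma> (1 - t)) r \<and> G s = germ_at (\<gamma> s) f"
    using continuation_family_local[OF G] by blast
  have "reversepath \<gamma> s \<in> ball (\<gamma> (1 - t)) r \<and> G (1 - s) = germ_at (reversepath \<gamma> s) f"
    if "s \<in> {0..1}" "\<bar>s - t\<bar> < e" for s
    using near[THEN bspec, of "1 - s"] that by (simp add: reversepath_def abs_minus_commute)
  then show "\<exists>U f e. holomorphic_several_on f U \<and> reversepath \<gamma> t \<in> U \<and> e > 0 \<and>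
      (\<forall>s\<in>{0..1}. \<bar>s - t\<bar> < e \<longrightarrow> reversepath \<gamma> s \<in> U \<and> G (1 - s) = germ_at (reversepath \<gamma> s) f)"
    using f by (intro exI[of _ "ball (\<gamma> (1 - t)) r"] exI[of _ f] exI[of _ e]) (simp add: reversepath_def)
qed

lemma germ_at_cong_open:
  assumes "open T" "\<And>y. y \<in> T \<Longrightarrow> f y = g y" "x \<in> T"
  shows "germ_at x f = germ_at x g"
  unfolding germ_at_eq_iff eventually_nhds using assms by blast

text \<open>
  At the common point the representatives of the two families have the same germ, so one of them
  represents both families nearby.
\<close>

lemma continuation_family_join:
  assumes G1: "continuation_family \<gamma>1 G1" and G2: "continuation_family \<gamma>2 G2"
    and end_pt: "pathfinish \<gamma>1 = pathstart \<gamma>2" and end_germ: "G1 1 = G2 0"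
  shows "continuation_family (\<gamma>1 +++ \<gamma>2) (\<lambda>t. if t \<le> 1/2 then G1 (2 * t) else G2 (2 * t - 1))"
    (is "continuation_family ?\<gamma> ?G")
proof (rule continuation_familyI)
  show path: "path ?\<gamma>" using G1 G2 end_pt by (simp add: continuation_family_def)
  fix t :: real assume t: "t \<in> {0..1}"
  consider "t < 1/2" | "t > 1/2" | "t = 1/2" by linarith
  then show "\<exists>U f e. holomorphic_several_on f U \<and> ?\<gamma> t \<in> U \<and> e > 0 \<and>
      (\<forall>s\<in>{0..1}. \<bar>s - t\<bar> < e \<longrightarrow> ?\<gamma> s \<in> U \<and> ?G s = germ_at (?\<gamma> s) f)"
  proof cases
    case 1
    then have "2 * t \<in> {0..1}" using t by simp
    then obtain f r e where f: "r > 0" "e > 0" "holomorphic_several_on f (ball (\<gamma>1 (2 * t)) r)"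
      and near: "\<forall>s\<in>{0..1}. \<bar>s - 2 * t\<bar> < e \<longrightarrow> \<gamma>1 s \<in> ball (\<gamma>1 (2 * t)) r \<and> G1 s = germ_at (\<gamma>1 s) f"
      using continuation_family_local[OF G1] by blast
    have "?\<gamma> s \<in> ball (\<gamma>1 (2 * t)) r \<and> ?G s = germ_at (?\<gamma> s) f"
      if s: "s \<in> {0..1}" "\<bar>s - t\<bar> < min (e / 2) (1/2 - t)" for s
    proof -
      have d: "\<bar>s - t\<bar> < e / 2" "\<bar>s - t\<bar> < 1/2 - t" using s(2) by simp_all
      have "s \<le> 1/2" using d(2) by linarith
      moreover have "2 * s \<in> {0..1}" using s(1) \<open>s \<le> 1/2\<close> by simp
      moreover have "\<bar>2 * s - 2 * t\<bar> < e" using d(1) by linarith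
      ultimately show ?thesis using near by (simp add: joinpaths_def)
    qed
    then show ?thesis using f 1
      by (intro exI[of _ "ball (\<gamma>1 (2 * t)) r"] exI[of _ f] exI[of _ "min (e / 2) (1/2 - t)"])
        (simp add: joinpaths_def)
  next
    case 2
    then have "2 * t - 1 \<in> {0..1}" using t by simp
    then obtain f r e where f: "r > 0" "e > 0" "holomorphic_several_on f (ball (\<gamma>2 (2 * t - 1)) r)"
      and near: "\<forall>s\<in>{0..1}. \<bar>s - (2 * t - 1)\<bar> < e \<longrightarrow> \<gamma>2 s \<in> ball (\<gamma>2 (2 * t - 1)) r \<and> G2 s = germ_at (\<gamma>2 s) f"
      using continuation_family_local[OF G2] by blast
    have "?\<gamma> s \<in> ball (\<gamma>2 (2 * t - 1)) r \<and> ?G s = germ_at (?\<gamma> s) f"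
      if s: "s \<in> {0..1}" "\<bar>s - t\<bar> < min (e / 2) (t - 1/2)" for s
    proof -
      have d: "\<bar>s - t\<bar> < e / 2" "\<bar>s - t\<bar> < t - 1/2" using s(2) by simp_all
      have "\<not> s \<le> 1/2" using d(2) by linarith
      moreover have "2 * s - 1 \<in> {0..1}" using s(1) \<open>\<not> s \<le> 1/2\<close> by simp
      moreover have "\<bar>2 * s - 1 - (2 * t - 1)\<bar> < e" using d(1) by linarith
      ultimately show ?thesis using near by (simp add: joinpaths_def)
    qed
    then show ?thesis using f 2
      by (intro exI[of _ "ball (\<gamma>2 (2 * t - 1)) r"] exI[of _ f] exI[of _ "min (e / 2) (t - 1/2)"])
        (simp add: joinpaths_def)
  next
    case 3
    define x where "x = \<gamma>1 1"
    have x2: "\<gamma>2 0 = x" using end_pt by (simp add: x_def pathstart_def pathfinish_def)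
    obtain f1 r1 e1 where f1: "r1 > 0" "e1 > 0" "holomorphic_several_on f1 (ball x r1)"
      and near1: "\<forall>s\<in>{0..1}. \<bar>s - 1\<bar> < e1 \<longrightarrow> \<gamma>1 s \<in> ball x r1 \<and> G1 s = germ_at (\<gamma>1 s) f1"
      using continuation_family_local[OF G1, of 1] unfolding x_def by auto
    obtain f2 r2 e2 where f2: "r2 > 0" "e2 > 0" "holomorphic_several_on f2 (ball x r2)"
      and near2: "\<forall>s\<in>{0..1}. \<bar>s - 0\<bar> < e2 \<longrightarrow> \<gamma>2 s \<in> ball x r2 \<and> G2 s = germ_at (\<gamma>2 s) f2"
      using continuation_family_local[OF G2, of 0] unfolding x2 by auto
    have "G1 1 = germ_at x f1" "G2 0 = germ_at x f2"
      using near1[THEN bspec, of 1] near2[THEN bspec, of 0] f1 f2 x2 by (simp_all add: x_def)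
    then have "germ_at x f1 = germ_at x f2" using end_germ by simp
    then obtain T where T: "open T" "x \<in> T" "\<And>y. y \<in> T \<Longrightarrow> f1 y = f2 y"
      unfolding germ_at_eq_iff eventually_nhds by blast
    define V where "V = T \<inter> ball x r1"
    have V: "open V" "x \<in> V" using T f1(1) by (auto simp: V_def)
    have mid: "?\<gamma> t = x" by (subst 3) (simp add: joinpaths_def x_def)
    obtain \<rho> where \<rho>: "\<rho> > 0" "ball x \<rho> \<subseteq> V" using V open_contains_ball by blast
    have "continuous_on {0..1} ?\<gamma>" using path by (simp add: path_def)
    then obtain e3 where e3: "e3 > 0" "\<forall>s\<in>{0..1}. dist s t < e3 \<longrightarrow> dist (?\<gamma> s) (?\<gamma> t) < \<rho>"
      using t \<rho>(1) unfolding continuous_on_iff by blast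
    define e where "e = min e3 (min (e1 / 2) (e2 / 2))"
    have "?\<gamma> s \<in> V \<and> ?G s = germ_at (?\<gamma> s) f1" if s: "s \<in> {0..1}" "\<bar>s - t\<bar> < e" for s
    proof -
      have "dist (?\<gamma> s) x < \<rho>" using e3(2) s mid by (simp add: e_def dist_real_def)
      then have sV: "?\<gamma> s \<in> V" using \<rho>(2) by (auto simp: dist_commute)
      show ?thesis
      proof (cases "s \<le> 1/2")
        case True
        then have "2 * s \<in> {0..1}" "\<bar>2 * s - 1\<bar> < e1" using s 3 by (auto simp: e_def abs_less_iff)
        then show ?thesis using near1 True sV by (simp add: joinpaths_def)
      next
        case False
        then have "2 * s - 1 \<in> {0..1}" "\<bar>2 * s - 1 - 0\<bar> < e2" using s 3 by (auto simp: e_def abs_less_iff)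
        then have "?G s = germ_at (?\<gamma> s) f2" using near2 False by (simp add: joinpaths_def)
        also have "\<dots> = germ_at (?\<gamma> s) f1"
          using T sV by (intro germ_at_cong_open[of T]) (auto simp: V_def)
        finally show ?thesis using sV by simp
      qed
    qed
    moreover have "holomorphic_several_on f1 V"
      by (rule holomorphic_several_on_subset[OF f1(3) V(1)]) (simp add: V_def)
    moreover have "e > 0" using e3 f1 f2 by (simp add: e_def)
    ultimately show ?thesis using mid V(2)
      by (intro exI[of _ V] exI[of _ f1] exI[of _ e]) simp
  qed
qed

lemma continues_along_join:
  assumes "continues_along \<gamma>1 g h" "continues_along \<gamma>2 h k" "pathfinish \<gamma>1 = pathstart \<gamma>2"
  shows "continues_along (\<gamma>1 +++ \<gamma>2) g k"
proof -
  obtain G1 G2 where G: "continuation_family \<gamma>1 G1" "G1 0 = g" "G1 1 = h" "continuation_family \<gamma>2 G2" "G2 0 = h" "G2 1 = k"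
    using assms unfolding continues_along_iff by blast
  then have "continuation_family (\<gamma>1 +++ \<gamma>2) (\<lambda>t. if t \<le> 1/2 then G1 (2 * t) else G2 (2 * t - 1))"
    using assms(3) by (intro continuation_family_join) auto
  then show ?thesis unfolding continues_along_iff
    by (intro exI[of _ "\<lambda>t. if t \<le> 1/2 then G1 (2 * t) else G2 (2 * t - 1)"] conjI) (use G in simp_all)
qed

lemma continues_along_reversepath:
  assumes "continues_along \<gamma> g h" shows "continues_along (reversepath \<gamma>) h g"
proof -
  obtain G where G: "continuation_family \<gamma> G" "G 0 = g" "G 1 = h"
    using assms unfolding continues_along_iff by blast
  show ?thesis unfolding continues_along_iff
    by (rule exI[of _ "\<lambda>t. G (1 - t)"]) (use G continuation_family_reversepath[OF G(1)] in simp)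
qed

section \<open>Moving paths off thin sets\<close>

definition jointly_transported ::
  "('a::topological_space \<Rightarrow> complex poly) \<Rightarrow> 'a set \<Rightarrow> 'i set \<Rightarrow> 'a \<Rightarrow> ('i \<Rightarrow> complex) \<Rightarrow> 'a \<Rightarrow> ('i \<Rightarrow> complex) \<Rightarrow> bool" where
  "jointly_transported R X I x u y v \<longleftrightarrow> (\<exists>\<delta>. path \<delta> \<and> path_image \<delta> \<subseteq> X \<and> pathstart \<delta> = x \<and> pathfinish \<delta> = y \<and>
     (\<forall>i\<in>I. transports R \<delta> (u i) (v i)))"

lemma jointly_transported_trans:
  assumes "jointly_transported R X I x u y v" "jointly_transported R X I y v' z w" "\<And>i. i \<in> I \<Longrightarrow> v i = v' i"
  shows "jointly_transported R X I x u z w"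
proof -
  obtain \<delta> where \<delta>: "path \<delta>" "path_image \<delta> \<subseteq> X" "pathstart \<delta> = x" "pathfinish \<delta> = y" "\<forall>i\<in>I. transports R \<delta> (u i) (v i)"
    using assms(1) unfolding jointly_transported_def by blast
  obtain \<eta> where \<eta>: "path \<eta>" "path_image \<eta> \<subseteq> X" "pathstart \<eta> = y" "pathfinish \<eta> = z" "\<forall>i\<in>I. transports R \<eta> (v' i) (w i)"
    using assms(2) unfolding jointly_transported_def by blast
  have "\<forall>i\<in>I. transports R (\<delta> +++ \<eta>) (u i) (w i)"
    using \<delta>(5) \<eta>(5) assms(3) by (auto intro: transports_join)
  then show ?thesis unfolding jointly_transported_def
    using \<delta>(1-4) \<eta>(1-4) by (intro exI[of _ "\<delta> +++ \<eta>"]) (auto simp: path_image_join)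
qed

text \<open>
  The germs \<open>h i\<close> at \<open>x\<close> arise from the values \<open>y i\<close> at \<open>x1\<close>, in the sense that every point \<open>b\<close> near \<open>x\<close>
  off \<open>Z\<close> can be reached from \<open>x1\<close> by a path in \<open>S - Z\<close> that carries each \<open>y i\<close> to the value of \<open>h i\<close> at
  \<open>b\<close>. It is essential that one path serves all \<open>i\<close>: the resulting loops have to induce a given
  permutation of the germs.
\<close>

definition simultaneously_reached ::
  "(complex^'n::finite \<Rightarrow> complex poly) \<Rightarrow> (complex^'n) set \<Rightarrow> (complex^'n) set \<Rightarrow> complex^'n \<Rightarrow> 'i set \<Rightarrow> ('i \<Rightarrow> complex) \<Rightarrow>
    complex^'n \<Rightarrow> ('i \<Rightarrow> 'n germ) \<Rightarrow> bool" where
  "simultaneously_reached R Z S x1 I y x h \<longleftrightarrow> (\<exists>W k. open W \<and> x \<in> W \<and> (\<forall>i\<in>I. h i = germ_at x (k i)) \<and>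
     (\<forall>b\<in>W - Z. jointly_transported R (S - Z) I x1 y b (\<lambda>i. k i b)))"

lemma transports_off_thin:
  fixes f :: "'i \<Rightarrow> complex^'n::finite \<Rightarrow> complex"
  assumes Z: "thin Z" and sub: "ball x r \<subseteq> S" and c: "c \<in> ball x r - Z" and b: "b \<in> ball x r - Z"
    and f: "\<forall>i\<in>I. continuous_on (ball x r) (f i)" "\<forall>i\<in>I. \<forall>z\<in>ball x r. poly (R z) (f i z) = 0"
  shows "jointly_transported R (S - Z) I c (\<lambda>i. f i c) b (\<lambda>i. f i b)"
proof -
  obtain \<eta> where \<eta>: "path \<eta>" "path_image \<eta> \<subseteq> ball x r - Z" "pathstart \<eta> = c" "pathfinish \<eta> = b"
    using path_connected_ball_minus_thin[OF Z, of x r] c b unfolding path_connected_def by blast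
  have im: "path_image \<eta> \<subseteq> ball x r" using \<eta>(2) by blast
  have "transports R \<eta> (f i c) (f i b)" if i: "i \<in> I" for i
  proof -
    have "transports R \<eta> (f i (pathstart \<eta>)) (f i (pathfinish \<eta>))"
      using \<eta>(1) continuous_on_subset[OF bspec[OF f(1) i] im] bspec[OF f(2) i] im by (intro transports_section) auto
    then show ?thesis using \<eta> by simp
  qed
  moreover have "path_image \<eta> \<subseteq> S - Z" using \<eta>(2) sub by blast
  ultimately show ?thesis using \<eta> unfolding jointly_transported_def by blast
qed

lemma common_germ_neighbourhood:
  assumes "finite I" "\<And>i. i \<in> I \<Longrightarrow> germ_at x (f i) = germ_at x (g i)"
  shows "\<exists>T. open T \<and> x \<in> T \<and> (\<forall>i\<in>I. \<forall>y\<in>T. f i y = g i y)"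
proof -
  have "\<forall>\<^sub>F y in nhds x. \<forall>i\<in>I. f i y = g i y"
    using assms by (intro eventually_ball_finite) (auto simp: germ_at_eq_iff)
  then show ?thesis unfolding eventually_nhds by blast
qed

lemma common_local_continuation:
  assumes I: "finite I" and S: "open S" "\<gamma> t \<in> S" and t: "t \<in> {0..1}"
    and G: "\<forall>i\<in>I. continuation_family \<gamma> (G i)" and \<gamma>: "path \<gamma>"
  shows "\<exists>f r e. r > 0 \<and> e > 0 \<and> ball (\<gamma> t) r \<subseteq> S \<and> (\<forall>s\<in>{0..1}. \<bar>s - t\<bar> < e \<longrightarrow> \<gamma> s \<in> ball (\<gamma> t) r) \<and>
    (\<forall>i\<in>I. holomorphic_several_on (f i) (ball (\<gamma> t) r) \<and>
      (\<forall>s\<in>{0..1}. \<bar>s - t\<bar> < e \<longrightarrow> G i s = germ_at (\<gamma> s) (f i)))"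
proof -
  have "\<forall>i. \<exists>f r e. i \<in> I \<longrightarrow> r > 0 \<and> e > 0 \<and> holomorphic_several_on f (ball (\<gamma> t) r) \<and>
    (\<forall>s\<in>{0..1}. \<bar>s - t\<bar> < e \<longrightarrow> \<gamma> s \<in> ball (\<gamma> t) r \<and> G i s = germ_at (\<gamma> s) f)"
    using continuation_family_local[OF bspec[OF G] t] by blast
  from choice[OF this] obtain f where "\<forall>i. \<exists>r e. i \<in> I \<longrightarrow> r > 0 \<and> e > 0 \<and> holomorphic_several_on (f i) (ball (\<gamma> t) r) \<and>
    (\<forall>s\<in>{0..1}. \<bar>s - t\<bar> < e \<longrightarrow> \<gamma> s \<in> ball (\<gamma> t) r \<and> G i s = germ_at (\<gamma> s) (f i))" ..
  from choice[OF this] obtain r where "\<forall>i. \<exists>e. i \<in> I \<longrightarrow> r i > 0 \<and> e > 0 \<and> holomorphic_several_on (f i) (ball (\<gamma> t) (r i)) \<and>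
    (\<forall>s\<in>{0..1}. \<bar>s - t\<bar> < e \<longrightarrow> \<gamma> s \<in> ball (\<gamma> t) (r i) \<and> G i s = germ_at (\<gamma> s) (f i))" ..
  from choice[OF this] obtain e where fre: "\<forall>i. i \<in> I \<longrightarrow> r i > 0 \<and> e i > 0 \<and> holomorphic_several_on (f i) (ball (\<gamma> t) (r i)) \<and>
    (\<forall>s\<in>{0..1}. \<bar>s - t\<bar> < e i \<longrightarrow> \<gamma> s \<in> ball (\<gamma> t) (r i) \<and> G i s = germ_at (\<gamma> s) (f i))" ..
  obtain rS where rS: "rS > 0" "ball (\<gamma> t) rS \<subseteq> S" using S open_contains_ball by blast
  define r0 where "r0 = Min (insert rS (r ` I))"
  have r0: "r0 > 0" using I fre rS by (auto simp: r0_def)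
  have r0_le: "r0 \<le> r i" if "i \<in> I" for i using I that by (auto simp: r0_def)
  have "r0 \<le> rS" using I by (auto simp: r0_def)
  have "continuous_on {0..1} \<gamma>" using \<gamma> by (simp add: path_def)
  then obtain eS where eS: "eS > 0" "\<forall>s\<in>{0..1}. dist s t < eS \<longrightarrow> dist (\<gamma> s) (\<gamma> t) < r0"
    using t r0 unfolding continuous_on_iff by blast
  define e0 where "e0 = Min (insert eS (e ` I))"
  have e0: "e0 > 0" using I fre eS by (auto simp: e0_def)
  have e0_le: "e0 \<le> e i" if "i \<in> I" for i using I that by (auto simp: e0_def)
  have "e0 \<le> eS" using I by (auto simp: e0_def)
  show ?thesis
  proof (rule exI[of _ f], rule exI[of _ r0], rule exI[of _ e0], intro conjI ballI impI)
    show "ball (\<gamma> t) r0 \<subseteq> S" using rS(2) \<open>r0 \<le> rS\<close> by auto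
    show "\<gamma> s \<in> ball (\<gamma> t) r0" if "s \<in> {0..1}" "\<bar>s - t\<bar> < e0" for s
      using eS(2) that \<open>e0 \<le> eS\<close> by (simp add: dist_real_def dist_commute[of "\<gamma> t"])
    fix i assume i: "i \<in> I"
    have "ball (\<gamma> t) r0 \<subseteq> ball (\<gamma> t) (r i)" using r0_le[OF i] by auto
    then show "holomorphic_several_on (f i) (ball (\<gamma> t) r0)"
      using fre i holomorphic_several_on_subset[of "f i" "ball (\<gamma> t) (r i)"] by simp
    show "G i s = germ_at (\<gamma> s) (f i)" if "s \<in> {0..1}" "\<bar>s - t\<bar> < e0" for s
      using fre i e0_le[OF i] that by auto
  qed (use r0 e0 in auto)
qed

text \<open>
  Being reached is locally constant along \<open>\<gamma>\<close>, because balls in \<open>S\<close> remain path connected when \<open>Z\<close> is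
  removed. So continuation along a path in \<open>S\<close> that may meet \<open>Z\<close> has the effect of transport along a
  path in \<open>S - Z\<close>.
\<close>

lemma simultaneously_reached_continuation:
  fixes \<gamma> :: "real \<Rightarrow> complex^'n::finite"
  assumes R: "linewise_monic R n" and Z: "thin Z" and A: "transport_closed R Z A"
    and I: "finite I" and S: "open S" and \<gamma>: "path \<gamma>" "path_image \<gamma> \<subseteq> S"
    and G: "\<forall>i\<in>I. continuation_family \<gamma> (G i)"
    and br: "\<And>i. i \<in> I \<Longrightarrow> local_branch R Z A (\<gamma> 0) (G i 0)"
    and start: "simultaneously_reached R Z S x1 I y (\<gamma> 0) (\<lambda>i. G i 0)"
  shows "simultaneously_reached R Z S x1 I y (\<gamma> 1) (\<lambda>i. G i 1)"
proof (rule locally_constant_on_unit_interval[of "\<lambda>t. simultaneously_reached R Z S x1 I y (\<gamma> t) (\<lambda>i. G i t)" 0])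
  fix t :: real assume t: "t \<in> {0..1}"
  have "\<gamma> t \<in> S" using \<gamma>(2) t unfolding path_image_def by blast
  then obtain f r e where r: "r > 0" and e: "e > 0" and sub: "ball (\<gamma> t) r \<subseteq> S"
    and near: "\<forall>s\<in>{0..1}. \<bar>s - t\<bar> < e \<longrightarrow> \<gamma> s \<in> ball (\<gamma> t) r"
    and fG: "\<forall>i\<in>I. holomorphic_several_on (f i) (ball (\<gamma> t) r) \<and>
      (\<forall>s\<in>{0..1}. \<bar>s - t\<bar> < e \<longrightarrow> G i s = germ_at (\<gamma> s) (f i))"
    using common_local_continuation[OF I S _ t G \<gamma>(1)] by blast
  have cont: "\<forall>i\<in>I. continuous_on (ball (\<gamma> t) r) (f i)"
    using fG holomorphic_several_on_imp_continuous_on by blast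
  have root1: "poly (R z) (f i z) = 0" if i: "i \<in> I" and z: "z \<in> ball (\<gamma> t) r" for i z
  proof -
    have hol: "holomorphic_several_on (f i) (ball (\<gamma> t) r)" using fG i by blast
    have "local_branch R Z A (\<gamma> t) (G i t)"
      by (rule local_branch_continuation[OF R Z A bspec[OF G i] br[OF i] t])
    moreover have "G i t = germ_at (\<gamma> t) (f i)" using fG i t e by simp
    ultimately have "local_branch R Z A (\<gamma> t) (germ_at (\<gamma> t) (f i))" by simp
    then show ?thesis using local_branch_spreads(1)[OF R Z A hol _ _ z, of "\<gamma> t"] r by simp
  qed
  then have root: "\<forall>i\<in>I. \<forall>z\<in>ball (\<gamma> t) r. poly (R z) (f i z) = 0" by blast
  have move: "simultaneously_reached R Z S x1 I y (\<gamma> s') (\<lambda>i. G i s')"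
    if s: "s \<in> {0..1}" "\<bar>s - t\<bar> < e" "simultaneously_reached R Z S x1 I y (\<gamma> s) (\<lambda>i. G i s)"
      and s': "s' \<in> {0..1}" "\<bar>s' - t\<bar> < e" for s s'
  proof -
    obtain W k where W: "open W" "\<gamma> s \<in> W" and k: "\<forall>i\<in>I. G i s = germ_at (\<gamma> s) (k i)"
      and reach: "\<forall>b\<in>W - Z. jointly_transported R (S - Z) I x1 y b (\<lambda>i. k i b)"
      using s(3) unfolding simultaneously_reached_def by blast
    have "germ_at (\<gamma> s) (f i) = germ_at (\<gamma> s) (k i)" if "i \<in> I" for i
      using fG k that s(1,2) by auto
    then have "\<exists>T. open T \<and> \<gamma> s \<in> T \<and> (\<forall>i\<in>I. \<forall>y\<in>T. f i y = k i y)"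
      by (rule common_germ_neighbourhood[OF I])
    then obtain T where T: "open T" "\<gamma> s \<in> T" "\<forall>i\<in>I. \<forall>y\<in>T. f i y = k i y" by blast
    have "open (W \<inter> T \<inter> ball (\<gamma> t) r)" "\<gamma> s \<in> W \<inter> T \<inter> ball (\<gamma> t) r" using W T near s(1,2) by auto
    then obtain c where c: "c \<in> W \<inter> T \<inter> ball (\<gamma> t) r" "c \<notin> Z" by (rule thin_dense[OF Z])
    have ext: "jointly_transported R (S - Z) I x1 y b (\<lambda>i. f i b)" if b: "b \<in> ball (\<gamma> t) r - Z" for b
    proof (rule jointly_transported_trans)
      show "jointly_transported R (S - Z) I x1 y c (\<lambda>i. k i c)" using reach c by simp
      have "c \<in> ball (\<gamma> t) r - Z" using c by simp
      from transports_off_thin[OF Z sub this b cont root]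
      show "jointly_transported R (S - Z) I c (\<lambda>i. f i c) b (\<lambda>i. f i b)" .
      show "k i c = f i c" if "i \<in> I" for i using T(3) c(1) that by simp
    qed
    show ?thesis unfolding simultaneously_reached_def
    proof (rule exI[of _ "ball (\<gamma> t) r"], rule exI[of _ f], intro conjI)
      show "\<gamma> s' \<in> ball (\<gamma> t) r" using near s' by blast
      show "\<forall>i\<in>I. G i s' = germ_at (\<gamma> s') (f i)" using fG s' by simp
      show "\<forall>b\<in>ball (\<gamma> t) r - Z. jointly_transported R (S - Z) I x1 y b (\<lambda>i. f i b)"
        by (rule ballI) (rule ext)
    qed simp
  qed
  have "simultaneously_reached R Z S x1 I y (\<gamma> s) (\<lambda>i. G i s) = simultaneously_reached R Z S x1 I y (\<gamma> t) (\<lambda>i. G i t)"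
    if "s \<in> {0..1}" "\<bar>s - t\<bar> < e" for s
    using move[of s t] move[of t s] t that e by auto
  then show "\<exists>e>0. \<forall>s\<in>{0..1}. \<bar>s - t\<bar> < e \<longrightarrow>
      simultaneously_reached R Z S x1 I y (\<gamma> s) (\<lambda>i. G i s) = simultaneously_reached R Z S x1 I y (\<gamma> t) (\<lambda>i. G i t)"
    using e by blast
qed (use start in auto)

section \<open>The monodromy group\<close>

text \<open>
  Off the discriminant the roots are simple. So a solution germ is determined by its value, which is
  one of finitely many roots.
\<close>

lemma finite_solution_germs:
  fixes P :: "'n::finite mvpoly poly"
  assumes P: "entire_algebraic_equation P" and x: "x \<notin> discriminant_locus P"
  shows "finite (solution_germs P x)"
proof -
  define R where "R = equation_at P"
  note lm = linewise_monic_equation_at[OF P, folded R_def]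
  note R = linewise_monic_imp_monic_family[OF lm]
  have "resultant (R x) (pderiv (R x)) \<noteq> 0"
    using x unfolding discriminant_locus_def discriminant_def R_def by auto
  then have "card (roots (R x)) = degree P"
    using resultant_nonzero_card_roots monic_family_nonzero[OF R] monic_familyD(2)[OF R] by simp
  moreover have "card (roots (R x')) \<le> degree P" for x'
    using card_roots_le_degree(2)[OF monic_family_nonzero[OF R, of x']] monic_familyD(2)[OF R, of x'] by simp
  ultimately have card: "card (roots (R x')) \<le> card (roots (R x))" for x' by simp
  obtain e where e: "e > 0"
    "\<forall>v w y. poly (R x) v = 0 \<longrightarrow> poly (R x) w = 0 \<longrightarrow> dist y v < e \<longrightarrow> dist y w < e \<longrightarrow> v = w"
    using separated_roots[OF R] by blast
  have same: "germ_at x f = germ_at x g"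
    if f: "holomorphic_several_on f U" "x \<in> U" "\<And>z. z \<in> U \<Longrightarrow> poly (R z) (f z) = 0"
      and g: "holomorphic_several_on g V" "x \<in> V" "\<And>z. z \<in> V \<Longrightarrow> poly (R z) (g z) = 0" and eq: "f x = g x"
    for f g U V
  proof -
    have near: "\<forall>\<^sub>F z in nhds x. z \<in> U' \<and> dist (h z) (h x) < e" if h: "holomorphic_several_on h U'" "x \<in> U'" for h U'
    proof -
      have op: "open U'" using h(1) by (simp add: holomorphic_several_on_def)
      have "isCont h x"
        using holomorphic_several_on_imp_continuous_on[OF h(1)] continuous_on_eq_continuous_at[OF op] h(2) by blast
      then have "(h \<longlongrightarrow> h x) (nhds x)" unfolding isCont_def tendsto_at_iff_tendsto_nhds .
      then have "\<forall>\<^sub>F z in nhds x. dist (h z) (h x) < e" using e(1) by (rule tendstoD)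
      then show ?thesis using eventually_nhds_in_open[OF op h(2)] by (rule eventually_conj[rotated])
    qed
    have "\<forall>\<^sub>F z in nhds x. f z = g z"
      using near[OF f(1,2)] near[OF g(1,2)] eventually_all_roots_persist[OF R e(1), of x]
    proof eventually_elim
      case (elim z)
      have "\<exists>!y. poly (R z) y = 0 \<and> dist y (f x) < e"
        using e(2) elim(3) card f(2,3) by (intro unique_nearby_roots(3)[OF R e(1)]) blast+
      then show ?case using elim(1,2) f(3) g(3) eq by auto
    qed
    then show ?thesis by (simp add: germ_at_eq_iff)
  qed
  have "\<forall>g. \<exists>f. g \<in> solution_germs P x \<longrightarrow> (\<exists>U. g = germ_at x f \<and> holomorphic_several_on f U \<and> x \<in> U \<and> (\<forall>z\<in>U. poly (R z) (f z) = 0))"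
    unfolding solution_germs_def R_def by blast
  from choice[OF this] obtain s where s: "\<forall>g. g \<in> solution_germs P x \<longrightarrow>
      (\<exists>U. g = germ_at x (s g) \<and> holomorphic_several_on (s g) U \<and> x \<in> U \<and> (\<forall>z\<in>U. poly (R z) (s g z) = 0))" ..
  have "inj_on (\<lambda>g. s g x) (solution_germs P x)"
  proof (rule inj_onI)
    fix g h assume gh: "g \<in> solution_germs P x" "h \<in> solution_germs P x" "s g x = s h x"
    obtain U where U: "g = germ_at x (s g)" "holomorphic_several_on (s g) U" "x \<in> U" "\<forall>z\<in>U. poly (R z) (s g z) = 0"
      using s gh(1) by blast
    obtain V where V: "h = germ_at x (s h)" "holomorphic_several_on (s h) V" "x \<in> V" "\<forall>z\<in>V. poly (R z) (s h z) = 0"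
      using s gh(2) by blast
    have "germ_at x (s g) = germ_at x (s h)"
      by (rule same[OF U(2,3) _ V(2,3) _ gh(3)]) (use U V in auto)
    then show "g = h" using U(1) V(1) by simp
  qed
  moreover have "(\<lambda>g. s g x) ` solution_germs P x \<subseteq> roots (R x)" using s by blast
  ultimately show ?thesis using monic_family_finite_roots[OF R] inj_on_finite by blast
qed

lemma BijGroup_mult_apply:
  assumes "\<sigma> \<in> Bij S" "\<tau> \<in> Bij S" "g \<in> S"
  shows "(\<sigma> \<otimes>\<^bsub>BijGroup S\<^esub> \<tau>) g = \<sigma> (\<tau> g)"
  using assms by (simp add: BijGroup_def compose_def)

text \<open>
  Products, inverses and the identity are realised by joined, reversed and constant paths.
\<close>

lemma subgroup_monodromy:
  assumes x0: "x0 \<in> B - discriminant_locus P"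
  shows "subgroup (carrier (monodromy_group P B x0)) (BijGroup (solution_germs P x0))"
proof -
  define I where "I = solution_germs P x0"
  define realises where "realises = (\<lambda>\<gamma> \<sigma>. path \<gamma> \<and> path_image \<gamma> \<subseteq> B - discriminant_locus P \<and> pathstart \<gamma> = x0 \<and>
    pathfinish \<gamma> = x0 \<and> (\<forall>g\<in>I. continues_along \<gamma> g (\<sigma> g)))"
  have carrier: "carrier (monodromy_group P B x0) = {\<sigma> \<in> Bij I. \<exists>\<gamma>. realises \<gamma> \<sigma>}"
    by (simp add: monodromy_group_def I_def realises_def)
  interpret G: group "BijGroup I" by (rule group_BijGroup)
  have carG: "carrier (BijGroup I) = Bij I" by (simp add: BijGroup_def)
  have one: "\<one>\<^bsub>BijGroup I\<^esub> = (\<lambda>g\<in>I. g)" by (simp add: BijGroup_def)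
  have bij: "\<sigma> ` I = I" "inj_on \<sigma> I" if "\<sigma> \<in> Bij I" for \<sigma>
    using that by (auto simp: Bij_def bij_betw_def)
  have "subgroup {\<sigma> \<in> Bij I. \<exists>\<gamma>. realises \<gamma> \<sigma>} (BijGroup I)"
  proof (rule G.subgroupI)
    show "{\<sigma> \<in> Bij I. \<exists>\<gamma>. realises \<gamma> \<sigma>} \<subseteq> carrier (BijGroup I)" by (auto simp: carG)
    have "continues_along (\<lambda>_. x0) g g" if g: "g \<in> I" for g
    proof -
      obtain f U where f: "g = germ_at x0 f" "holomorphic_several_on f U" "x0 \<in> U"
        using g unfolding I_def solution_germs_def by blast
      show ?thesis unfolding continues_along_iff
        by (rule exI[of _ "\<lambda>_. g"]) (use continuation_family_const[OF f(2,3)] f(1) in simp)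
    qed
    then have "realises (\<lambda>_. x0) (\<lambda>g\<in>I. g)"
      using x0 by (auto simp: realises_def path_def path_image_def pathstart_def pathfinish_def)
    moreover have "(\<lambda>g\<in>I. g) \<in> Bij I" by (rule id_Bij)
    ultimately show "{\<sigma> \<in> Bij I. \<exists>\<gamma>. realises \<gamma> \<sigma>} \<noteq> {}" by blast
  next
    fix \<sigma> assume "\<sigma> \<in> {\<sigma> \<in> Bij I. \<exists>\<gamma>. realises \<gamma> \<sigma>}"
    then obtain \<gamma> where \<sigma>: "\<sigma> \<in> Bij I" and \<gamma>: "realises \<gamma> \<sigma>" by blast
    have inv: "inv\<^bsub>BijGroup I\<^esub> \<sigma> = (\<lambda>g\<in>I. inv_into I \<sigma> g)" by (rule inv_BijGroup[OF \<sigma>])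
    have "continues_along (reversepath \<gamma>) g (inv_into I \<sigma> g)" if g: "g \<in> I" for g
    proof -
      have "g \<in> \<sigma> ` I" using g bij(1)[OF \<sigma>] by simp
      then have "inv_into I \<sigma> g \<in> I" "\<sigma> (inv_into I \<sigma> g) = g"
        by (rule inv_into_into, rule f_inv_into_f)
      then have "continues_along \<gamma> (inv_into I \<sigma> g) g" using \<gamma> unfolding realises_def by metis
      then show ?thesis by (rule continues_along_reversepath)
    qed
    then have "realises (reversepath \<gamma>) (\<lambda>g\<in>I. inv_into I \<sigma> g)"
      using \<gamma> by (auto simp: realises_def)
    then show "inv\<^bsub>BijGroup I\<^esub> \<sigma> \<in> {\<sigma> \<in> Bij I. \<exists>\<gamma>. realises \<gamma> \<sigma>}"
      unfolding inv using restrict_inv_into_Bij[OF \<sigma>] by blast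
  next
    fix \<sigma> \<tau> assume "\<sigma> \<in> {\<sigma> \<in> Bij I. \<exists>\<gamma>. realises \<gamma> \<sigma>}" "\<tau> \<in> {\<sigma> \<in> Bij I. \<exists>\<gamma>. realises \<gamma> \<sigma>}"
    then obtain \<gamma> \<delta> where st: "\<sigma> \<in> Bij I" "\<tau> \<in> Bij I" and \<gamma>: "realises \<gamma> \<sigma>" and \<delta>: "realises \<delta> \<tau>" by blast
    have "continues_along (\<delta> +++ \<gamma>) g ((\<sigma> \<otimes>\<^bsub>BijGroup I\<^esub> \<tau>) g)" if g: "g \<in> I" for g
    proof -
      have "\<tau> g \<in> I" using bij(1)[OF st(2)] g by blast
      then have "continues_along \<gamma> (\<tau> g) (\<sigma> (\<tau> g))" using \<gamma> by (simp add: realises_def)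
      moreover have "continues_along \<delta> g (\<tau> g)" using \<delta> g by (simp add: realises_def)
      moreover have "pathfinish \<delta> = pathstart \<gamma>" using \<gamma> \<delta> by (simp add: realises_def)
      ultimately have "continues_along (\<delta> +++ \<gamma>) g (\<sigma> (\<tau> g))" using continues_along_join by blast
      then show ?thesis by (simp add: BijGroup_mult_apply[OF st g])
    qed
    then have "realises (\<delta> +++ \<gamma>) (\<sigma> \<otimes>\<^bsub>BijGroup I\<^esub> \<tau>)"
      using \<gamma> \<delta> by (auto simp: realises_def path_image_join)
    moreover have "\<sigma> \<otimes>\<^bsub>BijGroup I\<^esub> \<tau> \<in> Bij I" using G.m_closed[of \<sigma> \<tau>] st by (simp add: carG)
    ultimately show "\<sigma> \<otimes>\<^bsub>BijGroup I\<^esub> \<tau> \<in> {\<sigma> \<in> Bij I. \<exists>\<gamma>. realises \<gamma> \<sigma>}" by blast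
  qed
  then show ?thesis unfolding carrier unfolding I_def .
qed

text \<open>
  Every element of the monodromy group is realised by a loop off \<open>Z\<close> based at a point \<open>x1\<close> near \<open>x0\<close>,
  in the sense that transport along the loop maps the values at \<open>x1\<close> of the solutions as the element
  maps their germs. Hence elements of the \<open>d\<close>-th derived subgroup are realised by loops of depth \<open>d\<close>,
  which act trivially on the values and so on the germs.
\<close>

lemma solvable_monodromy_group:
  fixes P :: "'n::finite mvpoly poly"
  assumes P: "entire_algebraic_equation P" and T: "tame_branches R Z A"
    and br: "\<And>g. g \<in> solution_germs P x0 \<Longrightarrow> local_branch R Z A x0 g"
    and x0: "x0 \<in> ball p r - discriminant_locus P"
    and fixA: "\<And>x y \<gamma>. (x, y) \<in> A \<Longrightarrow> derived_loop (ball p r - Z) x d \<gamma> \<Longrightarrow> transports R \<gamma> y y"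
  shows "solvable (monodromy_group P (ball p r) x0)"
proof -
  define I where "I = solution_germs P x0"
  define S where "S = ball p r"
  define M where "M = monodromy_group P S x0"
  obtain n where R: "linewise_monic R n" using tame_branchesD(1)[OF T] by blast
  note R' = linewise_monic_imp_monic_family[OF R]
  note Z = tame_branchesD(2)[OF T] and LZ = tame_branchesD(3)[OF T] and A = tame_branchesD(6)[OF T]
  have finI: "finite I" unfolding I_def using x0 by (intro finite_solution_germs[OF P]) simp
  have "\<forall>g. \<exists>f U. g \<in> I \<longrightarrow> open U \<and> x0 \<in> U \<and> continuous_on U f \<and> g = germ_at x0 f \<and>
      (\<forall>b\<in>U. poly (R b) (f b) = 0) \<and> (\<forall>b\<in>U - Z. (b, f b) \<in> A)"
    using br unfolding I_def local_branch_def by blast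
  from choice[OF this] obtain f where "\<forall>g. \<exists>U. g \<in> I \<longrightarrow> open U \<and> x0 \<in> U \<and> continuous_on U (f g) \<and> g = germ_at x0 (f g) \<and>
      (\<forall>b\<in>U. poly (R b) (f g b) = 0) \<and> (\<forall>b\<in>U - Z. (b, f g b) \<in> A)" ..
  from choice[OF this] obtain U where fU: "\<forall>g. g \<in> I \<longrightarrow> open (U g) \<and> x0 \<in> U g \<and> continuous_on (U g) (f g) \<and> g = germ_at x0 (f g) \<and>
      (\<forall>b\<in>U g. poly (R b) (f g b) = 0) \<and> (\<forall>b\<in>U g - Z. (b, f g b) \<in> A)" ..
  define V where "V = S \<inter> (\<Inter>g\<in>I. U g)"
  have "open V" unfolding V_def S_def using fU finI by (intro open_Int open_INT) auto
  moreover have "x0 \<in> V" using fU x0 by (auto simp: V_def S_def)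
  ultimately obtain \<rho> where \<rho>: "\<rho> > 0" "ball x0 \<rho> \<subseteq> V" using open_contains_ball by blast
  define B where "B = ball x0 \<rho>"
  have BS: "B \<subseteq> S" using \<rho> by (auto simp: B_def V_def)
  have x0B: "x0 \<in> B" and opB: "open B" using \<rho> by (auto simp: B_def)
  have BU: "B \<subseteq> U g" if "g \<in> I" for g using \<rho> that by (auto simp: B_def V_def)
  have germ: "g = germ_at x0 (f g)" if "g \<in> I" for g using fU that by blast
  have cont: "continuous_on B (f g)" if g: "g \<in> I" for g
    using fU g continuous_on_subset[OF _ BU[OF g], of "f g"] by simp
  have root: "poly (R b) (f g b) = 0" if "g \<in> I" "b \<in> B" for g b using fU that BU[OF that(1)] by auto
  have inA: "(b, f g b) \<in> A" if "g \<in> I" "b \<in> B" "b \<notin> Z" for g b using fU that BU[OF that(1)] by auto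
  obtain x1 where x1: "x1 \<in> B" "x1 \<notin> Z" using thin_dense[OF Z opB x0B] by blast
  define y where "y = (\<lambda>g. f g x1)"
  (* The germ g is represented by f g on the ball B and by its value y g at x1. *)
  define realised where "realised = (\<lambda>k \<sigma>. \<exists>\<gamma>. derived_loop (S - Z) x1 k \<gamma> \<and> (\<forall>g\<in>I. transports R \<gamma> (y g) (y (\<sigma> g))))"

  have sub: "subgroup (carrier M) (BijGroup I)"
    unfolding M_def I_def S_def by (rule subgroup_monodromy[OF x0])
  have M_eq: "M = (BijGroup I)\<lparr>carrier := carrier M\<rparr>"
    by (simp add: M_def monodromy_group_def I_def)
  interpret M: group M
    using subgroup.subgroup_is_group[OF sub group_BijGroup] M_eq by simp
  have Bij: "\<sigma> \<in> Bij I" if "\<sigma> \<in> carrier M" for \<sigma>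
    using that subgroup.subset[OF sub] by (auto simp: BijGroup_def)
  have ext: "\<sigma> g \<in> I" if "\<sigma> \<in> carrier M" "g \<in> I" for \<sigma> g
    using Bij_imp_funcset[OF Bij[OF that(1)]] that(2) by (auto simp: Pi_def)
  have mult_M: "mult M = mult (BijGroup I)" by (subst M_eq) simp
  have one_M: "\<one>\<^bsub>M\<^esub> = (\<lambda>g\<in>I. g)" by (subst M_eq) (simp add: BijGroup_def)
  have mult: "(\<sigma> \<otimes>\<^bsub>M\<^esub> \<tau>) g = \<sigma> (\<tau> g)" if "\<sigma> \<in> carrier M" "\<tau> \<in> carrier M" "g \<in> I" for \<sigma> \<tau> g
    unfolding mult_M using that Bij by (intro BijGroup_mult_apply) auto
  have inv: "\<sigma> ((inv\<^bsub>M\<^esub> \<sigma>) g) = g" if "\<sigma> \<in> carrier M" "g \<in> I" for \<sigma> g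
    using mult[OF that(1) M.inv_closed[OF that(1)] that(2)] M.r_inv[OF that(1)] one_M that(2) by simp

  (* The loop of a monodromy element may meet Z; it is replaced by one that does not. *)
  have real0: "realised 0 \<sigma>" if \<sigma>: "\<sigma> \<in> carrier M" for \<sigma>
  proof -
    obtain \<gamma> where \<gamma>: "path \<gamma>" "path_image \<gamma> \<subseteq> S - discriminant_locus P" "pathstart \<gamma> = x0" "pathfinish \<gamma> = x0"
      and c\<gamma>: "\<forall>g\<in>I. continues_along \<gamma> g (\<sigma> g)"
      using \<sigma> unfolding M_def monodromy_group_def I_def by auto
    have "\<forall>g. \<exists>G. g \<in> I \<longrightarrow> continuation_family \<gamma> G \<and> G 0 = g \<and> G 1 = \<sigma> g"
      using c\<gamma> unfolding continues_along_iff by blast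
    from choice[OF this] obtain G where G: "\<forall>g. g \<in> I \<longrightarrow> continuation_family \<gamma> (G g) \<and> G g 0 = g \<and> G g 1 = \<sigma> g" ..
    have \<gamma>01: "\<gamma> 0 = x0" "\<gamma> 1 = x0" using \<gamma>(3,4) by (simp_all add: pathstart_def pathfinish_def)
    have conts: "\<forall>g\<in>I. continuous_on (ball x0 \<rho>) (f g)" using cont by (simp add: B_def)
    have roots: "\<forall>g\<in>I. \<forall>z\<in>ball x0 \<rho>. poly (R z) (f g z) = 0" using root by (simp add: B_def)
    have BS': "ball x0 \<rho> \<subseteq> S" using BS by (simp add: B_def)
    have start: "simultaneously_reached R Z S x1 I y (\<gamma> 0) (\<lambda>g. G g 0)"
      unfolding simultaneously_reached_def
    proof (rule exI[of _ B], rule exI[of _ f], intro conjI ballI)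
      show "open B" "\<gamma> 0 \<in> B" using opB x0B \<gamma>01 by simp_all
      show "G g 0 = germ_at (\<gamma> 0) (f g)" if "g \<in> I" for g using G germ[OF that] that \<gamma>01 by simp
      fix b assume "b \<in> B - Z"
      then have b: "b \<in> ball x0 \<rho> - Z" by (simp add: B_def)
      have x1': "x1 \<in> ball x0 \<rho> - Z" using x1 by (simp add: B_def)
      show "jointly_transported R (S - Z) I x1 y b (\<lambda>g. f g b)"
        unfolding y_def by (rule transports_off_thin[OF Z BS' x1' b conts roots])
    qed
    have "simultaneously_reached R Z S x1 I y (\<gamma> 1) (\<lambda>g. G g 1)"
    proof (rule simultaneously_reached_continuation[where G = G and \<gamma> = \<gamma> and n = n and A = A])
      show "open S" by (simp add: S_def)
      show "path_image \<gamma> \<subseteq> S" using \<gamma>(2) by blast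
      show "\<forall>g\<in>I. continuation_family \<gamma> (G g)" using G by blast
      show "local_branch R Z A (\<gamma> 0) (G g 0)" if "g \<in> I" for g
        using G that \<gamma>01 br by (simp add: I_def)
    qed (rule R Z A finI \<gamma>(1) start)+
    then obtain W k where W: "open W" "x0 \<in> W" and k: "\<forall>g\<in>I. G g 1 = germ_at x0 (k g)"
      and reach: "\<forall>b\<in>W - Z. jointly_transported R (S - Z) I x1 y b (\<lambda>g. k g b)"
      unfolding simultaneously_reached_def \<gamma>01 by blast
    have "germ_at x0 (k g) = germ_at x0 (f (\<sigma> g))" if g: "g \<in> I" for g
      using k G g germ[OF ext[OF \<sigma> g]] by simp
    then have "\<exists>T. open T \<and> x0 \<in> T \<and> (\<forall>g\<in>I. \<forall>z\<in>T. k g z = f (\<sigma> g) z)"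
      by (rule common_germ_neighbourhood[OF finI])
    then obtain T where T: "open T" "x0 \<in> T" "\<forall>g\<in>I. \<forall>z\<in>T. k g z = f (\<sigma> g) z" by blast
    have "open (W \<inter> T \<inter> B)" "x0 \<in> W \<inter> T \<inter> B" using W T opB x0B by auto
    then obtain c where c: "c \<in> W \<inter> T \<inter> B" "c \<notin> Z" by (rule thin_dense[OF Z])
    have c': "c \<in> ball x0 \<rho> - Z" and x1': "x1 \<in> ball x0 \<rho> - Z" using c x1 by (simp_all add: B_def)
    have conts': "\<forall>g\<in>I. continuous_on (ball x0 \<rho>) (f (\<sigma> g))" using conts ext[OF \<sigma>] by blast
    have roots': "\<forall>g\<in>I. \<forall>z\<in>ball x0 \<rho>. poly (R z) (f (\<sigma> g) z) = 0" using roots ext[OF \<sigma>] by blast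
    have "jointly_transported R (S - Z) I x1 y x1 (\<lambda>g. y (\<sigma> g))"
    proof (rule jointly_transported_trans)
      show "jointly_transported R (S - Z) I x1 y c (\<lambda>g. k g c)" using reach c by simp
      show "jointly_transported R (S - Z) I c (\<lambda>g. f (\<sigma> g) c) x1 (\<lambda>g. y (\<sigma> g))"
        unfolding y_def by (rule transports_off_thin[OF Z BS' c' x1' conts' roots'])
      show "k g c = f (\<sigma> g) c" if "g \<in> I" for g using T(3) c(1) that by blast
    qed
    then show ?thesis unfolding realised_def jointly_transported_def by (blast intro: derived_loop.loop)
  qed

  have commutator: "realised (Suc k) (h1 \<otimes>\<^bsub>M\<^esub> h2 \<otimes>\<^bsub>M\<^esub> inv\<^bsub>M\<^esub> h1 \<otimes>\<^bsub>M\<^esub> inv\<^bsub>M\<^esub> h2)"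
    if h: "h1 \<in> carrier M" "h2 \<in> carrier M" and r: "realised k h1" "realised k h2" for h1 h2 k
  proof -
    obtain \<gamma>1 where \<gamma>1: "derived_loop (S - Z) x1 k \<gamma>1" "\<forall>g\<in>I. transports R \<gamma>1 (y g) (y (h1 g))"
      using r(1) unfolding realised_def by blast
    obtain \<gamma>2 where \<gamma>2: "derived_loop (S - Z) x1 k \<gamma>2" "\<forall>g\<in>I. transports R \<gamma>2 (y g) (y (h2 g))"
      using r(2) unfolding realised_def by blast
    have "transports R (loop_commutator \<gamma>2 \<gamma>1) (y g)
        (y ((h1 \<otimes>\<^bsub>M\<^esub> h2 \<otimes>\<^bsub>M\<^esub> inv\<^bsub>M\<^esub> h1 \<otimes>\<^bsub>M\<^esub> inv\<^bsub>M\<^esub> h2) g))" if g: "g \<in> I" for g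
    proof -
      define g1 where "g1 = (inv\<^bsub>M\<^esub> h2) g"
      define g2 where "g2 = (inv\<^bsub>M\<^esub> h1) g1"
      have g1: "g1 \<in> I" "h2 g1 = g" using ext inv h g by (auto simp: g1_def)
      have g2: "g2 \<in> I" "h1 g2 = g1" using ext inv h g1(1) by (auto simp: g2_def)
      have "(h1 \<otimes>\<^bsub>M\<^esub> h2 \<otimes>\<^bsub>M\<^esub> inv\<^bsub>M\<^esub> h1 \<otimes>\<^bsub>M\<^esub> inv\<^bsub>M\<^esub> h2) g = h1 (h2 g2)"
        using h g g1 g2 by (simp add: mult g1_def[symmetric] g2_def[symmetric])
      moreover have "transports R (reversepath \<gamma>2) (y g) (y g1)"
        using \<gamma>2(2) g1 by (intro transports_reversepath) auto
      moreover have "transports R (reversepath \<gamma>1) (y g1) (y g2)"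
        using \<gamma>1(2) g2 by (intro transports_reversepath) auto
      moreover have "transports R \<gamma>2 (y g2) (y (h2 g2))" using \<gamma>2(2) g2 by blast
      moreover have "transports R \<gamma>1 (y (h2 g2)) (y (h1 (h2 g2)))" using \<gamma>1(2) ext[OF h(2) g2(1)] by blast
      ultimately show ?thesis by (simp add: transports_join)
    qed
    moreover have "derived_loop (S - Z) x1 (Suc k) (loop_commutator \<gamma>2 \<gamma>1)"
      by (rule derived_loop.commutator[OF \<gamma>2(1) \<gamma>1(1)])
    ultimately show ?thesis unfolding realised_def by blast
  qed

  have real: "\<forall>\<sigma>\<in>(derived M ^^ k) (carrier M). realised k \<sigma>" for k
  proof (induction k)
    case 0
    then show ?case using real0 by simp
  next
    case (Suc k)
    define H where "H = (derived M ^^ k) (carrier M)"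
    have HM: "H \<subseteq> carrier M" unfolding H_def by (rule M.exp_of_derived_in_carrier) simp
    have "realised (Suc k) \<sigma>" if "\<sigma> \<in> generate M (derived_set M H)" for \<sigma>
      using that
    proof induction
      case one
      have "transports R (\<lambda>_. x1) (y g) (y (\<one>\<^bsub>M\<^esub> g))" if "g \<in> I" for g
        using root[OF that x1(1)] that by (simp add: one_M y_def transports_const)
      moreover have "derived_loop (S - Z) x1 (Suc k) (\<lambda>_. x1)"
        using x1 BS by (intro derived_loop.const) auto
      ultimately show ?case unfolding realised_def by blast
    next
      case (incl h)
      then show ?case using Suc.IH HM by (auto simp: H_def intro!: commutator)
    next
      case (inv h)
      then obtain h1 h2 where h: "h1 \<in> H" "h2 \<in> H" "h = h1 \<otimes>\<^bsub>M\<^esub> h2 \<otimes>\<^bsub>M\<^esub> inv\<^bsub>M\<^esub> h1 \<otimes>\<^bsub>M\<^esub> inv\<^bsub>M\<^esub> h2" by auto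
      have c: "h1 \<in> carrier M" "h2 \<in> carrier M" using h HM by auto
      have "inv\<^bsub>M\<^esub> h = h2 \<otimes>\<^bsub>M\<^esub> h1 \<otimes>\<^bsub>M\<^esub> inv\<^bsub>M\<^esub> h2 \<otimes>\<^bsub>M\<^esub> inv\<^bsub>M\<^esub> h1"
        unfolding h(3) using c by (simp add: M.inv_mult_group M.m_assoc)
      then show ?case using commutator[OF c(2,1)] Suc.IH h by (simp add: H_def)
    next
      case (eng h1 h2)
      have "derived_set M H \<subseteq> carrier M" by (rule M.derived_set_in_carrier[OF HM])
      then have c: "h1 \<in> carrier M" "h2 \<in> carrier M"
        using eng.hyps M.generate_in_carrier by blast+
      obtain \<gamma>1 where \<gamma>1: "derived_loop (S - Z) x1 (Suc k) \<gamma>1" "\<forall>g\<in>I. transports R \<gamma>1 (y g) (y (h1 g))"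
        using eng.IH(1) unfolding realised_def by blast
      obtain \<gamma>2 where \<gamma>2: "derived_loop (S - Z) x1 (Suc k) \<gamma>2" "\<forall>g\<in>I. transports R \<gamma>2 (y g) (y (h2 g))"
        using eng.IH(2) unfolding realised_def by blast
      have "transports R (\<gamma>2 +++ \<gamma>1) (y g) (y ((h1 \<otimes>\<^bsub>M\<^esub> h2) g))" if g: "g \<in> I" for g
        unfolding mult[OF c g]
      proof (rule transports_join)
        show "transports R \<gamma>2 (y g) (y (h2 g))" using \<gamma>2(2) g by blast
        show "transports R \<gamma>1 (y (h2 g)) (y (h1 (h2 g)))" using \<gamma>1(2) ext[OF c(2) g] by blast
      qed
      moreover have "derived_loop (S - Z) x1 (Suc k) (\<gamma>2 +++ \<gamma>1)" by (rule derived_loop.join[OF \<gamma>2(1) \<gamma>1(1)])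
      ultimately show ?case unfolding realised_def by blast
    qed
    moreover have "(derived M ^^ Suc k) (carrier M) = generate M (derived_set M H)"
      unfolding derived_def[symmetric] by (simp add: H_def)
    ultimately show ?case by simp
  qed

  (* Solutions on B with the same value at x1 agree off Z by uniqueness of transport, and on B by
     continuity. *)
  have sections_eq: "g = h" if g: "g \<in> I" and h: "h \<in> I" and eq: "y g = y h" for g h
  proof -
    have off: "f g b = f h b" if b: "b \<in> B" "b \<notin> Z" for b
    proof -
      have "x1 \<in> ball x0 \<rho> - Z" "b \<in> ball x0 \<rho> - Z" using x1 b by (simp_all add: B_def)
      then obtain \<gamma> where \<gamma>: "path \<gamma>" "path_image \<gamma> \<subseteq> ball x0 \<rho> - Z" "pathstart \<gamma> = x1" "pathfinish \<gamma> = b"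
        using path_connected_ball_minus_thin[OF Z, of x0 \<rho>] unfolding path_connected_def by blast
      have im: "path_image \<gamma> \<subseteq> B" using \<gamma>(2) by (auto simp: B_def)
      have "transports R \<gamma> (f g' x1) (f g' b)" if g': "g' \<in> I" for g'
      proof -
        have "transports R \<gamma> (f g' (pathstart \<gamma>)) (f g' (pathfinish \<gamma>))"
          using \<gamma>(1) continuous_on_subset[OF cont[OF g'] im] root[OF g'] im by (intro transports_section) auto
        then show ?thesis using \<gamma>(3,4) by simp
      qed
      from this[OF g] this[OF h] have "transports R \<gamma> (y g) (f g b)" "transports R \<gamma> (y g) (f h b)"
        using eq by (simp_all add: y_def)
      moreover have "path_image \<gamma> \<subseteq> - branch_locus R" using \<gamma>(2) LZ by blast
      ultimately show ?thesis using transports_unique[OF R' \<gamma>(1)] by blast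
    qed
    have "f g b = f h b" if b: "b \<in> B" for b
    proof (rule ccontr)
      assume ne: "f g b \<noteq> f h b"
      have "continuous_on B (\<lambda>z. f g z - f h z)" using cont g h by (intro continuous_intros) auto
      then have "open (B \<inter> (\<lambda>z. f g z - f h z) -` (- {0}))"
        using opB by (intro continuous_open_preimage) auto
      moreover have "b \<in> B \<inter> (\<lambda>z. f g z - f h z) -` (- {0})" using b ne by simp
      ultimately obtain c where "c \<in> B \<inter> (\<lambda>z. f g z - f h z) -` (- {0})" "c \<notin> Z" by (rule thin_dense[OF Z])
      then show False using off by auto
    qed
    then have "germ_at x0 (f g) = germ_at x0 (f h)" using x0B by (intro germ_at_cong_open[OF opB]) auto
    then show ?thesis using germ[OF g] germ[OF h] by simp
  qed

  have "(derived M ^^ d) (carrier M) = {\<one>\<^bsub>M\<^esub>}"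
  proof
    show "{\<one>\<^bsub>M\<^esub>} \<subseteq> (derived M ^^ d) (carrier M)"
      using subgroup.one_closed[OF M.exp_of_derived_is_subgroup[OF M.subgroup_self]] by simp
    show "(derived M ^^ d) (carrier M) \<subseteq> {\<one>\<^bsub>M\<^esub>}"
    proof
      fix \<sigma> assume \<sigma>: "\<sigma> \<in> (derived M ^^ d) (carrier M)"
      have \<sigma>M: "\<sigma> \<in> carrier M" using \<sigma> M.exp_of_derived_in_carrier[of "carrier M" d] by blast
      obtain \<gamma> where \<gamma>: "derived_loop (S - Z) x1 d \<gamma>" "\<forall>g\<in>I. transports R \<gamma> (y g) (y (\<sigma> g))"
        using real \<sigma> unfolding realised_def by blast
      have loop: "path \<gamma>" "path_image \<gamma> \<subseteq> - branch_locus R"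
        using derived_loop_imp_loop[OF \<gamma>(1)] LZ by auto
      have "\<sigma> g = g" if g: "g \<in> I" for g
      proof -
        have "transports R \<gamma> (y g) (y g)"
          using fixA[OF inA[OF g x1]] \<gamma>(1) by (simp add: y_def S_def)
        then have "y (\<sigma> g) = y g" using transports_unique[OF R' loop] \<gamma>(2) g by blast
        then show ?thesis by (rule sections_eq[OF ext[OF \<sigma>M g] g])
      qed
      then have "\<sigma> = \<one>\<^bsub>M\<^esub>"
        unfolding one_M using Bij_imp_extensional[OF Bij[OF \<sigma>M]] by (intro extensionalityI[of _ I]) auto
      then show "\<sigma> \<in> {\<one>\<^bsub>M\<^esub>}" by simp
    qed
  qed
  then have "solvable M" using M.solvable_iff_trivial_derived_seq by blast
  then show ?thesis by (simp add: M_def S_def)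
qed

theorem theorem3p9:
  fixes P :: "'n::finite mvpoly poly"
  assumes "entire_algebraic_equation P"
    and "algebraic_multifun P \<in> compositions"
  shows "\<forall>p. solvable_local_monodromy_at P p"
proof
  fix p
  obtain R Z A where T: "tame_branches R Z A" and br: "\<And>x h. (x, h) \<in> algebraic_multifun P \<Longrightarrow> local_branch R Z A x h"
    using compositions_tame[OF assms(2)] unfolding tame_def by blast
  obtain e d where e: "e > 0" and fixA: "\<forall>x y \<gamma>. (x, y) \<in> A \<longrightarrow> derived_loop (ball p e - Z) x d \<gamma> \<longrightarrow> transports R \<gamma> y y"
    using tame_branchesD(7)[OF T, of p] unfolding loops_trivial_near_def by blast
  have "solvable (monodromy_group P (ball p r) x0)"
    if r: "r < e" and x0: "x0 \<in> ball p r - discriminant_locus P" for r x0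
  proof (rule solvable_monodromy_group[OF assms(1) T _ x0])
    show "local_branch R Z A x0 g" if "g \<in> solution_germs P x0" for g
      using that by (intro br) (simp add: algebraic_multifun_def)
    fix x y \<gamma> assume "(x, y) \<in> A" "derived_loop (ball p r - Z) x d \<gamma>"
    moreover have "ball p r - Z \<subseteq> ball p e - Z" using r by auto
    ultimately show "transports R \<gamma> y y" using fixA derived_loop_mono by blast
  qed
  then show "solvable_local_monodromy_at P p"
    unfolding solvable_local_monodromy_at_def eventually_at_right_field using e by blast
qed


end
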